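(* Suppose that there exist $\nu_0\in[0,\nu_* )$ and $h_0\in\mathbb W$ such that $F(\nu_0,h_0)=0$ and either $D_hF|_{\nu_0,h_0}$ is invertible, or the following three conditions hold: \begin{itemize} \item $\operatorname{Range}(D_hF|_{\nu_0,h_0})\oplus \operatorname{span}\{D_\nu F|_{\nu_0,h_0}\}=\mathbb V$; \item $\int\alpha\, D_h^2F|_{\nu_0,h_0}\big(\Theta(\nu_0,h_0),\Theta(\nu_0,h_0)\big)\neq 0$; \item $\int\alpha h_0\neq 0$. \end{itemize} Then there exist $\delta>0$ and a map $(G,\mathbf h):(-\delta,\delta)\to[0,\nu_*]\times\mathbb W$, differentiable in the $\mathcal B_1$ topology, with $(G(0),\mathbf h(0))=(\nu_0,h_0)$, such that all the solutions of the equation $F(\nu,h)=0$ in $\{(\nu,h)\in[0,\nu_*]\times\mathbb W:\ |\nu-\nu_0|+\|h-h_0\|_{\mathcal B_1}\le\delta\}$ belong to the set $\{(G(\tau),\mathbf h(\tau)):\tau\in(-\delta,\delta)\}$. In addition, if $D_hF|_{\nu_0,h_0}$ is invertible, then for each $\nu$ in a neighborhood of $\nu_0$, the equation $F(\nu,h)=0$ has a unique solution. If instead $\nu_0>0$ and $D_hF|_{\nu_0,h_0}$ is not invertible, then there exists $\nu\in(0,\nu_* )$ for which the equation $F(\nu,h)=0$ has at least two solutions.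
   Context: Setting. Let $\mathbb T^d=\mathbb R^d/\mathbb Z^d$, with Lebesgue measure $m$; fix an integer $\bar r>12$, $T\in C^\infty(\mathbb T^d,\mathbb T^d)$, $\alpha\in C^\infty(\mathbb T^d,\mathbb R)$, $\beta\in C^\infty(\mathbb T^d,\mathbb R^d)$. For a distribution $h\in C^{\bar r}(\mathbb T^d,\mathbb R)'$ and $\varphi\in C^{\bar r}$ write $\int\varphi h:=h(\varphi)$; functions $h\in L^1$ are identified with $\varphi\mapsto\int\varphi h\,dm$; $h\ge0$ means $\int h\varphi\ge0$ for all $\varphi\ge0$ in $C^{\bar r}$. For $\nu\in\mathbb R$ and $h\in C^{\bar r}(\mathbb T^d,\mathbb R)'$ with $h(1)=1$ let $T_{\nu,h}(x)=T(x)+\nu\beta(x)\,h(\alpha)\bmod 1$. The transfer operator $\mathcal L_S$ of a map $S:\mathbb T^d\to\mathbb T^d$ is defined on distributions by $\int g\,\mathcal L_Sh=\int g\circ S\,h$; its restrictions to subspaces are denoted by the same symbol. $\widetilde{\mathcal L}_\nu(h):=\mathcal L_{T_{\nu,h}}h$. $L(X,Y)$ denotes the bounded linear operators from $X$ to $Y$. Standing assumptions. $\mathcal T\subset C^{\bar r}(\mathbb T^d,\mathbb T^d)$ is a set of surjective maps closed under composition, and $\nu_*>0$ is such that $T_{\nu,h}\in\mathcal T$ for all $\nu\in[0,\nu_*]$ and all probability measures $h$. $\mathcal B_0,\dots,\mathcal B_3$ are Banach spaces with $C^{\bar r}(\mathbb T^d,\mathbb R)'\supset\mathcal B_0\supset\mathcal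 B_1\supset\mathcal B_2\supset\mathcal B_3\supset C^{\bar r}(\mathbb T^d,\mathbb R)$ and $C^{\bar r}(\mathbb T^d,\mathbb R)'\supset\mathcal B_3'\supset\mathcal B_2'\supset\mathcal B_1'\supset\mathcal B_0'\supset C^{\bar r}(\mathbb T^d,\mathbb R)$ (one-to-one embeddings extending $h\mapsto(\phi\mapsto\int h\phi)$, and $\|\cdot\|_{\mathcal B_i}\le\|\cdot\|_{\mathcal B_{i+1}}$), $C^{\bar r}(\mathbb T^d,\mathbb R)$ being dense in each $\mathcal B_i$ and $\mathcal B_i'$. For a fixed, large enough $K_\star>0$, $$\mathbb W=\{h\in\mathcal B_1:\|h\|_{\mathcal B_1}\le K_\star,\ h\ge0,\ \textstyle\int h=1\},\qquad \mathbb V=\{f\in\mathcal B_1:\textstyle\int f=0\}.$$ There are $K,C_*\ge1$, $\bar c,\hat c>0$, $\vartheta\in(0,1)$ such that: (A1) $\mathcal L_S\in L(\mathcal B_i,\mathcal B_i)$ for all $S\in\mathcal T$, $i\in\{0,\dots,3\}$. (A2) $\partial_{x_k}\in L(\mathcal B_{i+1},\mathcal B_i)$ for $k\in\{1,\dots,d\}$, $i\in\{0,1,2\}$. (A3) $\|ah\|_{\mathcal B_i}\le C_*\|a\|_{C^{\bar ci+\hat c}}\|h\|_{\mathcal B_i}$ for $a\in C^{\bar ci+\hat c}$, and $|\int h|\le C_*\|h\|_{\mathcal B_0}$. (A4) The unit ball of $\mathcal B_{i+1}$ is relatively compact in $\mathcal B_i$, $i\in\{0,1,2\}$. (A5) For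 all $n\in\mathbb N$, $S_1,\dots,S_n\in\mathcal T$, $i\in\{1,2,3\}$, $\phi\in\mathcal B_i$: $\|\mathcal L_{S_n}\cdots\mathcal L_{S_1}\phi\|_{\mathcal B_0}\le C_*\|\phi\|_{\mathcal B_0}$ and $\|\mathcal L_{S_n}\cdots\mathcal L_{S_1}\phi\|_{\mathcal B_i}\le C_*\vartheta^n\|\phi\|_{\mathcal B_i}+K\|\phi\|_{\mathcal B_{i-1}}$. (A6) There is $\bar n\in\mathbb N$ such that for all $n\ge\bar n$, $S_1,\dots,S_n\in\mathcal T$, $i\in\{1,2,3\}$: $\|\mathcal L_{S_n}\cdots\mathcal L_{S_1}|_{\mathbb V\cap\mathcal B_i}\|_{\mathcal B_i}<\vartheta^n$. The function $F$. For $(\nu,h)\in\Omega:=[0,\nu_*]\times\mathbb W$ let $H(\nu,h)$ be the unique probability measure in $\mathbb W$ with $\mathcal L_{T_{\nu,h}}H(\nu,h)=H(\nu,h)$ (it belongs to $\mathcal B_3$). $F:\Omega\to\mathbb V$ is $F(\nu,h)=h-H(\nu,h)$; thus $F(\nu,h)=0$ iff $\widetilde{\mathcal L}_\nu h=h$. Let $$\Theta(\nu,h)=-(\mathrm{Id}-\mathcal L_{T_{\nu,h}})^{-1}\operatorname{div}\big(\mathcal L_{T_{\nu,h}}(\beta H(\nu,h))\big),$$ where $\mathcal L_{T_{\nu,h}}$ acts componentwise on vectors and the inverse is taken on zero-average elements. The derivatives of $F$ are, for $\phi,\bar\phi\in\mathbb V$: $D_hF|_{\nu,h}(\phi)=\phi-\nu\Theta(\nu,h)\int\alpha\phi$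 (an operator $\mathbb V\to\mathbb V$), $D_\nu F|_{\nu,h}=-\Theta(\nu,h)\int\alpha h$, and (with values in $\mathcal B_0$), writing $\mathcal L=\mathcal L_{T_{\nu,h}}$, $H=H(\nu,h)$, $$D_h^2F|_{\nu,h}(\phi,\bar\phi)=-\Big\{2\sum_{i,j}(\mathrm{Id}-\mathcal L)^{-1}\partial_{x_i}\big[\mathcal L\beta_i(\mathrm{Id}-\mathcal L)^{-1}\partial_{x_j}(\mathcal L\beta_jH)\big]+(\mathrm{Id}-\mathcal L)^{-1}\sum_{i,j}\partial_{x_i}\partial_{x_j}[\mathcal L\beta_i\beta_jH]\Big\}\nu^2\int\alpha\phi\int\alpha\bar\phi .$$
   Formalization: When D_hF is invertible, the solution for each ν in [0,ν_*] near ν_0 is claimed unique only among h with |ν-ν_0|+‖h-h_0‖_{B_1} ≤ δ; uniqueness in all of W fails in general, since several nondegenerate solutions can coexist. *)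

theory Defs
  imports "HOL-Analysis.Analysis" "HOL-Library.Function_Algebras"
begin

section \<open>Functions and maps on the torus\<close>

text \<open>Functions on the torus are identified with functions on \<open>real ^ 'd\<close> that are periodic
  with respect to the integer lattice, and maps of the torus with their lifts to \<open>real ^ 'd\<close>.
  Two lifts of the same torus map differ by an integer vector, which is not seen by periodic
  functions; this is why the reduction modulo 1 is not visible below.\<close>

definition lattice :: "(real ^ 'd::finite) set"
  where "lattice = {k. \<forall>i. k $ i \<in> \<int>}"

definition pd :: "'d::finite \<Rightarrow> (real ^ 'd \<Rightarrow> real) \<Rightarrow> real ^ 'd \<Rightarrow> real"
  where "pd k f x = frechet_derivative f (at x) (axis k 1)"

fun Ck :: "nat \<Rightarrow> (real ^ 'd::finite \<Rightarrow> real) \<Rightarrow> bool" where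
  "Ck 0 f \<longleftrightarrow> continuous_on UNIV f"
| "Ck (Suc n) f \<longleftrightarrow> (\<forall>x. f differentiable (at x)) \<and> (\<forall>k. Ck n (pd k f))"

definition CT :: "nat \<Rightarrow> (real ^ 'd::finite \<Rightarrow> real) set"
  where "CT n = {f. Ck n f \<and> (\<forall>x. \<forall>k\<in>lattice. f (x + k) = f x)}"

definition CT_norm :: "nat \<Rightarrow> (real ^ 'd::finite \<Rightarrow> real) \<Rightarrow> real"
  where "CT_norm n f = (\<Sum>ks | length ks \<le> n. SUP x. \<bar>foldr pd ks f x\<bar>)"

text \<open>\<open>CH s\<close> is $C^s$ for real \<open>s \<ge> 0\<close>: for non-integer \<open>s\<close> the derivatives of order
  \<open>\<lfloor>s\<rfloor>\<close> are Hoelder continuous with exponent \<open>frac s\<close>.\<close>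

definition CH :: "real \<Rightarrow> (real ^ 'd::finite \<Rightarrow> real) set"
  where "CH s = {f \<in> CT (nat \<lfloor>s\<rfloor>). frac s \<noteq> 0 \<longrightarrow>
    (\<forall>ks. length ks = nat \<lfloor>s\<rfloor> \<longrightarrow>
      (\<exists>C. \<forall>x y. \<bar>foldr pd ks f x - foldr pd ks f y\<bar> \<le> C * dist x y powr frac s))}"

definition CH_norm :: "real \<Rightarrow> (real ^ 'd::finite \<Rightarrow> real) \<Rightarrow> real"
  where "CH_norm s f = CT_norm (nat \<lfloor>s\<rfloor>) f +
    (if frac s = 0 then 0
     else (\<Sum>ks | length ks = nat \<lfloor>s\<rfloor>. SUP (x, y) \<in> {(x, y). x \<noteq> y}.
            \<bar>foldr pd ks f x - foldr pd ks f y\<bar> / dist x y powr frac s))"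

definition torus_maps :: "nat \<Rightarrow> (real ^ 'd::finite \<Rightarrow> real ^ 'd) set"
  where "torus_maps n = {S. (\<forall>i. Ck n (\<lambda>x. S x $ i)) \<and>
    (\<forall>x. \<forall>k\<in>lattice. S (x + k) - S x \<in> lattice)}"

definition torus_surj :: "(real ^ 'd::finite \<Rightarrow> real ^ 'd) \<Rightarrow> bool"
  where "torus_surj S \<longleftrightarrow> (\<forall>y. \<exists>x. S x - y \<in> lattice)"


section \<open>Distributions\<close>

text \<open>Elements of the dual of $C^r$ are represented as functionals on all functions that vanish
  outside \<open>CT r\<close>, so that equality of distributions is equality of functions.\<close>

type_synonym 'd distr = "(real ^ 'd \<Rightarrow> real) \<Rightarrow> real"

definition dual :: "nat \<Rightarrow> 'd::finite distr set"
  where "dual r = {h.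
    (\<forall>f\<in>CT r. \<forall>g\<in>CT r. h (\<lambda>x. f x + g x) = h f + h g) \<and>
    (\<forall>c. \<forall>f\<in>CT r. h (\<lambda>x. c * f x) = c * h f) \<and>
    (\<exists>C. \<forall>f\<in>CT r. \<bar>h f\<bar> \<le> C * CT_norm r f) \<and>
    (\<forall>f. f \<notin> CT r \<longrightarrow> h f = 0)}"

definition dscale :: "real \<Rightarrow> 'd::finite distr \<Rightarrow> 'd distr"
  where "dscale c h = (\<lambda>\<phi>. c * h \<phi>)"

abbreviation mass :: "'d::finite distr \<Rightarrow> real"
  where "mass h \<equiv> h (\<lambda>_. 1)"

definition nonneg :: "nat \<Rightarrow> 'd::finite distr \<Rightarrow> bool"
  where "nonneg r h \<longleftrightarrow> (\<forall>\<phi>\<in>CT r. (\<forall>x. 0 \<le> \<phi> x) \<longrightarrow> 0 \<le> h \<phi>)"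

definition prob_distr :: "nat \<Rightarrow> 'd::finite distr set"
  where "prob_distr r = {h \<in> dual r. nonneg r h \<and> mass h = 1}"

definition emb :: "nat \<Rightarrow> (real ^ 'd::finite \<Rightarrow> real) \<Rightarrow> 'd distr"
  where "emb r f = (\<lambda>\<phi>. if \<phi> \<in> CT r then (LINT x:cbox 0 1|lborel. f x * \<phi> x) else 0)"

definition mult :: "nat \<Rightarrow> (real ^ 'd::finite \<Rightarrow> real) \<Rightarrow> 'd distr \<Rightarrow> 'd distr"
  where "mult r a h = (\<lambda>\<phi>. if \<phi> \<in> CT r then h (\<lambda>x. a x * \<phi> x) else 0)"

text \<open>The formula \<open>g \<phi> = - h (pd k \<phi>)\<close> only makes sense for \<open>\<phi>\<close> in $C^{r+1}$, which is dense
  in $C^r$ and hence determines \<open>g\<close>.\<close>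

definition has_dpartial :: "nat \<Rightarrow> 'd::finite \<Rightarrow> 'd distr \<Rightarrow> 'd distr \<Rightarrow> bool"
  where "has_dpartial r k h g \<longleftrightarrow> g \<in> dual r \<and> (\<forall>\<phi>\<in>CT (Suc r). g \<phi> = - h (pd k \<phi>))"

definition dpartial :: "nat \<Rightarrow> 'd::finite \<Rightarrow> 'd distr \<Rightarrow> 'd distr"
  where "dpartial r k h = (THE g. has_dpartial r k h g)"

definition transfer_op :: "nat \<Rightarrow> (real ^ 'd::finite \<Rightarrow> real ^ 'd) \<Rightarrow> 'd distr \<Rightarrow> 'd distr"
  where "transfer_op r S h = (\<lambda>\<phi>. if \<phi> \<in> CT r then h (\<phi> \<circ> S) else 0)"

definition coupled :: "(real ^ 'd::finite \<Rightarrow> real ^ 'd) \<Rightarrow> (real ^ 'd \<Rightarrow> real) \<Rightarrow>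
    (real ^ 'd \<Rightarrow> real ^ 'd) \<Rightarrow> real \<Rightarrow> 'd distr \<Rightarrow> real ^ 'd \<Rightarrow> real ^ 'd"
  where "coupled T \<alpha> \<beta> \<nu> h = (\<lambda>x. T x + (\<nu> * h \<alpha>) *\<^sub>R \<beta> x)"


section \<open>Banach spaces of distributions\<close>

text \<open>A space is given by a carrier \<open>X\<close> and a norm \<open>N\<close>, whose values outside \<open>X\<close> are irrelevant.
  The library's \<^locale>\<open>Metric_space\<close> wants a function that is symmetric and nonnegative
  everywhere, hence the case distinction in \<open>ndist\<close>.\<close>

definition ndist :: "'d::finite distr set \<Rightarrow> ('d distr \<Rightarrow> real) \<Rightarrow> 'd distr \<Rightarrow> 'd distr \<Rightarrow> real"
  where "ndist X N g h = (if g \<in> X \<and> h \<in> X then N (g - h) else 0)"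

definition banach_sp :: "'d::finite distr set \<Rightarrow> ('d distr \<Rightarrow> real) \<Rightarrow> bool"
  where "banach_sp X N \<longleftrightarrow>
    0 \<in> X \<and> (\<forall>g\<in>X. \<forall>h\<in>X. g + h \<in> X) \<and> (\<forall>c. \<forall>h\<in>X. dscale c h \<in> X) \<and>
    (\<forall>h\<in>X. 0 \<le> N h) \<and> (\<forall>h\<in>X. N h = 0 \<longleftrightarrow> h = 0) \<and>
    (\<forall>g\<in>X. \<forall>h\<in>X. N (g + h) \<le> N g + N h) \<and>
    (\<forall>c. \<forall>h\<in>X. N (dscale c h) = \<bar>c\<bar> * N h) \<and>
    Metric_space.mcomplete X (ndist X N)"

definition bdd_op :: "'d::finite distr set \<Rightarrow> ('d distr \<Rightarrow> real) \<Rightarrow> 'd distr set \<Rightarrow>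
    ('d distr \<Rightarrow> real) \<Rightarrow> ('d distr \<Rightarrow> 'd distr) \<Rightarrow> bool"
  where "bdd_op X N Y N' A \<longleftrightarrow>
    (\<forall>h\<in>X. A h \<in> Y) \<and>
    (\<forall>g\<in>X. \<forall>h\<in>X. A (g + h) = A g + A h) \<and> (\<forall>c. \<forall>h\<in>X. A (dscale c h) = dscale c (A h)) \<and>
    (\<exists>C. \<forall>h\<in>X. N' (A h) \<le> C * N h)"

definition invertible_op :: "'d::finite distr set \<Rightarrow> ('d distr \<Rightarrow> real) \<Rightarrow>
    ('d distr \<Rightarrow> 'd distr) \<Rightarrow> bool"
  where "invertible_op X N D \<longleftrightarrow> bdd_op X N X N D \<and>
    (\<exists>A. bdd_op X N X N A \<and> (\<forall>h\<in>X. A (D h) = h \<and> D (A h) = h))"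

definition bdd_functional :: "'d::finite distr set \<Rightarrow> ('d distr \<Rightarrow> real) \<Rightarrow>
    ('d distr \<Rightarrow> real) \<Rightarrow> bool"
  where "bdd_functional X N l \<longleftrightarrow>
    (\<forall>g\<in>X. \<forall>h\<in>X. l (g + h) = l g + l h) \<and> (\<forall>c. \<forall>h\<in>X. l (dscale c h) = c * l h) \<and>
    (\<exists>C. \<forall>h\<in>X. \<bar>l h\<bar> \<le> C * N h)"

definition direct_sum_eq :: "'d::finite distr set \<Rightarrow> 'd distr set \<Rightarrow> 'd distr set \<Rightarrow> bool"
  where "direct_sum_eq X Y Z \<longleftrightarrow> {x + y | x y. x \<in> X \<and> y \<in> Y} = Z \<and> X \<inter> Y = {0}"

definition differentiable_curve :: "'d::finite distr set \<Rightarrow> ('d distr \<Rightarrow> real) \<Rightarrow>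
    (real \<Rightarrow> 'd distr) \<Rightarrow> real \<Rightarrow> bool"
  where "differentiable_curve X N c \<tau> \<longleftrightarrow>
    (\<exists>v\<in>X. ((\<lambda>s. N (dscale (1 / s) (c (\<tau> + s) - c \<tau>) - v)) \<longlongrightarrow> 0) (at 0))"

definition WW :: "nat \<Rightarrow> (nat \<Rightarrow> 'd::finite distr set) \<Rightarrow> (nat \<Rightarrow> 'd distr \<Rightarrow> real) \<Rightarrow>
    real \<Rightarrow> 'd distr set"
  where "WW r B N Ks = {h \<in> B 1. N 1 h \<le> Ks \<and> nonneg r h \<and> mass h = 1}"

definition VV :: "(nat \<Rightarrow> 'd::finite distr set) \<Rightarrow> 'd distr set"
  where "VV B = {f \<in> B 1. mass f = 0}"


section \<open>The standing assumptions\<close>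

text \<open>\<open>B i\<close> for \<open>i \<le> 3\<close> are the Banach spaces with norms \<open>N i\<close>, taken as subsets of \<open>dual r\<close>.
  The inclusion of the dual of \<open>B 3\<close> in the dual of $C^r$ amounts to the continuity of the
  inclusion of $C^r$ in \<open>B 3\<close>; the one of $C^r$ in the dual of \<open>B 0\<close> (via \<open>\<phi> \<mapsto> (h \<mapsto> h \<phi>)\<close>) to
  the continuity of the inclusion of \<open>B 0\<close> in \<open>dual r\<close>.\<close>

locale mean_field_setting =
  fixes r :: nat
    and T :: "real ^ 'd::finite \<Rightarrow> real ^ 'd"
    and \<alpha> :: "real ^ 'd \<Rightarrow> real"
    and \<beta> :: "real ^ 'd \<Rightarrow> real ^ 'd"
    and TT :: "(real ^ 'd \<Rightarrow> real ^ 'd) set"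
    and \<nu>s :: real
    and B :: "nat \<Rightarrow> 'd distr set"
    and N :: "nat \<Rightarrow> 'd distr \<Rightarrow> real"
    and K Cs cbar chat \<theta> :: real
  assumes r: "r > 12"
    and T_smooth: "\<And>n. T \<in> torus_maps n"
    and \<alpha>_smooth: "\<And>n. \<alpha> \<in> CT n"
    and \<beta>_smooth: "\<And>n i. (\<lambda>x. \<beta> x $ i) \<in> CT n"
    and TT_maps: "TT \<subseteq> torus_maps r"
    and TT_surj: "\<And>S. S \<in> TT \<Longrightarrow> torus_surj S"
    and TT_comp: "\<And>S S'. S \<in> TT \<Longrightarrow> S' \<in> TT \<Longrightarrow> S \<circ> S' \<in> TT"
    and \<nu>s_pos: "\<nu>s > 0"
    and coupled_in_TT: "\<And>\<nu> h. \<nu> \<in> {0..\<nu>s} \<Longrightarrow> h \<in> prob_distr r \<Longrightarrow> coupled T \<alpha> \<beta> \<nu> h \<in> TT"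
    and banach: "\<And>i. i \<le> 3 \<Longrightarrow> banach_sp (B i) (N i)"
    and B0_dual: "B 0 \<subseteq> dual r"
    and B0_dual_cont: "\<exists>C. \<forall>h\<in>B 0. \<forall>\<phi>\<in>CT r. \<bar>h \<phi>\<bar> \<le> C * N 0 h * CT_norm r \<phi>"
    and B_mono: "\<And>i. i \<le> 2 \<Longrightarrow> B (Suc i) \<subseteq> B i"
    and N_mono: "\<And>i h. i \<le> 2 \<Longrightarrow> h \<in> B (Suc i) \<Longrightarrow> N i h \<le> N (Suc i) h"
    and CT_B3: "\<And>\<phi>. \<phi> \<in> CT r \<Longrightarrow> emb r \<phi> \<in> B 3"
    and CT_B3_cont: "\<exists>C. \<forall>\<phi>\<in>CT r. N 3 (emb r \<phi>) \<le> C * CT_norm r \<phi>"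
    and CT_dense: "\<And>i h \<epsilon>. i \<le> 3 \<Longrightarrow> h \<in> B i \<Longrightarrow> \<epsilon> > 0 \<Longrightarrow> \<exists>\<phi>\<in>CT r. N i (h - emb r \<phi>) < \<epsilon>"
    and CT_dense_dual: "\<And>i l \<epsilon>. i \<le> 3 \<Longrightarrow> bdd_functional (B i) (N i) l \<Longrightarrow> \<epsilon> > 0 \<Longrightarrow>
          \<exists>\<phi>\<in>CT r. \<forall>h\<in>B i. \<bar>l h - h \<phi>\<bar> \<le> \<epsilon> * N i h"
    and K_ge_1: "K \<ge> 1" and Cs_ge_1: "Cs \<ge> 1"
    and cbar_pos: "cbar > 0" and chat_pos: "chat > 0"
    and \<theta>: "0 < \<theta>" "\<theta> < 1"
    and A1: "\<And>S i. S \<in> TT \<Longrightarrow> i \<le> 3 \<Longrightarrow> bdd_op (B i) (N i) (B i) (N i) (transfer_op r S)"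
    and A2: "\<And>k i. i \<le> 2 \<Longrightarrow>
          (\<forall>h\<in>B (Suc i). has_dpartial r k h (dpartial r k h)) \<and>
          bdd_op (B (Suc i)) (N (Suc i)) (B i) (N i) (dpartial r k)"
    \<comment> \<open>For \<open>a\<close> outside \<open>CT r\<close> the product \<open>a h\<close> is not given by \<open>mult r a h\<close>; on \<open>B i\<close> it is
       the continuous extension \<open>M\<close> of the multiplication of functions.\<close>
    and A3_mult: "\<And>i a. i \<le> 3 \<Longrightarrow> a \<in> CH (cbar * real i + chat) \<Longrightarrow>
          \<exists>M. bdd_op (B i) (N i) (B i) (N i) M \<and>
              (\<forall>f\<in>CT r. M (emb r f) = emb r (\<lambda>x. a x * f x)) \<and>
              (a \<in> CT r \<longrightarrow> (\<forall>h\<in>B i. M h = mult r a h)) \<and>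
              (\<forall>h\<in>B i. N i (M h) \<le> Cs * CH_norm (cbar * real i + chat) a * N i h)"
    and A3_mass: "\<And>h. h \<in> B 0 \<Longrightarrow> \<bar>mass h\<bar> \<le> Cs * N 0 h"
    and A4: "\<And>i. i \<le> 2 \<Longrightarrow>
          compactin (Metric_space.mtopology (B i) (ndist (B i) (N i)))
            (Metric_space.mtopology (B i) (ndist (B i) (N i)) closure_of
              {h \<in> B (Suc i). N (Suc i) h \<le> 1})"
    \<comment> \<open>\<open>fold (transfer_op r) [S1, \<dots>, Sn]\<close> applies the transfer operator of \<open>S1\<close> first.\<close>
    and A5_weak: "\<And>Ss i h. set Ss \<subseteq> TT \<Longrightarrow> i \<in> {1..3} \<Longrightarrow> h \<in> B i \<Longrightarrow>
          N 0 (fold (transfer_op r) Ss h) \<le> Cs * N 0 h"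
    and A5_strong: "\<And>Ss i h. set Ss \<subseteq> TT \<Longrightarrow> i \<in> {1..3} \<Longrightarrow> h \<in> B i \<Longrightarrow>
          N i (fold (transfer_op r) Ss h) \<le> Cs * \<theta> ^ length Ss * N i h + K * N (i - 1) h"
    \<comment> \<open>\<open>c\<close> is a bound for the operator norm.\<close>
    and A6: "\<exists>nbar. \<forall>Ss. length Ss \<ge> nbar \<and> set Ss \<subseteq> TT \<longrightarrow> (\<forall>i\<in>{1..3}.
          \<exists>c < \<theta> ^ length Ss. \<forall>h\<in>VV B \<inter> B i. N i (fold (transfer_op r) Ss h) \<le> c * N i h)"


section \<open>The function \<open>F\<close> and its derivatives\<close>

definition HH :: "nat \<Rightarrow> (real ^ 'd::finite \<Rightarrow> real ^ 'd) \<Rightarrow> (real ^ 'd \<Rightarrow> real) \<Rightarrow>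
    (real ^ 'd \<Rightarrow> real ^ 'd) \<Rightarrow> (nat \<Rightarrow> 'd distr set) \<Rightarrow> (nat \<Rightarrow> 'd distr \<Rightarrow> real) \<Rightarrow>
    real \<Rightarrow> real \<Rightarrow> 'd distr \<Rightarrow> 'd distr"
  where "HH r T \<alpha> \<beta> B N Ks \<nu> h =
    (THE p. p \<in> WW r B N Ks \<and> transfer_op r (coupled T \<alpha> \<beta> \<nu> h) p = p)"

definition FF :: "nat \<Rightarrow> (real ^ 'd::finite \<Rightarrow> real ^ 'd) \<Rightarrow> (real ^ 'd \<Rightarrow> real) \<Rightarrow>
    (real ^ 'd \<Rightarrow> real ^ 'd) \<Rightarrow> (nat \<Rightarrow> 'd distr set) \<Rightarrow> (nat \<Rightarrow> 'd distr \<Rightarrow> real) \<Rightarrow>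
    real \<Rightarrow> real \<Rightarrow> 'd distr \<Rightarrow> 'd distr"
  where "FF r T \<alpha> \<beta> B N Ks \<nu> h = h - HH r T \<alpha> \<beta> B N Ks \<nu> h"

text \<open>\<open>resolvent r B S f\<close> is $(\mathrm{Id} - L_S)^{-1} f$ on zero-average elements.\<close>

definition resolvent :: "nat \<Rightarrow> (nat \<Rightarrow> 'd::finite distr set) \<Rightarrow>
    (real ^ 'd \<Rightarrow> real ^ 'd) \<Rightarrow> 'd distr \<Rightarrow> 'd distr"
  where "resolvent r B S f = (THE g. g \<in> VV B \<and> g - transfer_op r S g = f)"

definition Theta :: "nat \<Rightarrow> (real ^ 'd::finite \<Rightarrow> real ^ 'd) \<Rightarrow> (real ^ 'd \<Rightarrow> real) \<Rightarrow>
    (real ^ 'd \<Rightarrow> real ^ 'd) \<Rightarrow> (nat \<Rightarrow> 'd distr set) \<Rightarrow> (nat \<Rightarrow> 'd distr \<Rightarrow> real) \<Rightarrow>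
    real \<Rightarrow> real \<Rightarrow> 'd distr \<Rightarrow> 'd distr"
  where "Theta r T \<alpha> \<beta> B N Ks \<nu> h =
    (let S = coupled T \<alpha> \<beta> \<nu> h; H = HH r T \<alpha> \<beta> B N Ks \<nu> h
     in - resolvent r B S
          (\<Sum>k\<in>UNIV. dpartial r k (transfer_op r S (mult r (\<lambda>x. \<beta> x $ k) H))))"

text \<open>\<open>DhF\<close>, \<open>DnuF\<close> and \<open>DhhF\<close> are the partial derivatives \<open>D\<^sub>h F\<close>, \<open>D\<^sub>\<nu> F\<close> and \<open>D\<^sub>h\<^sup>2 F\<close>, given by
  their explicit formulas because the domain of \<open>F\<close>, a subset of \<open>B 1\<close>, is not open.\<close>

definition DhF :: "nat \<Rightarrow> (real ^ 'd::finite \<Rightarrow> real ^ 'd) \<Rightarrow> (real ^ 'd \<Rightarrow> real) \<Rightarrow>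
    (real ^ 'd \<Rightarrow> real ^ 'd) \<Rightarrow> (nat \<Rightarrow> 'd distr set) \<Rightarrow> (nat \<Rightarrow> 'd distr \<Rightarrow> real) \<Rightarrow>
    real \<Rightarrow> real \<Rightarrow> 'd distr \<Rightarrow> 'd distr \<Rightarrow> 'd distr"
  where "DhF r T \<alpha> \<beta> B N Ks \<nu> h \<phi> = \<phi> - dscale (\<nu> * \<phi> \<alpha>) (Theta r T \<alpha> \<beta> B N Ks \<nu> h)"

definition DnuF :: "nat \<Rightarrow> (real ^ 'd::finite \<Rightarrow> real ^ 'd) \<Rightarrow> (real ^ 'd \<Rightarrow> real) \<Rightarrow>
    (real ^ 'd \<Rightarrow> real ^ 'd) \<Rightarrow> (nat \<Rightarrow> 'd distr set) \<Rightarrow> (nat \<Rightarrow> 'd distr \<Rightarrow> real) \<Rightarrow>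
    real \<Rightarrow> real \<Rightarrow> 'd distr \<Rightarrow> 'd distr"
  where "DnuF r T \<alpha> \<beta> B N Ks \<nu> h = - dscale (h \<alpha>) (Theta r T \<alpha> \<beta> B N Ks \<nu> h)"

definition DhhF :: "nat \<Rightarrow> (real ^ 'd::finite \<Rightarrow> real ^ 'd) \<Rightarrow> (real ^ 'd \<Rightarrow> real) \<Rightarrow>
    (real ^ 'd \<Rightarrow> real ^ 'd) \<Rightarrow> (nat \<Rightarrow> 'd distr set) \<Rightarrow> (nat \<Rightarrow> 'd distr \<Rightarrow> real) \<Rightarrow>
    real \<Rightarrow> real \<Rightarrow> 'd distr \<Rightarrow> 'd distr \<Rightarrow> 'd distr \<Rightarrow> 'd distr"
  where "DhhF r T \<alpha> \<beta> B N Ks \<nu> h \<phi> \<psi> =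
    (let S = coupled T \<alpha> \<beta> \<nu> h; L = transfer_op r S; R = resolvent r B S;
         H = HH r T \<alpha> \<beta> B N Ks \<nu> h; b = (\<lambda>i x. \<beta> x $ i)
     in - dscale (\<nu>\<^sup>2 * \<phi> \<alpha> * \<psi> \<alpha>)
            (dscale 2 (\<Sum>i\<in>UNIV. \<Sum>j\<in>UNIV.
               R (dpartial r i (L (mult r (b i) (R (dpartial r j (L (mult r (b j) H))))))))
             + R (\<Sum>i\<in>UNIV. \<Sum>j\<in>UNIV.
                 dpartial r i (dpartial r j (L (mult r (\<lambda>x. b i x * b j x) H))))))"

end

theory Submission
  imports Defs
begin

text \<open>The map \<open>coupled T \<alpha> \<beta> \<nu> h\<close> depends on \<open>\<nu>\<close> and \<open>h\<close> only through the number
\<open>s = \<nu> * h \<alpha>\<close>. Let \<open>L s\<close> be the transfer operator of $T + s\beta$, let \<open>stat s\<close> be its invariant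
probability distribution, and put \<open>obs s = stat s \<alpha>\<close>. Then $F(\nu,h) = h - \mathit{stat}(\nu h(\alpha))$, so
the solutions of $F = 0$ are the pairs \<open>(\<nu>, stat s)\<close> with \<open>s = \<nu> * obs s\<close>: an infinite-dimensional
bifurcation problem is a scalar equation in disguise.

The hypotheses translate accordingly. The operator $D_hF$ is a rank one perturbation of the identity; it is
invertible iff the derivative \<open>1 - \<nu>\<^sub>0 * obs' s\<^sub>0\<close> of \<open>s - \<nu>\<^sub>0 * obs s\<close> does not vanish
(\<open>invertible_iff\<close>), and then solutions are locally unique. Otherwise the non-degeneracy conditions say that
\<open>obs s\<^sub>0 \<noteq> 0\<close> and that the second order Taylor coefficient of \<open>obs\<close> at \<open>s\<^sub>0\<close> is not zero
(\<open>DhhF_eq\<close>), so \<open>\<nu> = s / obs s\<close> has a strict local extremum at \<open>s\<^sub>0\<close> and takes values on one side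
of \<open>\<nu>\<^sub>0\<close> twice. In both cases the curve of solutions is \<open>s \<mapsto> (s / obs s, stat s)\<close>, or a constant
distribution if \<open>obs s\<^sub>0 = 0\<close> (\<open>solution_branch\<close>).

The work is to show that \<open>stat\<close> is continuously differentiable in the norm of \<open>B 1\<close> and that \<open>obs\<close> has
a second order expansion. Since \<open>stat s' - stat s\<close> is $(\mathrm{Id}-L_{s'})^{-1}(L_{s'}-L_s)\,\mathit{stat}(s)$, and the
resolvents are bounded on the zero average parts of \<open>B 1\<close>, \<open>B 2\<close>, \<open>B 3\<close> by contraction, this reduces to the
dependence of \<open>L s h\<close> on \<open>s\<close>. There the idea is to use compactness instead of integration in Banach spaces: the
difference quotients of \<open>L s h\<close> are weak limits of averages of the formal derivative \<open>vel s h\<close>, so they stay in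
the closure in \<open>B i\<close> of a ball of \<open>B (Suc i)\<close> (\<open>ball_closure_mean_value\<close>). This closure is compact, and on a
compact set weak convergence is norm convergence (\<open>ball_closure_weak_imp_conv\<close>). Hence every limit can be computed by
testing against functions in $C^{r+1}$, where it is the chain rule; that these test functions determine a distribution
follows by mollification (\<open>dual_eqI\<close>).

For the second order expansion the remainder is only known to lie in the closure in \<open>B 0\<close> of a ball of \<open>B 1\<close>, a set
on which the resolvents are not known to be bounded. The iterates of \<open>L s\<close> still decay exponentially in the norm of
\<open>B 0\<close> on this set (\<open>ball_closure_Lpow_decay\<close>), so that the Neumann series, tested against a function, converges by
dominated convergence (\<open>R_weakly_continuous\<close>).\<close>

section \<open>Families of $C^n$ functions\<close>

text \<open>Families of functions all of whose derivatives in \<open>x\<close> up to order \<open>n\<close> are continuous jointly in the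
parameter and \<open>x\<close>. Joint continuity gives estimates that are uniform in \<open>x\<close> once periodicity is added.\<close>
fun Ck_family :: "nat \<Rightarrow> ('a::topological_space \<Rightarrow> real ^ 'd::finite \<Rightarrow> real) \<Rightarrow> bool" where
  "Ck_family 0 \<Psi> \<longleftrightarrow> continuous_on UNIV (\<lambda>(u, x). \<Psi> u x)"
| "Ck_family (Suc n) \<Psi> \<longleftrightarrow> continuous_on UNIV (\<lambda>(u, x). \<Psi> u x) \<and>
     (\<forall>u x. \<Psi> u differentiable (at x)) \<and> (\<forall>k. Ck_family n (\<lambda>u. pd k (\<Psi> u)))"

lemma pd_eqI: "(f has_derivative D) (at x) \<Longrightarrow> pd k f x = D (axis k 1)"
  unfolding pd_def using frechet_derivative_at by metis

lemma frechet_derivative_eq_sum_pd: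
  fixes f :: "real ^ 'd::finite \<Rightarrow> real"
  assumes "f differentiable (at y)"
  shows "frechet_derivative f (at y) v = (\<Sum>k\<in>UNIV. v $ k * pd k f y)"
proof -
  interpret linear "frechet_derivative f (at y)"
    using assms by (rule linear_frechet_derivative)
  have "frechet_derivative f (at y) v = frechet_derivative f (at y) (\<Sum>k\<in>UNIV. (v $ k) *\<^sub>R axis k 1)"
    using basis_expansion[of v] by (simp add: scalar_mult_eq_scaleR)
  also have "\<dots> = (\<Sum>k\<in>UNIV. v $ k * pd k f y)"
    by (simp add: sum scale pd_def)
  finally show ?thesis .
qed

lemma has_derivative_pd:
  fixes f :: "real ^ 'd::finite \<Rightarrow> real"
  assumes "f differentiable (at y)"
  shows "(f has_derivative (\<lambda>v. \<Sum>k\<in>UNIV. v $ k * pd k f y)) (at y)"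
proof -
  have "frechet_derivative f (at y) = (\<lambda>v. \<Sum>k\<in>UNIV. v $ k * pd k f y)"
    by (rule ext) (rule frechet_derivative_eq_sum_pd[OF assms])
  with assms show ?thesis by (simp add: frechet_derivative_works)
qed

lemma pd_add: "f differentiable (at x) \<Longrightarrow> g differentiable (at x) \<Longrightarrow>
    pd k (\<lambda>y. f y + g y) x = pd k f x + pd k g x"
  by (subst pd_eqI[OF has_derivative_add[OF iffD1[OF frechet_derivative_works] iffD1[OF frechet_derivative_works]]])
     (auto simp: pd_def)

lemma pd_mult: "f differentiable (at x) \<Longrightarrow> g differentiable (at x) \<Longrightarrow>
    pd k (\<lambda>y. f y * g y) x = f x * pd k g x + pd k f x * g x"
  by (subst pd_eqI[OF has_derivative_mult[OF iffD1[OF frechet_derivative_works] iffD1[OF frechet_derivative_works]]])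
     (auto simp: pd_def)

lemma pd_const [simp]: "pd k (\<lambda>_. c) = (\<lambda>_. 0)"
  by (rule ext) (simp add: pd_eqI[OF has_derivative_const])

lemma pd_cmult: "f differentiable (at x) \<Longrightarrow> pd k (\<lambda>y. c * f y) x = c * pd k f x"
  by (simp add: pd_mult)

lemma Ck_family_continuous: "Ck_family n \<Psi> \<Longrightarrow> continuous_on UNIV (\<lambda>(u, x). \<Psi> u x)"
  by (cases n) auto

lemma Ck_family_Suc_D: "Ck_family (Suc n) \<Psi> \<Longrightarrow> Ck_family n \<Psi>"
proof (induction n arbitrary: \<Psi>)
  case (Suc n)
  from Suc.prems have "continuous_on UNIV (\<lambda>(u, x). \<Psi> u x)"
    "\<forall>u x. \<Psi> u differentiable (at x)" "\<forall>k. Ck_family (Suc n) (\<lambda>u. pd k (\<Psi> u))"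
    unfolding Ck_family.simps(2)[of "Suc n"] by blast+
  then show ?case using Suc.IH unfolding Ck_family.simps(2)[of n] by blast
qed auto

lemma Ck_family_le: "Ck_family n \<Psi> \<Longrightarrow> m \<le> n \<Longrightarrow> Ck_family m \<Psi>"
  by (induction n) (auto simp: le_Suc_eq simp del: Ck_family.simps dest: Ck_family_Suc_D)

lemma continuous_on_snd_comp: "continuous_on UNIV f \<Longrightarrow> continuous_on UNIV (\<lambda>(u, x). f x)"
  unfolding split_beta by (rule continuous_on_compose2[of UNIV f]) (auto intro: continuous_intros)

lemma Ck_imp_continuous: "Ck n f \<Longrightarrow> continuous_on UNIV f"
  by (cases n) (auto intro!: differentiable_imp_continuous_on simp: differentiable_on_def)

lemma Ck_imp_family: "Ck n f \<Longrightarrow> Ck_family n (\<lambda>_. f)"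
proof (induction n arbitrary: f)
  case (Suc n)
  then show ?case using Ck_imp_continuous[OF Suc.prems] by (auto intro!: continuous_on_snd_comp)
qed (auto intro: continuous_on_snd_comp)

lemma Ck_family_imp_Ck: "Ck_family n \<Psi> \<Longrightarrow> Ck n (\<Psi> u)"
proof (induction n arbitrary: \<Psi>)
  case 0
  then have "continuous_on (range (Pair u)) (\<lambda>(u, x). \<Psi> u x)"
    by (auto intro: continuous_on_subset)
  then have "continuous_on UNIV ((\<lambda>(u, x). \<Psi> u x) \<circ> Pair u)"
    by (intro continuous_on_compose continuous_on_Pair continuous_on_const continuous_on_id)
  then show ?case by (simp add: o_def)
qed auto

lemma Ck_le: "Ck n f \<Longrightarrow> m \<le> n \<Longrightarrow> Ck m f"
  using Ck_family_imp_Ck[OF Ck_family_le[OF Ck_imp_family]] by blast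

lemma Ck_family_param: "continuous_on UNIV g \<Longrightarrow> Ck_family n (\<lambda>u x. g u)"
proof (induction n arbitrary: g)
  have *: "continuous_on UNIV (\<lambda>(u, x::real^'d). g u)" if "continuous_on UNIV g" for g :: "'a \<Rightarrow> real"
    unfolding split_beta by (rule continuous_on_compose2[OF that]) (auto intro: continuous_intros)
  {
    case 0 then show ?case using * by auto
  next
    case (Suc n) then show ?case using * by auto
  }
qed

lemma Ck_family_add:
  "Ck_family n \<Psi> \<Longrightarrow> Ck_family n \<Phi> \<Longrightarrow> Ck_family n (\<lambda>u x. \<Psi> u x + \<Phi> u x)"
proof (induction n arbitrary: \<Psi> \<Phi>)
  case 0 then show ?case by (auto simp: split_beta intro!: continuous_intros)
next
  case (Suc n)
  have "pd k (\<lambda>x. \<Psi> u x + \<Phi> u x) = (\<lambda>x. pd k (\<Psi> u) x + pd k (\<Phi> u) x)" for k u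
    using Suc.prems by (auto simp: fun_eq_iff intro!: pd_add)
  with Suc show ?case by (auto simp: split_beta intro!: continuous_intros differentiable_add)
qed

lemma Ck_family_mult:
  "Ck_family n \<Psi> \<Longrightarrow> Ck_family n \<Phi> \<Longrightarrow> Ck_family n (\<lambda>u x. \<Psi> u x * \<Phi> u x)"
proof (induction n arbitrary: \<Psi> \<Phi>)
  case 0 then show ?case by (auto simp: split_beta intro!: continuous_intros)
next
  case (Suc n)
  have eq: "pd k (\<lambda>x. \<Psi> u x * \<Phi> u x) = (\<lambda>x. \<Psi> u x * pd k (\<Phi> u) x + pd k (\<Psi> u) x * \<Phi> u x)" for k u
    using Suc.prems by (auto simp: fun_eq_iff intro!: pd_mult)
  have "Ck_family n (\<lambda>u. pd k (\<lambda>x. \<Psi> u x * \<Phi> u x))" for k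
    unfolding eq using Suc Ck_family_Suc_D by (intro Ck_family_add Suc.IH) auto
  with Suc.prems show ?case by (auto simp: split_beta intro!: continuous_intros differentiable_mult)
qed

lemma Ck_family_const: "Ck_family n (\<lambda>u x. c)"
  by (rule Ck_family_param) auto

lemma Ck_family_sum:
  "finite A \<Longrightarrow> (\<And>i. i \<in> A \<Longrightarrow> Ck_family n (\<Psi> i)) \<Longrightarrow> Ck_family n (\<lambda>u x. \<Sum>i\<in>A. \<Psi> i u x)"
  by (induction A rule: finite_induct) (auto intro: Ck_family_const Ck_family_add)

lemma differentiable_vec:
  fixes S :: "real ^ 'd::finite \<Rightarrow> real ^ 'e::finite"
  assumes "\<And>i. (\<lambda>x. S x $ i) differentiable (at x)"
  shows "(S has_derivative (\<lambda>v. \<chi> i. frechet_derivative (\<lambda>x. S x $ i) (at x) v)) (at x)"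
proof -
  have "((\<lambda>x. S x \<bullet> b) has_derivative (\<lambda>v. (\<chi> i. frechet_derivative (\<lambda>x. S x $ i) (at x) v) \<bullet> b)) (at x)"
    if "b \<in> Basis" for b :: "real ^ 'e"
  proof -
    obtain i where b: "b = axis i 1" using \<open>b \<in> Basis\<close> by (auto simp: Basis_vec_def)
    show ?thesis using assms[of i] unfolding b
      by (simp add: inner_axis frechet_derivative_works)
  qed
  then show ?thesis unfolding has_derivative_componentwise_within[of S] by blast
qed

lemma Ck_family_compose:
  fixes S :: "'a::topological_space \<Rightarrow> real ^ 'd::finite \<Rightarrow> real ^ 'e::finite"
  assumes "Ck n \<phi>" "\<And>i. Ck_family n (\<lambda>u x. S u x $ i)"
  shows "Ck_family n (\<lambda>u x. \<phi> (S u x))"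
  using assms
proof (induction n arbitrary: \<phi>)
  have *: "continuous_on UNIV (\<lambda>(u, x). \<phi> (S u x))"
    if "continuous_on UNIV \<phi>" "\<And>i. continuous_on UNIV (\<lambda>(u, x). S u x $ i)" for \<phi> :: "real ^ 'e \<Rightarrow> real"
  proof -
    have "continuous_on UNIV (\<lambda>p. \<chi> i. S (fst p) (snd p) $ i)"
      using that(2) by (intro continuous_on_vec_lambda) (simp add: split_beta)
    then show ?thesis
      using continuous_on_compose2[OF that(1), of UNIV "\<lambda>p. \<chi> i. S (fst p) (snd p) $ i"]
      by (simp add: split_beta)
  qed
  {
    case 0 then show ?case using * by auto
  next
    case (Suc n)
    have dS: "(S u has_derivative (\<lambda>v. \<chi> i. frechet_derivative (\<lambda>x. S u x $ i) (at x) v)) (at x)" for u x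
      using Suc.prems by (intro differentiable_vec) auto
    have d\<phi>: "\<phi> differentiable (at x)" for x using Suc.prems by auto
    have D: "((\<lambda>x. \<phi> (S u x)) has_derivative
       (\<lambda>v. \<Sum>i\<in>UNIV. frechet_derivative (\<lambda>x. S u x $ i) (at x) v * pd i \<phi> (S u x))) (at x)" for u x
      using has_derivative_compose[OF dS has_derivative_pd[OF d\<phi>]] by simp
    have eq: "pd k (\<lambda>x. \<phi> (S u x)) = (\<lambda>x. \<Sum>i\<in>UNIV. pd k (\<lambda>x. S u x $ i) x * pd i \<phi> (S u x))" for k u
      by (rule ext) (simp add: pd_eqI[OF D], simp add: pd_def)
    have "Ck_family n (\<lambda>u. pd k (\<lambda>x. \<phi> (S u x)))" for k
      unfolding eq
    proof (rule Ck_family_sum[OF finite], rule Ck_family_mult)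
      fix i
      show "Ck_family n (\<lambda>u. pd k (\<lambda>x. S u x $ i))"
        using Suc.prems(2)[of i] by simp
      show "Ck_family n (\<lambda>u x. pd i \<phi> (S u x))"
      proof (rule Suc.IH)
        show "Ck n (pd i \<phi>)" using Suc.prems(1) by simp
        show "Ck_family n (\<lambda>u x. S u x $ i)" for i by (rule Ck_family_Suc_D[OF Suc.prems(2)])
      qed
    qed
    moreover have "continuous_on UNIV (\<lambda>(u, x). \<phi> (S u x))"
      by (rule *[OF Ck_imp_continuous[OF Suc.prems(1)] Ck_family_continuous[OF Suc.prems(2)]])
    ultimately show ?case using D by (auto simp: differentiable_def)
  }
qed

lemma Ck_add: "Ck n f \<Longrightarrow> Ck n g \<Longrightarrow> Ck n (\<lambda>x. f x + g x)"
  using Ck_family_imp_Ck[OF Ck_family_add[OF Ck_imp_family Ck_imp_family]] by blast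

lemma Ck_mult: "Ck n f \<Longrightarrow> Ck n g \<Longrightarrow> Ck n (\<lambda>x. f x * g x)"
  using Ck_family_imp_Ck[OF Ck_family_mult[OF Ck_imp_family Ck_imp_family]] by blast

lemma Ck_const: "Ck n (\<lambda>_. c)"
  using Ck_family_imp_Ck[OF Ck_family_const] by blast

lemma Ck_cmult: "Ck n f \<Longrightarrow> Ck n (\<lambda>x. c * f x)"
  by (rule Ck_mult[OF Ck_const])

lemma foldr_pd_linear:
  assumes "Ck n f" "Ck n g" "length ks \<le> n"
  shows "foldr pd ks (\<lambda>x. c * f x + d * g x) = (\<lambda>x. c * foldr pd ks f x + d * foldr pd ks g x)"
  using assms
proof (induction ks arbitrary: n f g rule: rev_induct)
  case (snoc k ks)
  then obtain m where n: "n = Suc m" by (cases n) auto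
  have eq: "pd k (\<lambda>x. c * f x + d * g x) = (\<lambda>x. c * pd k f x + d * pd k g x)"
    using snoc.prems(1,2) n
    by (auto simp: fun_eq_iff pd_cmult pd_add differentiable_mult)
  have "foldr pd ks (\<lambda>x. c * pd k f x + d * pd k g x) =
      (\<lambda>x. c * foldr pd ks (pd k f) x + d * foldr pd ks (pd k g) x)"
    using snoc.prems n by (intro snoc.IH[of m]) auto
  then show ?case by (simp add: eq)
qed simp

lemma Ck_family_foldr_pd:
  "Ck_family n \<Psi> \<Longrightarrow> length ks \<le> n \<Longrightarrow> Ck_family (n - length ks) (\<lambda>u. foldr pd ks (\<Psi> u))"
proof (induction ks arbitrary: n \<Psi> rule: rev_induct)
  case (snoc k ks)
  then obtain m where n: "n = Suc m" by (cases n) auto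
  then show ?case using snoc.IH[of m "\<lambda>u. pd k (\<Psi> u)"] snoc.prems by auto
qed simp


section \<open>Periodic functions\<close>

lemma pd_translate:
  assumes "f differentiable (at (x + l))"
  shows "((\<lambda>y. f (y + l)) has_derivative frechet_derivative f (at (x + l))) (at x)"
    and "pd k (\<lambda>y. f (y + l)) x = pd k f (x + l)"
proof -
  show "((\<lambda>y. f (y + l)) has_derivative frechet_derivative f (at (x + l))) (at x)"
    using has_derivative_compose[of "\<lambda>y. y + l" "\<lambda>v. v" x UNIV f "frechet_derivative f (at (x + l))"]
      assms has_derivative_add_const[OF has_derivative_ident, of l]
    by (auto simp: frechet_derivative_works)
  from pd_eqI[OF this] show "pd k (\<lambda>y. f (y + l)) x = pd k f (x + l)" by (simp add: pd_def)
qed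

lemma pd_periodic:
  assumes "\<And>x. \<forall>k\<in>lattice. f (x + k) = f x" "\<And>x. f differentiable (at x)" "l \<in> lattice"
  shows "pd k f (x + l) = pd k f x"
  using pd_translate(2)[OF assms(2), where x = x and l = l and k = k] assms(1,3) by simp

lemma CT_D: assumes "f \<in> CT n" shows "Ck n f" "\<And>x k. k \<in> lattice \<Longrightarrow> f (x + k) = f x"
  using assms by (auto simp: CT_def)

lemma CT_pd: "f \<in> CT (Suc n) \<Longrightarrow> pd k f \<in> CT n"
  using pd_periodic[of f] by (auto simp: CT_def)

lemma CT_foldr_pd: "f \<in> CT n \<Longrightarrow> length ks \<le> n \<Longrightarrow> foldr pd ks f \<in> CT (n - length ks)"
proof (induction ks arbitrary: n f rule: rev_induct)
  case (snoc k ks)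
  then obtain m where n: "n = Suc m" by (cases n) auto
  then show ?case using snoc.IH[of "pd k f" m] snoc.prems CT_pd[of f m k] by auto
qed simp

lemma CT_le: "f \<in> CT n \<Longrightarrow> m \<le> n \<Longrightarrow> f \<in> CT m"
  using Ck_le[of n f m] by (auto simp: CT_def)

lemma CT_add: "f \<in> CT n \<Longrightarrow> g \<in> CT n \<Longrightarrow> (\<lambda>x. f x + g x) \<in> CT n"
  by (simp add: CT_def Ck_add)

lemma CT_mult: "f \<in> CT n \<Longrightarrow> g \<in> CT n \<Longrightarrow> (\<lambda>x. f x * g x) \<in> CT n"
  by (simp add: CT_def Ck_mult)

lemma CT_const: "(\<lambda>_. c) \<in> CT n"
  by (simp add: CT_def Ck_const)

lemma CT_cmult: "f \<in> CT n \<Longrightarrow> (\<lambda>x. c * f x) \<in> CT n"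
  by (rule CT_mult[OF CT_const])

lemma CT_diff: "f \<in> CT n \<Longrightarrow> g \<in> CT n \<Longrightarrow> (\<lambda>x. f x - g x) \<in> CT n"
  using CT_add[OF _ CT_cmult[of g n "-1"], of f] by simp

lemma CT_sum: "finite A \<Longrightarrow> (\<And>i. i \<in> A \<Longrightarrow> f i \<in> CT n) \<Longrightarrow> (\<lambda>x. \<Sum>i\<in>A. f i x) \<in> CT n"
  by (induction A rule: finite_induct) (auto intro: CT_add CT_const)

lemma CT_compose:
  assumes "\<phi> \<in> CT n" "S \<in> torus_maps n"
  shows "(\<lambda>x. \<phi> (S x)) \<in> CT n"
proof -
  have "Ck_family n (\<lambda>(u::real) x. \<phi> (S x))"
  proof (rule Ck_family_compose[where S = "\<lambda>u. S"])
    show "Ck n \<phi>" using assms(1) by (simp add: CT_def)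
    show "Ck_family n (\<lambda>(u::real) x. S x $ i)" for i
      using assms(2) by (intro Ck_imp_family) (simp add: torus_maps_def)
  qed
  then have "Ck n (\<lambda>x. \<phi> (S x))" by (rule Ck_family_imp_Ck)
  moreover have "\<phi> (S (x + k)) = \<phi> (S x)" if "k \<in> lattice" for x k
  proof -
    have "S (x + k) - S x \<in> lattice" using assms(2) that by (auto simp: torus_maps_def)
    from CT_D(2)[OF assms(1) this, of "S x"] show ?thesis by simp
  qed
  ultimately show ?thesis by (simp add: CT_def)
qed

lemma periodic_representative:
  obtains k y where "k \<in> lattice" "y \<in> cbox 0 (1 :: real ^ 'd::finite)" "x = y + k"
proof
  show "(\<chi> i. real_of_int \<lfloor>x $ i\<rfloor>) \<in> lattice" by (simp add: lattice_def)
  show "(\<chi> i. frac (x $ i)) \<in> cbox 0 (1 :: real ^ 'd)"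
    by (auto simp: mem_box_cart less_imp_le frac_lt_1)
  show "x = (\<chi> i. frac (x $ i)) + (\<chi> i. real_of_int \<lfloor>x $ i\<rfloor>)"
    by (simp add: vec_eq_iff frac_def)
qed

text \<open>Periodicity reduces the supremum over all \<open>x\<close> to the compact unit cube, where joint continuity
is uniform.\<close>
lemma periodic_family_uniform:
  fixes \<Psi> :: "'a::{heine_borel,real_normed_vector} \<Rightarrow> real ^ 'd::finite \<Rightarrow> real"
  assumes cont: "continuous_on UNIV (\<lambda>(u, x). \<Psi> u x)"
    and per: "\<And>u x k. k \<in> lattice \<Longrightarrow> \<Psi> u (x + k) = \<Psi> u x" and "\<epsilon> > 0"
  shows "\<exists>\<delta>>0. \<forall>u. dist u u0 < \<delta> \<longrightarrow> (\<forall>x. \<bar>\<Psi> u x - \<Psi> u0 x\<bar> < \<epsilon>)"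
proof -
  have "compact (cball u0 1 \<times> cbox 0 (1 :: real ^ 'd))"
    by (intro compact_Times compact_cbox compact_cball)
  then have "uniformly_continuous_on (cball u0 1 \<times> cbox 0 (1 :: real ^ 'd)) (\<lambda>(u, x). \<Psi> u x)"
    using cont by (intro compact_uniformly_continuous) (auto intro: continuous_on_subset)
  then obtain \<delta> where \<delta>: "\<delta> > 0" "\<And>p q. p \<in> cball u0 1 \<times> cbox 0 1 \<Longrightarrow> q \<in> cball u0 1 \<times> cbox 0 1 \<Longrightarrow>
      dist q p < \<delta> \<Longrightarrow> dist (case q of (u, x) \<Rightarrow> \<Psi> u x) (case p of (u, x) \<Rightarrow> \<Psi> u x) < \<epsilon>"
    using \<open>\<epsilon> > 0\<close> unfolding uniformly_continuous_on_def by metis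
  show ?thesis
  proof (intro exI[of _ "min \<delta> 1"] conjI allI impI)
    fix u x assume u: "dist u u0 < min \<delta> 1"
    obtain k y where k: "k \<in> lattice" "y \<in> cbox 0 (1 :: real ^ 'd)" "x = y + k"
      by (rule periodic_representative)
    have "dist (u, y) (u0, y) < \<delta>" using u by (simp add: dist_prod_def)
    then have "dist (\<Psi> u y) (\<Psi> u0 y) < \<epsilon>"
      using \<delta>(2)[of "(u0, y)" "(u, y)"] k u by (auto simp: dist_commute)
    then show "\<bar>\<Psi> u x - \<Psi> u0 x\<bar> < \<epsilon>" using per[OF k(1)] k(3) by (simp add: dist_real_def)
  qed (use \<delta> in auto)
qed

lemma CT_bounded:
  assumes "f \<in> CT n"
  shows "\<exists>C. \<forall>x. \<bar>f x\<bar> \<le> C"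
proof -
  have "bounded (f ` cbox 0 1)"
    using Ck_imp_continuous[OF CT_D(1)[OF assms]]
    by (intro compact_imp_bounded compact_continuous_image) (auto intro: continuous_on_subset)
  then obtain C where C: "\<And>y. y \<in> cbox 0 1 \<Longrightarrow> \<bar>f y\<bar> \<le> C"
    unfolding bounded_iff by auto
  have "\<bar>f x\<bar> \<le> C" for x
    using periodic_representative[of x] CT_D(2)[OF assms] C by metis
  then show ?thesis by blast
qed

lemma CT_norm_le:
  fixes f :: "real ^ 'd::finite \<Rightarrow> real"
  assumes "\<And>ks x. length ks \<le> n \<Longrightarrow> \<bar>foldr pd ks f x\<bar> \<le> e"
  shows "CT_norm n f \<le> real (card {ks :: 'd list. length ks \<le> n}) * e"
  unfolding CT_norm_def
  by (rule sum_bounded_above) (use assms in \<open>auto intro!: cSUP_least\<close>)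

text \<open>The form in which the continuity of a distribution is used: a bound for all derivatives gives a bound for the
value, without any further mention of the $C^n$ norm.\<close>
lemma dual_le:
  fixes h :: "'d::finite distr"
  assumes "h \<in> dual n"
  shows "\<exists>C\<ge>0. \<forall>f\<in>CT n. \<forall>e. (\<forall>ks x. length ks \<le> n \<longrightarrow> \<bar>foldr pd ks f x\<bar> \<le> e) \<longrightarrow> \<bar>h f\<bar> \<le> C * e"
proof -
  from assms obtain C where C: "\<And>f. f \<in> CT n \<Longrightarrow> \<bar>h f\<bar> \<le> C * CT_norm n f"
    unfolding dual_def by blast
  show ?thesis
  proof (intro exI[of _ "max C 0 * real (card {ks :: 'd list. length ks \<le> n})"] conjI ballI allI impI)
    fix f :: "real ^ 'd \<Rightarrow> real" and e assume f: "f \<in> CT n" and e: "\<forall>ks x. length ks \<le> n \<longrightarrow> \<bar>foldr pd ks f x\<bar> \<le> e"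
    have "0 \<le> e" using e[rule_format, of "[]" 0] by simp
    have le: "CT_norm n f \<le> real (card {ks :: 'd list. length ks \<le> n}) * e"
      using e by (intro CT_norm_le) auto
    have "0 \<le> CT_norm n f"
      unfolding CT_norm_def
    proof (intro sum_nonneg)
      fix ks :: "'d list" assume "ks \<in> {ks. length ks \<le> n}"
      then have "bdd_above (range (\<lambda>x. \<bar>foldr pd ks f x\<bar>))" using e by (intro bdd_aboveI[of _ e]) auto
      then have "\<bar>foldr pd ks f 0\<bar> \<le> (SUP x. \<bar>foldr pd ks f x\<bar>)" by (intro cSUP_upper) auto
      then show "0 \<le> (SUP x. \<bar>foldr pd ks f x\<bar>)" by linarith
    qed
    then have "\<bar>h f\<bar> \<le> max C 0 * CT_norm n f"
      using C[OF f] by (meson max.cobounded1 mult_right_mono order_trans)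
    also have "\<dots> \<le> max C 0 * (real (card {ks :: 'd list. length ks \<le> n}) * e)"
      using le by (intro mult_left_mono) auto
    finally show "\<bar>h f\<bar> \<le> max C 0 * real (card {ks :: 'd list. length ks \<le> n}) * e" by (simp add: mult_ac)
  qed simp
qed

lemma dual_add: "h \<in> dual n \<Longrightarrow> f \<in> CT n \<Longrightarrow> g \<in> CT n \<Longrightarrow> h (\<lambda>x. f x + g x) = h f + h g"
  by (auto simp: dual_def)
lemma dual_cmult: "h \<in> dual n \<Longrightarrow> f \<in> CT n \<Longrightarrow> h (\<lambda>x. c * f x) = c * h f"
  by (auto simp: dual_def)
lemma dual_diff: "h \<in> dual n \<Longrightarrow> f \<in> CT n \<Longrightarrow> g \<in> CT n \<Longrightarrow> h (\<lambda>x. f x - g x) = h f - h g"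
  using dual_add[of h n f "\<lambda>x. - 1 * g x"] dual_cmult[of h n g "-1"] CT_cmult[of g n "-1"] by simp
lemma dual_zero: "h \<in> dual n \<Longrightarrow> h (\<lambda>_. 0) = 0"
  using dual_cmult[of h n "\<lambda>_. 0" 0] CT_const[of 0 n] by simp
lemma dual_sum:
  assumes "h \<in> dual n" "finite A" "\<And>i. i \<in> A \<Longrightarrow> f i \<in> CT n"
  shows "h (\<lambda>x. \<Sum>i\<in>A. f i x) = (\<Sum>i\<in>A. h (f i))"
  using assms(2,3)
  by (induction A rule: finite_induct) (auto simp: dual_zero[OF assms(1)] dual_add[OF assms(1)] CT_sum)


section \<open>Differentiation with respect to a parameter\<close>

text \<open>The exchange of two partial derivatives, under the one-sided hypothesis that only the
derivative in the parameter is known to have a continuous derivative in space. Both are limits of the same second difference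
quotient; two applications of the mean value theorem compare it with \<open>pd k (\<Psi>' u) x\<close>.\<close>
lemma has_real_derivative_pd_parameter:
  fixes \<Psi> :: "real \<Rightarrow> real ^ 'd::finite \<Rightarrow> real"
  assumes du: "\<And>u x. ((\<lambda>u. \<Psi> u x) has_real_derivative \<Psi>' u x) (at u)"
    and d1: "\<And>u x. \<Psi> u differentiable (at x)" and d2: "\<And>u x. \<Psi>' u differentiable (at x)"
    and cont: "continuous_on UNIV (\<lambda>(u, x). pd k (\<Psi>' u) x)"
  shows "((\<lambda>u. pd k (\<Psi> u) x) has_real_derivative pd k (\<Psi>' u) x) (at u)"
proof -
  define e :: "real ^ 'd" where "e = axis k 1"
  have line: "((\<lambda>t. f (x + t *\<^sub>R e)) has_real_derivative pd k f (x + t *\<^sub>R e)) (at t)"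
    if "\<And>y. f differentiable (at y)" for f :: "real ^ 'd \<Rightarrow> real" and t
  proof -
    have lin: "linear (frechet_derivative f (at (x + t *\<^sub>R e)))"
      using that by (rule linear_frechet_derivative)
    have "((\<lambda>t. x + t *\<^sub>R e) has_derivative (\<lambda>s. s *\<^sub>R e)) (at t)"
      by (auto intro!: derivative_eq_intros)
    from has_derivative_compose[OF this iffD1[OF frechet_derivative_works that]]
    show ?thesis
      unfolding has_field_derivative_def pd_def e_def[symmetric] linear_cmul[OF lin] by (simp add: mult.commute[of _ "frechet_derivative _ _ _"] mult_commute_abs)
  qed
  define c where "c = pd k (\<Psi>' u) x"
  show ?thesis
    unfolding DERIV_def c_def[symmetric]
  proof (rule LIM_I)
    fix \<epsilon> :: real assume "\<epsilon> > 0"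
    have "isCont (\<lambda>(u, x). pd k (\<Psi>' u) x) (u, x)"
      using cont by (simp add: continuous_on_eq_continuous_at)
    then obtain d where d: "d > 0" "\<And>p. dist p (u, x) < d \<Longrightarrow>
        dist ((\<lambda>(u, x). pd k (\<Psi>' u) x) p) (pd k (\<Psi>' u) x) < \<epsilon> / 2"
      using \<open>\<epsilon> > 0\<close> unfolding continuous_at_eps_delta
      by (metis (no_types, lifting) case_prod_conv half_gt_zero)
    have near: "\<bar>pd k (\<Psi>' v) (x + t *\<^sub>R e) - c\<bar> \<le> \<epsilon> / 2" if "\<bar>v - u\<bar> < d / 2" "\<bar>t\<bar> < d / 2" for v t
    proof -
      have "dist (v, x + t *\<^sub>R e) (u, x) \<le> dist v u + dist (x + t *\<^sub>R e) x"
        by (simp add: dist_prod_def sqrt_sum_squares_le_sum)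
      also have "\<dots> < d" using that by (simp add: dist_norm e_def)
      finally show ?thesis using d(2)[of "(v, x + t *\<^sub>R e)"] by (simp add: dist_real_def c_def)
    qed
    show "\<exists>s>0. \<forall>z. z \<noteq> 0 \<and> norm (z - 0) < s \<longrightarrow>
        norm ((pd k (\<Psi> (u + z)) x - pd k (\<Psi> u) x) / z - c) < \<epsilon>"
    proof (intro exI[of _ "d / 2"] conjI allI impI)
      fix h :: real assume h: "h \<noteq> 0 \<and> norm (h - 0) < d / 2"
      \<comment> \<open>The difference \<open>\<kappa> t - \<kappa> 0\<close> is the second difference of \<open>\<Psi>\<close> minus its expected value \<open>t * h * c\<close>.\<close>
      define \<kappa> where "\<kappa> t = \<Psi> (u + h) (x + t *\<^sub>R e) - \<Psi> u (x + t *\<^sub>R e) - t * h * c" for t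
      have bound: "\<bar>\<kappa> t - \<kappa> 0\<bar> \<le> \<bar>h\<bar> * (\<bar>t\<bar> * (\<epsilon> / 2))" if t: "\<bar>t\<bar> < d / 2" for t
      proof -
        define lam where "lam v = \<Psi> v (x + t *\<^sub>R e) - \<Psi> v x - v * (t * c)" for v
        have "norm (lam (u + h) - lam u) \<le> (\<bar>t\<bar> * (\<epsilon> / 2)) * norm (u + h - u)"
        proof (rule field_differentiable_bound[where S = "ball u (d/2)"])
          fix v assume v: "v \<in> ball u (d/2)"
          show "(lam has_field_derivative (\<Psi>' v (x + t *\<^sub>R e) - \<Psi>' v x - t * c)) (at v within ball u (d/2))"
            unfolding lam_def by (auto intro!: derivative_eq_intros has_field_derivative_at_within[OF du])
          have "norm ((\<Psi>' v (x + t *\<^sub>R e) - t * c) - (\<Psi>' v (x + 0 *\<^sub>R e) - 0 * c)) \<le> (\<epsilon> / 2) * norm (t - 0)"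
          proof (rule field_differentiable_bound[where S = "ball 0 (d/2)"])
            fix s :: real assume s: "s \<in> ball 0 (d/2)"
            show "((\<lambda>t. \<Psi>' v (x + t *\<^sub>R e) - t * c) has_field_derivative (pd k (\<Psi>' v) (x + s *\<^sub>R e) - c))
                (at s within ball 0 (d/2))"
              by (auto intro!: derivative_eq_intros has_field_derivative_at_within[OF line[OF d2]])
            show "norm (pd k (\<Psi>' v) (x + s *\<^sub>R e) - c) \<le> \<epsilon> / 2"
              using near[of v s] v s by (auto simp: dist_real_def abs_minus_commute)
          qed (use t d in auto)
          then show "norm (\<Psi>' v (x + t *\<^sub>R e) - \<Psi>' v x - t * c) \<le> \<bar>t\<bar> * (\<epsilon> / 2)"
            by (simp add: algebra_simps)
        qed (use h d in \<open>auto simp: dist_real_def\<close>)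
        then show ?thesis by (simp add: lam_def \<kappa>_def algebra_simps)
      qed
      define D where "D = pd k (\<Psi> (u + h)) x - pd k (\<Psi> u) x - h * c"
      have "(\<kappa> has_real_derivative D) (at 0)"
        unfolding \<kappa>_def D_def
        using line[OF d1[of "u + h"], of 0] line[OF d1[of u], of 0]
        by (auto intro!: derivative_eq_intros)
      then have "((\<lambda>t. \<bar>(\<kappa> (0 + t) - \<kappa> 0) / t\<bar>) \<longlongrightarrow> \<bar>D\<bar>) (at 0)"
        unfolding DERIV_def by (intro tendsto_rabs) simp
      moreover have "\<forall>\<^sub>F t in at 0. \<bar>(\<kappa> (0 + t) - \<kappa> 0) / t\<bar> \<le> \<bar>h\<bar> * (\<epsilon> / 2)"
        unfolding eventually_at
      proof (intro exI[of _ "d / 2"] conjI ballI impI)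
        fix t :: real assume t: "t \<noteq> 0 \<and> dist t 0 < d / 2"
        then have "\<bar>\<kappa> t - \<kappa> 0\<bar> \<le> (\<bar>h\<bar> * (\<epsilon> / 2)) * \<bar>t\<bar>" using bound[of t] by (simp add: algebra_simps)
        then show "\<bar>(\<kappa> (0 + t) - \<kappa> 0) / t\<bar> \<le> \<bar>h\<bar> * (\<epsilon> / 2)"
          using t by (simp add: divide_le_eq)
      qed (use d in auto)
      ultimately have D: "\<bar>D\<bar> \<le> \<bar>h\<bar> * (\<epsilon> / 2)"
        by (intro tendsto_upperbound) auto
      have "(pd k (\<Psi> (u + h)) x - pd k (\<Psi> u) x) / h - c = D / h"
        using h by (simp add: D_def field_simps)
      also have "\<bar>D / h\<bar> \<le> \<epsilon> / 2" using D h by (simp add: divide_le_eq mult.commute)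
      finally show "norm ((pd k (\<Psi> (u + h)) x - pd k (\<Psi> u) x) / h - c) < \<epsilon>"
        using \<open>\<epsilon> > 0\<close> by (simp)
    qed (use d in auto)
  qed
qed

lemma has_real_derivative_foldr_pd_parameter:
  assumes "\<And>u x. ((\<lambda>u. \<Psi> u x) has_real_derivative \<Psi>' u x) (at u)"
    and "\<And>u. Ck n (\<Psi> u)" and "Ck_family n \<Psi>'" and "length ks \<le> n"
  shows "((\<lambda>u. foldr pd ks (\<Psi> u) x) has_real_derivative foldr pd ks (\<Psi>' u) x) (at u)"
  using assms
proof (induction ks arbitrary: n \<Psi> \<Psi>' u x rule: rev_induct)
  case (snoc k ks)
  then obtain m where n: "n = Suc m" by (cases n) auto
  have "((\<lambda>u. foldr pd ks (pd k (\<Psi> u)) x) has_real_derivative foldr pd ks (pd k (\<Psi>' u)) x) (at u)"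
  proof (rule snoc.IH)
    show "((\<lambda>u. pd k (\<Psi> u) x) has_real_derivative pd k (\<Psi>' u) x) (at u)" for u x
      using snoc.prems n
      by (intro has_real_derivative_pd_parameter) (auto intro!: Ck_family_continuous[of m])
    show "Ck m (pd k (\<Psi> u))" for u using snoc.prems n by auto
    show "Ck_family m (\<lambda>u. pd k (\<Psi>' u))" using snoc.prems n by auto
    show "length ks \<le> m" using snoc.prems n by simp
  qed
  then show ?case by simp
qed simp

text \<open>By the mean value theorem in \<open>u\<close>, the difference quotients of all spatial derivatives converge
uniformly in \<open>x\<close>; so the difference quotients of \<open>\<Psi>\<close> converge in $C^n$, and \<open>h\<close> is continuous there.\<close>
lemma dual_has_real_derivative:
  fixes \<Psi> :: "real \<Rightarrow> real ^ 'd::finite \<Rightarrow> real"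
  assumes h: "h \<in> dual n"
    and du: "\<And>u x. ((\<lambda>u. \<Psi> u x) has_real_derivative \<Psi>' u x) (at u)"
    and \<Psi>: "\<And>u. \<Psi> u \<in> CT n" and \<Psi>': "\<And>u. \<Psi>' u \<in> CT n" "Ck_family n \<Psi>'"
  shows "((\<lambda>u. h (\<Psi> u)) has_real_derivative h (\<Psi>' u)) (at u)"
proof -
  obtain C where C: "C \<ge> 0" "\<And>f e. f \<in> CT n \<Longrightarrow>
      (\<And>ks x. length ks \<le> n \<Longrightarrow> \<bar>foldr pd ks f x\<bar> \<le> e) \<Longrightarrow> \<bar>h f\<bar> \<le> C * e"
    using dual_le[OF h] by metis
  show ?thesis
    unfolding DERIV_def
  proof (rule LIM_I)
    fix \<epsilon> :: real assume "\<epsilon> > 0"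
    define e where "e = \<epsilon> / (C + 1)"
    have e: "e > 0" "C * e < \<epsilon>" using \<open>\<epsilon> > 0\<close> C by (auto simp: e_def field_simps)
    have "\<exists>\<delta>>0. \<forall>v. dist v u < \<delta> \<longrightarrow> (\<forall>x. \<bar>foldr pd ks (\<Psi>' v) x - foldr pd ks (\<Psi>' u) x\<bar> < e)"
      if "length ks \<le> n" for ks :: "'d list"
    proof (rule periodic_family_uniform)
      show "continuous_on UNIV (\<lambda>(u, x). foldr pd ks (\<Psi>' u) x)"
        using Ck_family_foldr_pd[OF \<Psi>'(2) that] by (rule Ck_family_continuous)
      show "foldr pd ks (\<Psi>' v) (x + k) = foldr pd ks (\<Psi>' v) x" if "k \<in> lattice" for v x k
        using CT_D(2)[OF CT_foldr_pd[OF \<Psi>'(1) \<open>length ks \<le> n\<close>] that] .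
    qed (use e in auto)
    then obtain \<delta> where \<delta>: "\<And>ks :: 'd list. length ks \<le> n \<Longrightarrow> \<delta> ks > 0"
      "\<And>ks v x. length ks \<le> n \<Longrightarrow> dist v u < \<delta> ks \<Longrightarrow> \<bar>foldr pd ks (\<Psi>' v) x - foldr pd ks (\<Psi>' u) x\<bar> < e"
      by metis
    define d where "d = Min (\<delta> ` {ks. length ks \<le> n})"
    have fin: "finite {ks :: 'd list. length ks \<le> n}"
      using finite_lists_length_le[of "UNIV :: 'd set" n] by simp
    have d: "d > 0" "\<And>ks. length ks \<le> n \<Longrightarrow> d \<le> \<delta> ks"
    proof -
      have "{ks :: 'd list. length ks \<le> n} \<noteq> {}" by (auto intro: exI[of _ "[]"])
      then show "d > 0" using fin \<delta>(1) by (auto simp: d_def Min_gr_iff)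
      show "d \<le> \<delta> ks" if "length ks \<le> n" for ks
        using fin that by (auto simp: d_def)
    qed
    show "\<exists>s>0. \<forall>z. z \<noteq> 0 \<and> norm (z - 0) < s \<longrightarrow> norm ((h (\<Psi> (u + z)) - h (\<Psi> u)) / z - h (\<Psi>' u)) < \<epsilon>"
    proof (intro exI[of _ d] conjI allI impI)
      fix z :: real assume z: "z \<noteq> 0 \<and> norm (z - 0) < d"
      define q where "q = (\<lambda>x. (1 / z) * (\<Psi> (u + z) x - \<Psi> u x) - \<Psi>' u x)"
      have q: "q \<in> CT n" unfolding q_def using \<Psi> \<Psi>' by (intro CT_diff CT_cmult)
      have "\<bar>foldr pd ks q x\<bar> \<le> e" if ks: "length ks \<le> n" for ks x
      proof -
        have "foldr pd ks q = foldr pd ks (\<lambda>x. 1 * (1 / z * \<Psi> (u + z) x + (- 1 / z) * \<Psi> u x) + (-1) * \<Psi>' u x)"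
          unfolding q_def using z by (intro arg_cong[where f = "foldr pd ks"]) (auto simp: fun_eq_iff field_simps)
        also have "\<dots> = (\<lambda>x. 1 * foldr pd ks (\<lambda>x. 1 / z * \<Psi> (u + z) x + (- 1 / z) * \<Psi> u x) x
            + (-1) * foldr pd ks (\<Psi>' u) x)"
          using \<Psi> \<Psi>' ks by (intro foldr_pd_linear[of n] Ck_add Ck_cmult) (auto simp: CT_def)
        also have "foldr pd ks (\<lambda>x. 1 / z * \<Psi> (u + z) x + (- 1 / z) * \<Psi> u x) =
            (\<lambda>x. 1 / z * foldr pd ks (\<Psi> (u + z)) x + (- 1 / z) * foldr pd ks (\<Psi> u) x)"
          using \<Psi> ks by (intro foldr_pd_linear[of n]) (auto simp: CT_def)
        finally have eq: "foldr pd ks q x = (1 / z) * (foldr pd ks (\<Psi> (u + z)) x - foldr pd ks (\<Psi> u) x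
            - z * foldr pd ks (\<Psi>' u) x)" using z by (simp add: field_simps)
        have "norm ((foldr pd ks (\<Psi> (u + z)) x - (u + z) * foldr pd ks (\<Psi>' u) x)
            - (foldr pd ks (\<Psi> u) x - u * foldr pd ks (\<Psi>' u) x)) \<le> e * norm (u + z - u)"
        proof (rule field_differentiable_bound[where S = "ball u d"])
          fix v assume v: "v \<in> ball u d"
          show "((\<lambda>v. foldr pd ks (\<Psi> v) x - v * foldr pd ks (\<Psi>' u) x) has_field_derivative
            (foldr pd ks (\<Psi>' v) x - foldr pd ks (\<Psi>' u) x)) (at v within ball u d)"
            by (auto intro!: derivative_eq_intros has_field_derivative_at_within
                [OF has_real_derivative_foldr_pd_parameter[OF du CT_D(1)[OF \<Psi>] \<Psi>'(2) ks]])
          show "norm (foldr pd ks (\<Psi>' v) x - foldr pd ks (\<Psi>' u) x) \<le> e"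
            using \<delta>(2)[OF ks, of v x] d(2)[OF ks] v by (auto simp: dist_commute)
        qed (use z d in \<open>auto simp: dist_real_def\<close>)
        then have "\<bar>foldr pd ks (\<Psi> (u + z)) x - foldr pd ks (\<Psi> u) x - z * foldr pd ks (\<Psi>' u) x\<bar> \<le> e * \<bar>z\<bar>"
          by (simp add: algebra_simps)
        then show ?thesis unfolding eq using z by (simp add: abs_mult divide_le_eq)
      qed
      then have "\<bar>h q\<bar> \<le> C * e" by (intro C(2) q)
      moreover have "h q = (h (\<Psi> (u + z)) - h (\<Psi> u)) / z - h (\<Psi>' u)"
      proof -
        have "h q = h (\<lambda>x. (1 / z) * (\<Psi> (u + z) x - \<Psi> u x)) - h (\<Psi>' u)"
          unfolding q_def by (rule dual_diff[OF h CT_cmult[OF CT_diff[OF \<Psi> \<Psi>]] \<Psi>'(1)])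
        also have "h (\<lambda>x. (1 / z) * (\<Psi> (u + z) x - \<Psi> u x)) = (1 / z) * (h (\<Psi> (u + z)) - h (\<Psi> u))"
          by (simp only: dual_cmult[OF h CT_diff[OF \<Psi> \<Psi>]] dual_diff[OF h \<Psi> \<Psi>])
        finally show ?thesis by simp
      qed
      ultimately show "norm ((h (\<Psi> (u + z)) - h (\<Psi> u)) / z - h (\<Psi>' u)) < \<epsilon>"
        using e by simp
    qed (use d in auto)
  qed
qed

lemma torus_maps_drift:
  fixes T :: "real ^ 'd::finite \<Rightarrow> real ^ 'd"
  assumes "T \<in> torus_maps n" "\<And>i. (\<lambda>x. \<beta> x $ i) \<in> CT n"
  shows "(\<lambda>x. T x + u *\<^sub>R \<beta> x) \<in> torus_maps n"
proof -
  have "\<beta> (x + k) = \<beta> x" if "k \<in> lattice" for x k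
    using CT_D(2)[OF assms(2) that] by (simp add: vec_eq_iff)
  then show ?thesis using assms by (auto simp: torus_maps_def CT_def intro!: Ck_add Ck_cmult)
qed

text \<open>One more derivative of \<open>\<phi>\<close> than \<open>h\<close> can absorb is needed, because differentiating in \<open>u\<close> moves a
derivative onto \<open>\<phi>\<close>.\<close>
lemma dual_drift_derivative:
  fixes T :: "real ^ 'd::finite \<Rightarrow> real ^ 'd"
  assumes T: "T \<in> torus_maps n" and \<beta>: "\<And>i. (\<lambda>x. \<beta> x $ i) \<in> CT n"
    and \<phi>: "\<phi> \<in> CT (Suc n)" and h: "h \<in> dual n"
  shows "((\<lambda>u. h (\<lambda>x. \<phi> (T x + u *\<^sub>R \<beta> x))) has_real_derivative
    (\<Sum>k\<in>UNIV. h (\<lambda>x. \<beta> x $ k * pd k \<phi> (T x + u *\<^sub>R \<beta> x)))) (at u)"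
proof -
  have \<phi>n: "\<phi> \<in> CT n" using \<phi> by (rule CT_le) simp
  have inCT: "(\<lambda>x. \<beta> x $ k * pd k \<phi> (T x + u *\<^sub>R \<beta> x)) \<in> CT n" for k u
    by (intro CT_mult \<beta> CT_compose[OF CT_pd[OF \<phi>]] torus_maps_drift T)
  have "((\<lambda>u. h (\<lambda>x. \<phi> (T x + u *\<^sub>R \<beta> x))) has_real_derivative
     h (\<lambda>x. \<Sum>k\<in>UNIV. \<beta> x $ k * pd k \<phi> (T x + u *\<^sub>R \<beta> x))) (at u)"
  proof (rule dual_has_real_derivative[OF h])
    fix u x
    have d: "((\<lambda>u. T x + u *\<^sub>R \<beta> x) has_derivative (\<lambda>s. s *\<^sub>R \<beta> x)) (at u)"
      by (auto intro!: derivative_eq_intros)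
    have "\<phi> differentiable (at (T x + u *\<^sub>R \<beta> x))" using \<phi> by (auto simp: CT_def)
    from has_derivative_compose[OF d has_derivative_pd[OF this]]
    show "((\<lambda>u. \<phi> (T x + u *\<^sub>R \<beta> x)) has_real_derivative
      (\<Sum>k\<in>UNIV. \<beta> x $ k * pd k \<phi> (T x + u *\<^sub>R \<beta> x))) (at u)"
      unfolding has_field_derivative_def
      by (rule has_derivative_eq_rhs) (auto simp: fun_eq_iff sum_distrib_right sum_distrib_left mult_ac intro!: sum.cong)
  next
    show "(\<lambda>x. \<phi> (T x + u *\<^sub>R \<beta> x)) \<in> CT n" for u
      by (intro CT_compose[OF \<phi>n] torus_maps_drift T \<beta>)
    show "(\<lambda>x. \<Sum>k\<in>UNIV. \<beta> x $ k * pd k \<phi> (T x + u *\<^sub>R \<beta> x)) \<in> CT n" for u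
      by (intro CT_sum inCT) auto
    show "Ck_family n (\<lambda>u x. \<Sum>k\<in>UNIV. \<beta> x $ k * pd k \<phi> (T x + u *\<^sub>R \<beta> x))"
    proof (rule Ck_family_sum[OF finite], rule Ck_family_mult)
      fix k
      have \<beta>n: "Ck_family n (\<lambda>(u::real) x. \<beta> x $ i)" for i
        using \<beta>[of i] by (intro Ck_imp_family) (simp add: CT_def)
      then show "Ck_family n (\<lambda>(u::real) x. \<beta> x $ k)" .
      have Tn: "Ck_family n (\<lambda>(u::real) x. T x $ i)" for i
        using T by (intro Ck_imp_family) (simp add: torus_maps_def)
      show "Ck_family n (\<lambda>u x. pd k \<phi> (T x + u *\<^sub>R \<beta> x))"
      proof (rule Ck_family_compose)
        show "Ck n (pd k \<phi>)" using CT_pd[OF \<phi>] by (simp add: CT_def)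
        have "Ck_family n (\<lambda>u x. T x $ i + u * \<beta> x $ i)" for i
          by (rule Ck_family_add[OF Tn Ck_family_mult[OF Ck_family_param \<beta>n]]) auto
        then show "Ck_family n (\<lambda>u x. (T x + u *\<^sub>R \<beta> x) $ i)" for i by simp
      qed
    qed
  qed
  then show ?thesis by (simp add: dual_sum[OF h] inCT)
qed

section \<open>Mollification\<close>

lemma continuous_on_flip: "continuous_on UNIV (\<lambda>(y, x). \<Psi> y x) \<Longrightarrow> continuous_on S (\<lambda>(x, y). \<Psi> y x)"
proof -
  assume "continuous_on UNIV (\<lambda>(y, x). \<Psi> y x)"
  from continuous_on_compose2[OF this continuous_on_swap[of S]] show ?thesis
    by (simp add: split_beta)
qed

lemma parametric_integral_has_derivative:
  fixes \<Psi> :: "'e::euclidean_space \<Rightarrow> real ^ 'd::finite \<Rightarrow> real"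
  assumes "Ck_family (Suc n) \<Psi>"
  shows "((\<lambda>x. integral (cbox a b) (\<lambda>y. \<Psi> y x)) has_derivative
    (\<lambda>v. \<Sum>k\<in>UNIV. v $ k * integral (cbox a b) (\<lambda>y. pd k (\<Psi> y) x))) (at x)"
proof -
  define D where "D x y = (\<Sum>k\<in>UNIV. pd k (\<Psi> y) x *\<^sub>R blinfun_inner_left (axis k 1 :: real ^ 'd))" for x y
  have D: "blinfun_apply (D x y) = (\<lambda>v. \<Sum>k\<in>UNIV. v $ k * pd k (\<Psi> y) x)" for x y
    by (simp add: D_def fun_eq_iff blinfun.sum_left blinfun.scaleR_left inner_axis mult_ac)
  have cont: "continuous_on UNIV (\<lambda>(y, x). pd k (\<Psi> y) x)" for k
    using assms by (intro Ck_family_continuous[of n]) simp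
  have ck: "continuous_on S (\<lambda>(x, y). pd k (\<Psi> y) x)" for k S
    by (rule continuous_on_flip[OF cont])
  have c0: "continuous_on S (\<lambda>(x, y). \<Psi> y x)" for S
    by (rule continuous_on_flip[OF Ck_family_continuous[OF assms]])
  have sec: "continuous_on S (\<lambda>y. f y x)" if "\<And>S. continuous_on S (\<lambda>(x, y). f y x)" for f :: "'e \<Rightarrow> real ^ 'd \<Rightarrow> real" and S x
    using continuous_on_compose2[OF that[of UNIV], of S "\<lambda>y. (x, y)"] by (simp add: continuous_on_Pair)
  have cD: "continuous_on S (\<lambda>(x, y). D x y)" for S
    unfolding D_def split_beta using ck[unfolded split_beta]
    by (intro continuous_on_sum continuous_on_scaleR continuous_on_const) auto
  have "((\<lambda>x. integral (cbox a b) ((\<lambda>x y. \<Psi> y x) x)) has_derivative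
      blinfun_apply (integral (cbox a b) (D x))) (at x within UNIV)"
  proof (rule leibniz_rule)
    show "((\<lambda>x. \<Psi> y x) has_derivative blinfun_apply (D x y)) (at x within UNIV)" for x y
      unfolding D using assms by (intro has_derivative_pd) simp
    show "(\<lambda>y. \<Psi> y x) integrable_on cbox a b" for x
      by (intro integrable_continuous sec c0)
  qed (auto intro: cD)
  moreover have "blinfun_apply (integral (cbox a b) (D x)) =
      (\<lambda>v. \<Sum>k\<in>UNIV. v $ k * integral (cbox a b) (\<lambda>y. pd k (\<Psi> y) x))"
  proof
    fix v
    have "continuous_on (cbox a b) (D x)"
      using continuous_on_compose2[OF cD[of UNIV], of "cbox a b" "\<lambda>y. (x, y)"] by (simp add: continuous_on_Pair)
    then have "blinfun_apply (integral (cbox a b) (D x)) v = integral (cbox a b) (\<lambda>y. \<Sum>k\<in>UNIV. v $ k * pd k (\<Psi> y) x)"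
      by (simp add: blinfun_apply_integral integrable_continuous D)
    also have "\<dots> = (\<Sum>k\<in>UNIV. v $ k * integral (cbox a b) (\<lambda>y. pd k (\<Psi> y) x))"
      by (subst integral_sum) (auto intro: integrable_on_mult_right[OF integrable_continuous[OF sec[OF ck]]])
    finally show "blinfun_apply (integral (cbox a b) (D x)) v = \<dots>" .
  qed
  ultimately show ?thesis by simp
qed

lemma pd_parametric_integral:
  fixes \<Psi> :: "'e::euclidean_space \<Rightarrow> real ^ 'd::finite \<Rightarrow> real"
  assumes "Ck_family (Suc n) \<Psi>"
  shows "pd k (\<lambda>x. integral (cbox a b) (\<lambda>y. \<Psi> y x)) = (\<lambda>x. integral (cbox a b) (\<lambda>y. pd k (\<Psi> y) x))"
proof
  fix x
  have "(\<Sum>j\<in>UNIV. axis k 1 $ j * integral (cbox a b) (\<lambda>y. pd j (\<Psi> y) x)) = integral (cbox a b) (\<lambda>y. pd k (\<Psi> y) x)"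
    by (simp add: axis_def if_distrib[of "\<lambda>c. c * _"] cong: if_cong)
  then show "pd k (\<lambda>x. integral (cbox a b) (\<lambda>y. \<Psi> y x)) x = integral (cbox a b) (\<lambda>y. pd k (\<Psi> y) x)"
    using pd_eqI[OF parametric_integral_has_derivative[OF assms]] by simp
qed

lemma Ck_parametric_integral:
  fixes \<Psi> :: "'e::euclidean_space \<Rightarrow> real ^ 'd::finite \<Rightarrow> real"
  shows "Ck_family n \<Psi> \<Longrightarrow> Ck n (\<lambda>x. integral (cbox a b) (\<lambda>y. \<Psi> y x))"
proof (induction n arbitrary: \<Psi>)
  case 0
  have "continuous_on (UNIV \<times> cbox a b) (\<lambda>(x, y). \<Psi> y x)" by (rule continuous_on_flip) (use 0 in simp)
  from integral_continuous_on_param[OF this] show ?case by simp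
next
  case (Suc n)
  have "(\<lambda>x. integral (cbox a b) (\<lambda>y. \<Psi> y x)) differentiable (at x)" for x
    unfolding differentiable_def using parametric_integral_has_derivative[OF Suc.prems] by blast
  moreover have "Ck n (\<lambda>x. integral (cbox a b) (\<lambda>y. pd k (\<Psi> y) x))" for k
    by (rule Suc.IH) (use Suc.prems in simp)
  ultimately show ?case by (simp add: pd_parametric_integral[OF Suc.prems])
qed

text \<open>An unnormalised mollifier. It is only $C^1$, which suffices since a single derivative has to be gained.\<close>
definition bump :: "real \<Rightarrow> 'a::real_inner \<Rightarrow> real"
  where "bump \<eta> y = (max 0 (\<eta>\<^sup>2 - y \<bullet> y))\<^sup>2"

definition mollify :: "real \<Rightarrow> (real ^ 'd::finite \<Rightarrow> real) \<Rightarrow> real ^ 'd \<Rightarrow> real"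
  where "mollify \<eta> f x = integral (cbox (- (\<eta> *\<^sub>R One)) (\<eta> *\<^sub>R One)) (\<lambda>y. bump \<eta> y * f (x + y))"

lemma bump_nonneg: "0 \<le> bump \<eta> y"
  by (simp add: bump_def)

lemma bump_eq_0: "norm y \<ge> \<eta> \<Longrightarrow> \<eta> \<ge> 0 \<Longrightarrow> bump \<eta> y = 0"
  by (simp add: bump_def dot_square_norm power_mono)

lemma continuous_bump: "continuous_on S (bump \<eta>)"
  unfolding bump_def[abs_def] by (intro continuous_intros)

lemma bump_Ck: "Ck 1 (bump \<eta> :: real ^ 'd::finite \<Rightarrow> real)"
proof -
  have sq: "((\<lambda>s. (max 0 s)\<^sup>2) has_real_derivative 2 * max 0 s) (at s)" for s :: real
  proof -
    consider "s > 0" | "s < 0" | "s = 0" by linarith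
    then show ?thesis
    proof cases
      case 1
      have "((\<lambda>s. s\<^sup>2) has_real_derivative 2 * max 0 s) (at s)"
        using 1 by (auto intro!: derivative_eq_intros)
      then show ?thesis
        by (rule has_field_derivative_transform_within_open[where S = "{0<..}"]) (use 1 in auto)
    next
      case 2
      have "((\<lambda>s. 0) has_real_derivative 2 * max 0 s) (at s)"
        using 2 by auto
      then show ?thesis
        by (rule has_field_derivative_transform_within_open[where S = "{..<0}"]) (use 2 in auto)
    next
      case 3
      have "((\<lambda>h::real. (max 0 h)\<^sup>2 / h) \<longlongrightarrow> 0) (at 0)"
      proof (rule Lim_null_comparison)
        show "\<forall>\<^sub>F h in at 0. norm ((max 0 h)\<^sup>2 / h) \<le> \<bar>h\<bar>" for h :: real
          by (auto simp: max_def power2_eq_square)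
        show "((\<lambda>h::real. \<bar>h\<bar>) \<longlongrightarrow> 0) (at 0)" by (rule tendsto_rabs_zero) simp
      qed
      then show ?thesis using 3 by (simp add: DERIV_def)
    qed
  qed
  have D: "(bump \<eta> has_derivative (\<lambda>v. 2 * max 0 (\<eta>\<^sup>2 - x \<bullet> x) * - (2 * (x \<bullet> v)))) (at x)" for x :: "real ^ 'd"
  proof -
    have "((\<lambda>y. \<eta>\<^sup>2 - y \<bullet> y) has_derivative (\<lambda>v. - (2 * (x \<bullet> v)))) (at x)"
      by (auto intro!: derivative_eq_intros simp: inner_commute)
    from has_derivative_compose[OF this sq[of "\<eta>\<^sup>2 - x \<bullet> x", unfolded has_field_derivative_def]]
    show ?thesis by (simp add: bump_def[abs_def])
  qed
  have "pd k (bump \<eta>) = (\<lambda>x::real ^ 'd. 2 * max 0 (\<eta>\<^sup>2 - x \<bullet> x) * - (2 * (x $ k)))" for k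
    by (rule ext) (simp add: pd_eqI[OF D] inner_axis)
  moreover have "continuous_on UNIV (\<lambda>x::real ^ 'd. 2 * max 0 (\<eta>\<^sup>2 - x \<bullet> x) * - (2 * (x $ k)))" for k
    by (intro continuous_intros)
  ultimately show ?thesis using D unfolding One_nat_def Ck.simps by (auto simp: differentiable_def)
qed

lemma Ck_vec_nth: "Ck n (\<lambda>x::real ^ 'd::finite. x $ i)"
proof -
  have "pd k (\<lambda>x::real ^ 'd. x $ i) = (\<lambda>_. axis k 1 $ i)" for k
    by (rule ext) (rule pd_eqI[OF bounded_linear_imp_has_derivative[OF bounded_linear_vec_nth]])
  moreover have "(\<lambda>x::real ^ 'd. x $ i) differentiable at x" for x
    by (rule bounded_linear_imp_differentiable[OF bounded_linear_vec_nth])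
  ultimately show ?thesis by (cases n) (auto intro!: continuous_intros Ck_const)
qed

lemma Ck_translate_family:
  assumes "Ck n f"
  shows "Ck_family n (\<lambda>y x. f (x + y))"
proof (rule Ck_family_compose[OF assms])
  fix i
  have "Ck_family n (\<lambda>(y::real ^ 'a) x::real ^ 'a. x $ i)"
    by (rule Ck_imp_family[OF Ck_vec_nth])
  moreover have "Ck_family n (\<lambda>y x::real ^ 'a. y $ i)"
    by (rule Ck_family_param) (intro continuous_intros)
  ultimately show "Ck_family n (\<lambda>y x::real ^ 'a. (x + y) $ i)"
    by (simp add: Ck_family_add)
qed

lemma mollify_integrand_family:
  assumes "Ck n f"
  shows "Ck_family n (\<lambda>y x. bump \<eta> y * f (x + y))"
  by (intro Ck_family_mult Ck_family_param continuous_bump Ck_translate_family assms)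

lemma Ck_mollify: "Ck n f \<Longrightarrow> Ck n (mollify \<eta> f)"
  unfolding mollify_def[abs_def] by (rule Ck_parametric_integral[OF mollify_integrand_family])

lemma pd_mollify:
  assumes "Ck (Suc n) f"
  shows "pd k (mollify \<eta> f) = mollify \<eta> (pd k f)"
proof -
  have d: "f differentiable (at x)" for x using assms by simp
  have "pd k (\<lambda>x. f (x + y)) x = pd k f (x + y)" for x y
    by (rule pd_translate(2)[OF d])
  moreover have "(\<lambda>x. f (x + y)) differentiable (at x)" for x y
    using Ck_translate_family[OF assms] by simp
  ultimately have "pd k (\<lambda>x. bump \<eta> y * f (x + y)) x = bump \<eta> y * pd k f (x + y)" for x y
    by (simp add: pd_cmult)
  then show ?thesis
    unfolding mollify_def[abs_def] pd_parametric_integral[OF mollify_integrand_family[OF assms]] by simp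
qed

lemma foldr_pd_mollify:
  "Ck n f \<Longrightarrow> length ks \<le> n \<Longrightarrow> foldr pd ks (mollify \<eta> f) = mollify \<eta> (foldr pd ks f)"
proof (induction ks arbitrary: n f rule: rev_induct)
  case (snoc k ks)
  then obtain m where n: "n = Suc m" by (cases n) auto
  then show ?case using snoc.IH[of m "pd k f"] snoc.prems pd_mollify[of m f k \<eta>] by auto
qed simp

text \<open>After a translation of the integration variable the argument \<open>x\<close> sits in the smooth kernel, and the
integral may be differentiated there. The domain of integration then depends on \<open>x\<close>; it is replaced by a larger cube that
works for all \<open>x\<close> near a given point.\<close>
lemma mollify_continuous_Ck1:
  fixes f :: "real ^ 'd::finite \<Rightarrow> real"
  assumes "continuous_on UNIV f" "\<eta> > 0"
  shows "Ck 1 (mollify \<eta> f)"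
proof -
  define F where "F x0 x = integral (cbox (x0 - (\<eta> + 1) *\<^sub>R One) (x0 + (\<eta> + 1) *\<^sub>R One)) (\<lambda>z. bump \<eta> (x - z) * f z)" for x0 x :: "real ^ 'd"
  have F: "Ck 1 (F x0)" for x0
    unfolding F_def[abs_def]
  proof (rule Ck_parametric_integral)
    have "Ck_family 1 (\<lambda>z x. bump \<eta> (x - z :: real ^ 'd))"
    proof (rule Ck_family_compose[OF bump_Ck])
      fix i
      have "Ck_family 1 (\<lambda>z x::real ^ 'd. x $ i + - (z $ i))"
        by (intro Ck_family_add Ck_imp_family[OF Ck_vec_nth] Ck_family_param continuous_intros)
      then show "Ck_family 1 (\<lambda>z x::real ^ 'd. (x - z) $ i)" by simp
    qed
    moreover have "Ck_family 1 (\<lambda>z (x::real ^ 'd). f z)"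
      by (rule Ck_family_param[OF assms(1)])
    ultimately show "Ck_family 1 (\<lambda>z x::real ^ 'd. bump \<eta> (x - z) * f z)"
      by (rule Ck_family_mult)
  qed
  have eq: "mollify \<eta> f x = F x0 x" if x: "x \<in> ball x0 1" for x x0
  proof -
    have sym: "bump \<eta> (z - x) = bump \<eta> (x - z)" for z :: "real ^ 'd"
      by (simp add: bump_def inner_diff algebra_simps inner_commute)
    have out: "bump \<eta> (x - z) * f z = 0" if "z \<notin> cbox (- (\<eta> *\<^sub>R One) + x) (\<eta> *\<^sub>R One + x)" for z
    proof -
      from that obtain b :: "real ^ 'd" where b: "b \<in> Basis" "\<bar>(x - z) \<bullet> b\<bar> > \<eta>"
        by (auto simp: mem_box algebra_simps inner_simps not_le abs_if)
      have "norm (x - z) \<ge> \<eta>"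
        using Basis_le_norm[OF b(1), of "x - z"] b(2) by linarith
      then show ?thesis using bump_eq_0[of \<eta> "x - z"] \<open>\<eta> > 0\<close> by simp
    qed
    have sub: "cbox (- (\<eta> *\<^sub>R One) + x) (\<eta> *\<^sub>R One + x) \<subseteq> cbox (x0 - (\<eta> + 1) *\<^sub>R One) (x0 + (\<eta> + 1) *\<^sub>R One)"
    proof -
      have "\<bar>(x - x0) \<bullet> b\<bar> \<le> 1" if "b \<in> Basis" for b
        using Basis_le_norm[OF that, of "x - x0"] x by (simp add: dist_norm norm_minus_commute)
      note near = this
      show ?thesis
      proof
        fix z assume z: "z \<in> cbox (- (\<eta> *\<^sub>R One) + x) (\<eta> *\<^sub>R One + x)"
        show "z \<in> cbox (x0 - (\<eta> + 1) *\<^sub>R One) (x0 + (\<eta> + 1) *\<^sub>R One)"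
          unfolding mem_box
        proof (intro ballI)
          fix b :: "real ^ 'd" assume b: "b \<in> Basis"
          then have "- \<eta> + x \<bullet> b \<le> z \<bullet> b" "z \<bullet> b \<le> \<eta> + x \<bullet> b"
            using z by (auto simp: mem_box inner_simps)
          then show "(x0 - (\<eta> + 1) *\<^sub>R One) \<bullet> b \<le> z \<bullet> b \<and> z \<bullet> b \<le> (x0 + (\<eta> + 1) *\<^sub>R One) \<bullet> b"
            using near[OF b] b by (simp add: inner_simps abs_le_iff)
        qed
      qed
    qed
    let ?G = "\<lambda>z. bump \<eta> (x - z) * f z"
    have "continuous_on UNIV ?G"
      unfolding bump_def by (intro continuous_intros assms)
    then have int: "?G integrable_on (cbox (- (\<eta> *\<^sub>R One) + x) (\<eta> *\<^sub>R One + x))"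
      by (intro integrable_continuous) (auto intro: continuous_on_subset)
    have "mollify \<eta> f x = integral (cbox (- (\<eta> *\<^sub>R One)) (\<eta> *\<^sub>R One)) (?G \<circ> (+) x)"
      by (simp add: mollify_def o_def bump_def)
    also have "\<dots> = integral (cbox (- (\<eta> *\<^sub>R One) + x) (\<eta> *\<^sub>R One + x)) ?G"
      by (rule integral_shift_cbox_plus)
    also have "\<dots> = F x0 x"
      unfolding F_def
      by (rule integral_unique[symmetric], rule has_integral_on_superset[OF integrable_integral[OF int] out sub])
    finally show ?thesis .
  qed
  have deriv: "(mollify \<eta> f has_derivative frechet_derivative (F x0) (at x)) (at x)" if "x \<in> ball x0 1" for x x0
  proof -
    have "(F x0 has_derivative frechet_derivative (F x0) (at x)) (at x)"
      using F[of x0] by (simp add: frechet_derivative_works[symmetric])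
    from has_derivative_transform_within_open[OF this open_ball that]
    show ?thesis using eq by simp
  qed
  have pd_eq: "pd k (mollify \<eta> f) x = pd k (F x0) x" if "x \<in> ball x0 1" for x x0 k
    using pd_eqI[OF deriv[OF that]] by (simp add: pd_def)
  have "continuous_on UNIV (pd k (mollify \<eta> f))" for k
    unfolding continuous_on_eq_continuous_at[OF open_UNIV]
  proof
    fix x0 :: "real ^ 'd"
    have "isCont (pd k (F x0)) x0"
      using F[of x0] by (simp add: continuous_on_eq_continuous_at)
    moreover have "\<forall>\<^sub>F x in nhds x0. pd k (F x0) x = pd k (mollify \<eta> f) x"
      using pd_eq by (auto simp: eventually_nhds intro!: exI[of _ "ball x0 1"])
    ultimately show "isCont (pd k (mollify \<eta> f)) x0"
      using isCont_cong by blast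
  qed
  moreover have "mollify \<eta> f differentiable (at x)" for x
    using deriv[of x x] by (auto simp: differentiable_def)
  ultimately show ?thesis by simp
qed

lemma Ck_Suc_mollify: "\<eta> > 0 \<Longrightarrow> Ck n f \<Longrightarrow> Ck (Suc n) (mollify \<eta> f)"
proof (induction n arbitrary: f)
  case 0 then show ?case using mollify_continuous_Ck1 by simp
next
  case (Suc n)
  have "pd k (mollify \<eta> f) = mollify \<eta> (pd k f)" for k by (rule pd_mollify[OF Suc.prems(2)])
  moreover have "Ck (Suc n) (mollify \<eta> (pd k f))" for k using Suc by simp
  moreover have "mollify \<eta> f differentiable (at x)" for x using Ck_mollify[OF Suc.prems(2)] by simp
  ultimately show ?case by (simp del: Ck.simps add: Ck.simps(2)[of "Suc n"])
qed

lemma bump_integral_pos: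
  assumes "\<eta> > 0"
  shows "integral (cbox (- (\<eta> *\<^sub>R One)) (\<eta> *\<^sub>R One)) (bump \<eta> :: real ^ 'd::finite \<Rightarrow> real) > 0"
proof -
  let ?b = "bump \<eta> :: real ^ 'd \<Rightarrow> real" and ?C = "cbox (- (\<eta> *\<^sub>R One)) (\<eta> *\<^sub>R One) :: (real ^ 'd) set"
  have "integral ?C ?b \<ge> 0" by (intro integral_nonneg integrable_continuous continuous_bump bump_nonneg)
  moreover have "integral ?C ?b \<noteq> 0"
  proof
    assume "integral ?C ?b = 0"
    then have "\<forall>x\<in>?C. ?b x = 0"
    proof (subst (asm) integral_cbox_eq_0_iff)
      show "box (- (\<eta> *\<^sub>R One)) (\<eta> *\<^sub>R One :: real ^ 'd) \<noteq> {}"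
        using assms by (auto simp: box_ne_empty)
    qed (auto intro: continuous_bump bump_nonneg)
    moreover have "0 \<in> ?C" using assms by (auto simp: mem_box)
    ultimately show False using assms by (auto simp: bump_def)
  qed
  ultimately show ?thesis by simp
qed

text \<open>Mollification commutes with derivatives, so it converges in $C^n$ as soon as it converges uniformly for
each derivative.\<close>
lemma CT_Suc_dense:
  fixes f :: "real ^ 'd::finite \<Rightarrow> real"
  assumes f: "f \<in> CT n" and "e > 0"
  shows "\<exists>g\<in>CT (Suc n). \<forall>ks x. length ks \<le> n \<longrightarrow> \<bar>foldr pd ks (\<lambda>x. f x - g x) x\<bar> \<le> e"
proof -
  have "\<exists>\<delta>>0. \<forall>y. dist y 0 < \<delta> \<longrightarrow> (\<forall>x. \<bar>foldr pd ks f (x + y) - foldr pd ks f (x + 0)\<bar> < e)"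
    if ks: "length ks \<le> n" for ks
  proof (rule periodic_family_uniform)
    have inCT: "foldr pd ks f \<in> CT (n - length ks)" by (rule CT_foldr_pd[OF f ks])
    show "continuous_on UNIV (\<lambda>(y, x). foldr pd ks f (x + y))"
      by (rule Ck_family_continuous[OF Ck_translate_family[OF CT_D(1)[OF inCT]]])
    show "foldr pd ks f (x + k + y) = foldr pd ks f (x + y)" if "k \<in> lattice" for y x k
      using CT_D(2)[OF inCT that, of "x + y"] by (simp add: add_ac)
  qed fact
  then obtain \<delta> where \<delta>: "\<And>ks. length ks \<le> n \<Longrightarrow> \<delta> ks > 0"
    "\<And>ks y x. length ks \<le> n \<Longrightarrow> dist y 0 < \<delta> ks \<Longrightarrow> \<bar>foldr pd ks f (x + y) - foldr pd ks f x\<bar> < e"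
    by (metis add_0_right)
  define \<eta> where "\<eta> = Min (\<delta> ` {ks. length ks \<le> n})"
  have fin: "finite {ks :: 'd list. length ks \<le> n}"
    using finite_lists_length_le[of "UNIV :: 'd set" n] by simp
  have \<eta>: "\<eta> > 0" "\<And>ks. length ks \<le> n \<Longrightarrow> \<eta> \<le> \<delta> ks"
  proof -
    have "{ks :: 'd list. length ks \<le> n} \<noteq> {}" by (auto intro: exI[of _ "[]"])
    then show "\<eta> > 0" using fin \<delta>(1) by (auto simp: \<eta>_def Min_gr_iff)
    show "\<eta> \<le> \<delta> ks" if "length ks \<le> n" for ks
      using fin that by (auto simp: \<eta>_def)
  qed
  define C where "C = (cbox (- (\<eta> *\<^sub>R One)) (\<eta> *\<^sub>R One) :: (real ^ 'd) set)"
  define m where "m = integral C (bump \<eta>)"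
  have m: "m > 0" unfolding m_def C_def by (rule bump_integral_pos[OF \<eta>(1)])
  define g where "g = (\<lambda>x. (1 / m) * mollify \<eta> f x)"
  have "g \<in> CT (Suc n)"
  proof -
    have "mollify \<eta> f (x + k) = mollify \<eta> f x" if "k \<in> lattice" for x k
    proof -
      have "f (x + k + y) = f (x + y)" for y using CT_D(2)[OF f that, of "x + y"] by (simp add: add_ac)
      then show ?thesis by (simp add: mollify_def)
    qed
    moreover have "Ck (Suc n) g"
      unfolding g_def by (rule Ck_cmult[OF Ck_Suc_mollify[OF \<eta>(1) CT_D(1)[OF f]]])
    ultimately show ?thesis unfolding CT_def by (simp add: g_def del: Ck.simps)
  qed
  moreover have "\<bar>foldr pd ks (\<lambda>x. f x - g x) x\<bar> \<le> e" if ks: "length ks \<le> n" for ks x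
  proof -
    let ?F = "foldr pd ks f"
    have "foldr pd ks (\<lambda>x. f x - g x) = foldr pd ks (\<lambda>x. 1 * f x + (- 1 / m) * mollify \<eta> f x)"
      by (simp add: g_def)
    also have "\<dots> = (\<lambda>x. 1 * ?F x + (- 1 / m) * mollify \<eta> ?F x)"
      by (simp only: foldr_pd_linear[OF CT_D(1)[OF f] Ck_mollify[OF CT_D(1)[OF f]] ks]
        foldr_pd_mollify[OF CT_D(1)[OF f] ks])
    finally have eq: "foldr pd ks (\<lambda>x. f x - g x) x = ?F x - mollify \<eta> ?F x / m" by simp
    have contF: "continuous_on UNIV ?F"
      by (rule Ck_imp_continuous[OF CT_D(1)[OF CT_foldr_pd[OF f ks]]])
    have i1: "(\<lambda>y. bump \<eta> y * ?F (x + y)) integrable_on C" unfolding C_def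
      by (intro integrable_continuous continuous_intros continuous_bump continuous_on_compose2[OF contF]) auto
    have i2: "(\<lambda>y. bump \<eta> y * ?F x) integrable_on C" unfolding C_def
      by (intro integrable_continuous continuous_intros continuous_bump)
    have i3: "(\<lambda>y. bump \<eta> y * e) integrable_on C" unfolding C_def
      by (intro integrable_continuous continuous_intros continuous_bump)
    have "mollify \<eta> ?F x - m * ?F x = integral C (\<lambda>y. bump \<eta> y * ?F (x + y) - bump \<eta> y * ?F x)"
      using integral_diff[OF i1 i2] by (simp add: mollify_def m_def C_def[symmetric])
    also have "\<bar>\<dots>\<bar> \<le> integral C (\<lambda>y. bump \<eta> y * e)"
    proof (subst real_norm_def[symmetric], rule integral_norm_bound_integral)
      fix y assume "y \<in> C"
      show "norm (bump \<eta> y * ?F (x + y) - bump \<eta> y * ?F x) \<le> bump \<eta> y * e"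
      proof (cases "norm y < \<eta>")
        case True
        then have "\<bar>?F (x + y) - ?F x\<bar> \<le> e" using \<delta>(2)[OF ks, of y x] \<eta>(2)[OF ks] by simp
        then have "bump \<eta> y * \<bar>?F (x + y) - ?F x\<bar> \<le> bump \<eta> y * e"
          by (intro mult_left_mono bump_nonneg)
        then show ?thesis by (simp add: abs_mult bump_nonneg right_diff_distrib[symmetric] abs_of_nonneg)
      next
        case False
        then show ?thesis using bump_eq_0[of \<eta> y] \<eta>(1) by simp
      qed
    qed (use integrable_diff[OF i1 i2] i3 in auto)
    also have "\<dots> = m * e" by (simp add: m_def)
    finally have "\<bar>mollify \<eta> ?F x - m * ?F x\<bar> \<le> m * e" .
    moreover have "?F x - mollify \<eta> ?F x / m = - (mollify \<eta> ?F x - m * ?F x) / m"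
      using m by (simp add: field_simps)
    ultimately show ?thesis unfolding eq using m by (simp add: abs_mult divide_le_eq mult.commute abs_minus_commute)
  qed
  ultimately show ?thesis by blast
qed

text \<open>Distributional derivatives, hence also derivatives in the parameter, are only accessible by testing against
$C^{n+1}$; by density this loses nothing.\<close>
lemma dual_eqI:
  fixes g h :: "'d::finite distr"
  assumes "g \<in> dual n" "h \<in> dual n" "\<And>\<phi>. \<phi> \<in> CT (Suc n) \<Longrightarrow> g \<phi> = h \<phi>"
  shows "g = h"
proof
  fix f
  show "g f = h f"
  proof (cases "f \<in> CT n")
    case f: True
    obtain C where C: "C \<ge> 0" "\<And>f e. f \<in> CT n \<Longrightarrow>
        (\<And>ks x. length ks \<le> n \<Longrightarrow> \<bar>foldr pd ks f x\<bar> \<le> e) \<Longrightarrow> \<bar>g f\<bar> \<le> C * e"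
      using dual_le[OF assms(1)] by metis
    obtain C' where C': "C' \<ge> 0" "\<And>f e. f \<in> CT n \<Longrightarrow>
        (\<And>ks x. length ks \<le> n \<Longrightarrow> \<bar>foldr pd ks f x\<bar> \<le> e) \<Longrightarrow> \<bar>h f\<bar> \<le> C' * e"
      using dual_le[OF assms(2)] by metis
    have "\<bar>g f - h f\<bar> \<le> (C + C') * e" if "e > 0" for e
    proof -
      obtain \<psi> where \<psi>: "\<psi> \<in> CT (Suc n)" "\<And>ks x. length ks \<le> n \<Longrightarrow> \<bar>foldr pd ks (\<lambda>x. f x - \<psi> x) x\<bar> \<le> e"
        using CT_Suc_dense[OF f \<open>e > 0\<close>] by blast
      have \<psi>n: "\<psi> \<in> CT n" by (rule CT_le[OF \<psi>(1)]) simp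
      have d: "(\<lambda>x. f x - \<psi> x) \<in> CT n" by (rule CT_diff[OF f \<psi>n])
      have "\<bar>g f - g \<psi>\<bar> \<le> C * e" using C(2)[OF d \<psi>(2)] dual_diff[OF assms(1) f \<psi>n] by simp
      moreover have "\<bar>h f - h \<psi>\<bar> \<le> C' * e" using C'(2)[OF d \<psi>(2)] dual_diff[OF assms(2) f \<psi>n] by simp
      moreover have "g \<psi> = h \<psi>" by (rule assms(3)[OF \<psi>(1)])
      ultimately show ?thesis by (simp add: algebra_simps)
    qed
    note key = this
    have "\<bar>g f - h f\<bar> \<le> 0 + e" if "e > 0" for e
    proof -
      have "\<bar>g f - h f\<bar> \<le> (C + C') * (e / (C + C' + 1))" using C C' that by (intro key) auto
      also have "\<dots> \<le> e" using C C' that by (simp add: field_simps)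
      finally show ?thesis by simp
    qed
    then have "\<bar>g f - h f\<bar> \<le> 0" by (rule field_le_epsilon)
    then show ?thesis by simp
  next
    case False
    then show ?thesis using assms(1,2) by (auto simp: dual_def)
  qed
qed

section \<open>Norms and convergence of distributions\<close>

lemma dscale_apply [simp]: "dscale c h \<phi> = c * h \<phi>"
  by (simp add: dscale_def)

lemma minus_distr_apply [simp]: "(g - h) \<phi> = g \<phi> - h \<phi>" for g h :: "'d::finite distr"
  by (simp add: fun_diff_def)

lemma uminus_distr_apply [simp]: "(- h) \<phi> = - h \<phi>" for h :: "'d::finite distr"
  by (simp add: fun_Compl_def)

lemma sum_distr_apply: "(\<Sum>i\<in>A. f i) \<phi> = (\<Sum>i\<in>A. f i \<phi>)" for f :: "'i \<Rightarrow> 'd::finite distr"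
  by (induction A rule: infinite_finite_induct) auto

lemma dscale_add: "dscale c (g + h) = dscale c g + dscale c h"
  by (auto simp: fun_eq_iff algebra_simps)
lemma dscale_diff: "dscale c (g - h) = dscale c g - dscale c h"
  by (auto simp: fun_eq_iff algebra_simps)
lemma dscale_dscale [simp]: "dscale c (dscale d h) = dscale (c * d) h"
  by (auto simp: fun_eq_iff)
lemma dscale_1 [simp]: "dscale 1 h = h"
  by (auto simp: fun_eq_iff)
lemma dscale_minus1: "dscale (- 1) h = - h"
  by (auto simp: fun_eq_iff)
lemma dscale_0 [simp]: "dscale c 0 = 0"
  by (auto simp: fun_eq_iff)

lemma transfer_op_add: "transfer_op n S (g + h) = transfer_op n S g + transfer_op n S h"
  by (auto simp: fun_eq_iff transfer_op_def)
lemma transfer_op_diff: "transfer_op n S (g - h) = transfer_op n S g - transfer_op n S h"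
  by (auto simp: fun_eq_iff transfer_op_def)
lemma transfer_op_dscale: "transfer_op n S (dscale c h) = dscale c (transfer_op n S h)"
  by (auto simp: fun_eq_iff transfer_op_def)
lemma mult_diff: "mult n a (g - h) = mult n a g - mult n a h"
  by (auto simp: fun_eq_iff mult_def)

context mean_field_setting
begin

definition drift :: "real \<Rightarrow> real ^ 'd \<Rightarrow> real ^ 'd"
  where "drift u = (\<lambda>x. T x + u *\<^sub>R \<beta> x)"

abbreviation L :: "real \<Rightarrow> 'd distr \<Rightarrow> 'd distr"
  where "L u \<equiv> transfer_op r (drift u)"

abbreviation b :: "'d \<Rightarrow> 'd distr \<Rightarrow> 'd distr"
  where "b k \<equiv> mult r (\<lambda>x. \<beta> x $ k)"

text \<open>The values of \<open>\<nu> * h \<alpha>\<close>, for which \<open>drift u\<close> belongs to \<open>TT\<close>. Nothing is known about the transfer operators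
of other \<open>drift u\<close>, which is why limits are taken within \<open>I\<close>.\<close>
definition I :: "real set"
  where "I = {\<nu> * h \<alpha> | \<nu> h. \<nu> \<in> {0..\<nu>s} \<and> h \<in> prob_distr r}"

abbreviation conv :: "nat \<Rightarrow> ('x \<Rightarrow> 'd distr) \<Rightarrow> 'd distr \<Rightarrow> 'x filter \<Rightarrow> bool"
  where "conv i f g F \<equiv> ((\<lambda>x. N i (f x - g)) \<longlongrightarrow> 0) F"

lemma coupled_eq_drift: "coupled T \<alpha> \<beta> \<nu> h = drift (\<nu> * h \<alpha>)"
  by (simp add: coupled_def drift_def)

lemma drift_in_TT: "u \<in> I \<Longrightarrow> drift u \<in> TT"
  unfolding I_def using coupled_in_TT by (auto simp: coupled_eq_drift)

lemma drift_torus_maps: "drift u \<in> torus_maps r"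
  unfolding drift_def by (rule torus_maps_drift[OF T_smooth \<beta>_smooth])

lemma B_zero: "i \<le> 3 \<Longrightarrow> 0 \<in> B i"
  and B_add: "i \<le> 3 \<Longrightarrow> g \<in> B i \<Longrightarrow> h \<in> B i \<Longrightarrow> g + h \<in> B i"
  and B_scale: "i \<le> 3 \<Longrightarrow> h \<in> B i \<Longrightarrow> dscale c h \<in> B i"
  and N_nonneg: "i \<le> 3 \<Longrightarrow> h \<in> B i \<Longrightarrow> 0 \<le> N i h"
  and N_eq_0: "i \<le> 3 \<Longrightarrow> h \<in> B i \<Longrightarrow> N i h = 0 \<longleftrightarrow> h = 0"
  and N_triangle: "i \<le> 3 \<Longrightarrow> g \<in> B i \<Longrightarrow> h \<in> B i \<Longrightarrow> N i (g + h) \<le> N i g + N i h"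
  and N_scale: "i \<le> 3 \<Longrightarrow> h \<in> B i \<Longrightarrow> N i (dscale c h) = \<bar>c\<bar> * N i h"
  and B_mcomplete: "i \<le> 3 \<Longrightarrow> Metric_space.mcomplete (B i) (ndist (B i) (N i))"
  using banach[of i] by (simp_all add: banach_sp_def)

lemma B_minus: "i \<le> 3 \<Longrightarrow> h \<in> B i \<Longrightarrow> - h \<in> B i"
  using B_scale[of i h "-1"] by (simp add: dscale_minus1)

lemma B_diff: "i \<le> 3 \<Longrightarrow> g \<in> B i \<Longrightarrow> h \<in> B i \<Longrightarrow> g - h \<in> B i"
  using B_add[OF _ _ B_minus, of i g h] by simp

lemma B_sum: "i \<le> 3 \<Longrightarrow> (\<And>k. k \<in> A \<Longrightarrow> f k \<in> B i) \<Longrightarrow> (\<Sum>k\<in>A. f k) \<in> B i"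
  by (induction A rule: infinite_finite_induct) (auto intro: B_zero B_add)

lemma N_0: "i \<le> 3 \<Longrightarrow> N i 0 = 0"
  using N_eq_0 B_zero by blast

lemma N_minus: "i \<le> 3 \<Longrightarrow> h \<in> B i \<Longrightarrow> N i (- h) = N i h"
  using N_scale[of i h "-1"] by (simp add: dscale_minus1)

lemma N_commute: "i \<le> 3 \<Longrightarrow> g \<in> B i \<Longrightarrow> h \<in> B i \<Longrightarrow> N i (g - h) = N i (h - g)"
  using N_minus[of i "g - h"] B_diff by simp

lemma N_diff_triangle: "i \<le> 3 \<Longrightarrow> f \<in> B i \<Longrightarrow> g \<in> B i \<Longrightarrow> h \<in> B i \<Longrightarrow> N i (f - h) \<le> N i (f - g) + N i (g - h)"
  using N_triangle[of i "f - g" "g - h"] B_diff by simp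

lemma N_le_add_diff: "i \<le> 3 \<Longrightarrow> g \<in> B i \<Longrightarrow> h \<in> B i \<Longrightarrow> N i g \<le> N i (g - h) + N i h"
  using N_triangle[of i "g - h" h] B_diff by simp

lemma N_diff_le: "i \<le> 3 \<Longrightarrow> g \<in> B i \<Longrightarrow> h \<in> B i \<Longrightarrow> N i (g - h) \<le> N i g + N i h"
  using N_triangle[of i g "- h"] B_minus N_minus by simp

lemma N_sum: "i \<le> 3 \<Longrightarrow> (\<And>k. k \<in> A \<Longrightarrow> f k \<in> B i) \<Longrightarrow> N i (\<Sum>k\<in>A. f k) \<le> (\<Sum>k\<in>A. N i (f k))"
proof (induction A rule: infinite_finite_induct)
  case (insert x F)
  have IH: "N i (\<Sum>k\<in>F. f k) \<le> (\<Sum>k\<in>F. N i (f k))"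
    by (rule insert.IH) (use insert.prems in auto)
  have "N i (f x + (\<Sum>k\<in>F. f k)) \<le> N i (f x) + N i (\<Sum>k\<in>F. f k)"
    by (intro N_triangle B_sum) (use insert.prems in auto)
  with IH show "N i (\<Sum>k\<in>insert x F. f k) \<le> (\<Sum>k\<in>insert x F. N i (f k))"
    unfolding sum.insert[OF insert.hyps] by linarith
qed (auto simp: N_0)

lemma B_le: "i \<le> j \<Longrightarrow> j \<le> 3 \<Longrightarrow> h \<in> B j \<Longrightarrow> h \<in> B i"
proof (induction j)
  case (Suc j)
  show ?case
  proof (cases "i = Suc j")
    case False
    then show ?thesis using Suc B_mono[of j] by auto
  qed (use Suc in auto)
qed auto

lemma N_le: "i \<le> j \<Longrightarrow> j \<le> 3 \<Longrightarrow> h \<in> B j \<Longrightarrow> N i h \<le> N j h"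
proof (induction j)
  case (Suc j)
  show ?case
  proof (cases "i = Suc j")
    case False
    then have "N i h \<le> N j h" using Suc B_mono[of j] by auto
    also have "N j h \<le> N (Suc j) h" using Suc by (intro N_mono) auto
    finally show ?thesis .
  qed (use Suc in auto)
qed auto

lemma B_dual: "i \<le> 3 \<Longrightarrow> h \<in> B i \<Longrightarrow> h \<in> dual r"
  using B_le[of 0 i h] B0_dual by auto

lemma eval_bound:
  assumes "\<phi> \<in> CT r"
  shows "\<exists>C\<ge>0. \<forall>i\<le>3. \<forall>h\<in>B i. \<bar>h \<phi>\<bar> \<le> C * N i h"
proof -
  obtain C where C: "\<And>h \<phi>. h \<in> B 0 \<Longrightarrow> \<phi> \<in> CT r \<Longrightarrow> \<bar>h \<phi>\<bar> \<le> C * N 0 h * CT_norm r \<phi>"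
    using B0_dual_cont by blast
  define D where "D = \<bar>C * CT_norm r \<phi>\<bar>"
  have "\<bar>h \<phi>\<bar> \<le> D * N i h" if "i \<le> 3" "h \<in> B i" for i h
  proof -
    have h0: "h \<in> B 0" using B_le[of 0 i h] that by simp
    have "\<bar>h \<phi>\<bar> \<le> (C * CT_norm r \<phi>) * N 0 h" using C[OF h0 assms] by (simp add: mult_ac)
    also have "\<dots> \<le> D * N 0 h" unfolding D_def using N_nonneg[OF _ h0] by (intro mult_right_mono) auto
    also have "\<dots> \<le> D * N i h" unfolding D_def using N_le[of 0 i h] that by (intro mult_left_mono) auto
    finally show ?thesis .
  qed
  then show ?thesis by (intro exI[of _ D]) (auto simp: D_def)
qed

lemma conv_eval:
  assumes "conv i f g F" "i \<le> 3" "\<forall>\<^sub>F x in F. f x \<in> B i" "g \<in> B i" "\<phi> \<in> CT r"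
  shows "((\<lambda>x. f x \<phi>) \<longlongrightarrow> g \<phi>) F"
proof -
  obtain C where C: "\<And>h. h \<in> B i \<Longrightarrow> \<bar>h \<phi>\<bar> \<le> C * N i h"
    using eval_bound[OF assms(5)] assms(2) by blast
  have "((\<lambda>x. f x \<phi> - g \<phi>) \<longlongrightarrow> 0) F"
  proof (rule Lim_null_comparison)
    show "\<forall>\<^sub>F x in F. norm (f x \<phi> - g \<phi>) \<le> C * N i (f x - g)"
      using assms(3) by eventually_elim (use C[OF B_diff[OF assms(2) _ assms(4)]] in auto)
    show "((\<lambda>x. C * N i (f x - g)) \<longlongrightarrow> 0) F" using assms(1) by (rule tendsto_mult_right_zero)
  qed
  then show ?thesis by (simp add: LIM_zero_iff)
qed

lemma conv_bound:
  assumes "i \<le> 3" "\<forall>\<^sub>F x in F. N i (f x - g) \<le> e x" "\<forall>\<^sub>F x in F. f x \<in> B i" "g \<in> B i" "(e \<longlongrightarrow> 0) F"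
  shows "conv i f g F"
proof (rule Lim_null_comparison[OF _ assms(5)])
  show "\<forall>\<^sub>F x in F. norm (N i (f x - g)) \<le> e x"
    using assms(2,3) by eventually_elim (use N_nonneg[OF assms(1) B_diff[OF assms(1) _ assms(4)]] in auto)
qed

lemma conv_add:
  assumes "i \<le> 3" "conv i f g F" "conv i f' g' F"
    "\<forall>\<^sub>F x in F. f x \<in> B i" "g \<in> B i" "\<forall>\<^sub>F x in F. f' x \<in> B i" "g' \<in> B i"
  shows "conv i (\<lambda>x. f x + f' x) (g + g') F"
proof (rule conv_bound[OF assms(1)])
  show "\<forall>\<^sub>F x in F. N i (f x + f' x - (g + g')) \<le> N i (f x - g) + N i (f' x - g')"
    using assms(4,6)
  proof eventually_elim
    case (elim x)
    have eq: "f x + f' x - (g + g') = (f x - g) + (f' x - g')" by simp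
    show ?case unfolding eq by (intro N_triangle B_diff assms(1) elim assms(5,7))
  qed
  show "\<forall>\<^sub>F x in F. f x + f' x \<in> B i" using assms(4,6) by eventually_elim (rule B_add[OF assms(1)])
  show "((\<lambda>x. N i (f x - g) + N i (f' x - g')) \<longlongrightarrow> 0) F"
    using tendsto_add[OF assms(2,3)] by simp
qed (use assms in \<open>auto intro: B_add\<close>)

lemma conv_scale:
  assumes "i \<le> 3" "conv i f g F" "\<forall>\<^sub>F x in F. f x \<in> B i" "g \<in> B i"
  shows "conv i (\<lambda>x. dscale c (f x)) (dscale c g) F"
proof (rule conv_bound[OF assms(1)])
  show "\<forall>\<^sub>F x in F. N i (dscale c (f x) - dscale c g) \<le> \<bar>c\<bar> * N i (f x - g)"
    using assms(3)
    by eventually_elim (use N_scale[OF assms(1) B_diff[OF assms(1) _ assms(4)]] in \<open>auto simp: dscale_diff[symmetric]\<close>)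
  show "\<forall>\<^sub>F x in F. dscale c (f x) \<in> B i" using assms(3) by eventually_elim (rule B_scale[OF assms(1)])
  show "((\<lambda>x. \<bar>c\<bar> * N i (f x - g)) \<longlongrightarrow> 0) F" using assms(2) by (rule tendsto_mult_right_zero)
qed (use assms in \<open>auto intro: B_scale\<close>)

lemma conv_minus:
  assumes "i \<le> 3" "conv i f g F" "\<forall>\<^sub>F x in F. f x \<in> B i" "g \<in> B i"
  shows "conv i (\<lambda>x. - f x) (- g) F"
  using conv_scale[OF assms, of "-1"] by (simp add: dscale_minus1)

lemma conv_sum:
  assumes "i \<le> 3" "\<And>k. k \<in> A \<Longrightarrow> conv i (f k) (g k) F"
    "\<And>k. k \<in> A \<Longrightarrow> \<forall>\<^sub>F x in F. f k x \<in> B i" "\<And>k. k \<in> A \<Longrightarrow> g k \<in> B i"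
  shows "conv i (\<lambda>x. \<Sum>k\<in>A. f k x) (\<Sum>k\<in>A. g k) F"
  using assms(2-)
proof (induction A rule: infinite_finite_induct)
  case (insert k A)
  have IH: "conv i (\<lambda>x. \<Sum>k\<in>A. f k x) (\<Sum>k\<in>A. g k) F"
    by (rule insert.IH) (use insert.prems in auto)
  have "\<forall>\<^sub>F x in F. \<forall>k\<in>A. f k x \<in> B i"
    by (rule eventually_ball_finite) (use insert in auto)
  then have "\<forall>\<^sub>F x in F. (\<Sum>k\<in>A. f k x) \<in> B i"
    by eventually_elim (rule B_sum[OF assms(1)], blast)
  then have "conv i (\<lambda>x. f k x + (\<Sum>k\<in>A. f k x)) (g k + (\<Sum>k\<in>A. g k)) F"
    by (intro conv_add[OF assms(1) insert.prems(1) IH] B_sum[OF assms(1)] insert.prems) auto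
  then show "conv i (\<lambda>x. \<Sum>k\<in>insert k A. f k x) (\<Sum>k\<in>insert k A. g k) F"
    unfolding sum.insert[OF insert.hyps] .
qed (auto simp: N_0[OF assms(1)])

lemma conv_le:
  assumes "i \<le> j" "j \<le> 3" "conv j f g F" "\<forall>\<^sub>F x in F. f x \<in> B j" "g \<in> B j"
  shows "conv i f g F"
proof (rule conv_bound[where e = "\<lambda>x. N j (f x - g)"])
  show "\<forall>\<^sub>F x in F. N i (f x - g) \<le> N j (f x - g)"
    using assms(4) by eventually_elim (use assms in \<open>auto intro!: N_le B_diff\<close>)
  show "\<forall>\<^sub>F x in F. f x \<in> B i" using assms(4) by eventually_elim (use assms in \<open>auto intro: B_le\<close>)
qed (use assms in \<open>auto intro: B_le\<close>)

lemma bdd_op_diff: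
  assumes "bdd_op (B i) (N i) (B j) (N j) A" "i \<le> 3" "g \<in> B i" "h \<in> B i"
  shows "A (g - h) = A g - A h"
proof -
  have "A (g + dscale (-1) h) = A g + A (dscale (-1) h)" "A (dscale (-1) h) = dscale (-1) (A h)"
    using assms B_scale[of i h "-1"] unfolding bdd_op_def by blast+
  then show ?thesis by (simp add: dscale_minus1)
qed

lemma bdd_op_bound:
  assumes "bdd_op (B i) (N i) (B j) (N j) A" "i \<le> 3"
  shows "\<exists>C\<ge>0. \<forall>h\<in>B i. N j (A h) \<le> C * N i h"
proof -
  obtain C where C: "\<And>h. h \<in> B i \<Longrightarrow> N j (A h) \<le> C * N i h"
    using assms unfolding bdd_op_def by blast
  have "N j (A h) \<le> \<bar>C\<bar> * N i h" if "h \<in> B i" for h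
  proof -
    have "C * N i h \<le> \<bar>C\<bar> * N i h" using N_nonneg[OF assms(2) that] by (intro mult_right_mono) auto
    then show ?thesis using C[OF that] by linarith
  qed
  then show ?thesis by (intro exI[of _ "\<bar>C\<bar>"]) auto
qed

lemma conv_op:
  assumes A: "bdd_op (B i) (N i) (B j) (N j) A" and "i \<le> 3" "j \<le> 3"
    "conv i f g F" "\<forall>\<^sub>F x in F. f x \<in> B i" "g \<in> B i"
  shows "conv j (\<lambda>x. A (f x)) (A g) F"
proof -
  obtain C where C: "C \<ge> 0" "\<And>h. h \<in> B i \<Longrightarrow> N j (A h) \<le> C * N i h"
    using bdd_op_bound[OF A \<open>i \<le> 3\<close>] by blast
  have in_B: "A h \<in> B j" if "h \<in> B i" for h using A that unfolding bdd_op_def by blast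
  show ?thesis
  proof (rule conv_bound[OF \<open>j \<le> 3\<close>])
    show "\<forall>\<^sub>F x in F. N j (A (f x) - A g) \<le> C * N i (f x - g)"
      using assms(5)
    proof eventually_elim
      case (elim x)
      show ?case
        unfolding bdd_op_diff[OF A \<open>i \<le> 3\<close> elim \<open>g \<in> B i\<close>, symmetric]
        by (rule C(2)[OF B_diff[OF \<open>i \<le> 3\<close> elim \<open>g \<in> B i\<close>]])
    qed
    show "\<forall>\<^sub>F x in F. A (f x) \<in> B j" using assms(5) by eventually_elim (rule in_B)
    show "((\<lambda>x. C * N i (f x - g)) \<longlongrightarrow> 0) F" using assms(4) by (rule tendsto_mult_right_zero)
  qed (use in_B \<open>g \<in> B i\<close> in auto)
qed

lemma Metric_space_B:
  assumes "i \<le> 3"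
  shows "Metric_space (B i) (ndist (B i) (N i))"
proof
  fix x y z
  show "0 \<le> ndist (B i) (N i) x y" by (auto simp: ndist_def assms intro!: N_nonneg B_diff)
  show "ndist (B i) (N i) x y = ndist (B i) (N i) y x"
    by (auto simp: ndist_def assms intro: N_commute)
  show "ndist (B i) (N i) x y = 0 \<longleftrightarrow> x = y" if "x \<in> B i" "y \<in> B i"
    using that N_eq_0[OF assms B_diff[OF assms that]] by (auto simp: ndist_def)
  show "ndist (B i) (N i) x z \<le> ndist (B i) (N i) x y + ndist (B i) (N i) y z"
    if "x \<in> B i" "y \<in> B i" "z \<in> B i"
    using that N_diff_triangle[OF assms that] by (auto simp: ndist_def)
qed

lemma limitin_B_imp_conv:
  assumes "i \<le> 3" "\<And>n. X n \<in> B i"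
    "limitin (Metric_space.mtopology (B i) (ndist (B i) (N i))) X l sequentially"
  shows "l \<in> B i" "conv i X l sequentially"
proof -
  interpret Metric_space "B i" "ndist (B i) (N i)" by (rule Metric_space_B[OF assms(1)])
  show l: "l \<in> B i" using assms(3) by (simp add: limit_metric_sequentially)
  show "conv i X l sequentially"
  proof (rule LIMSEQ_I)
    fix e :: real assume "e > 0"
    then obtain M where M: "\<And>n. n \<ge> M \<Longrightarrow> ndist (B i) (N i) (X n) l < e"
      using assms(3) unfolding limit_metric_sequentially by blast
    have "norm (N i (X n - l) - 0) < e" if "n \<ge> M" for n
      using M[OF that] assms(2)[of n] l N_nonneg[OF assms(1) B_diff[OF assms(1,2) l], of n]
      by (simp add: ndist_def)
    then show "\<exists>no. \<forall>n\<ge>no. norm (N i (X n - l) - 0) < e" by blast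
  qed
qed

lemma B_complete:
  assumes "i \<le> 3" "\<And>n. X n \<in> B i"
    and "\<And>e. e > 0 \<Longrightarrow> \<exists>M. \<forall>m\<ge>M. \<forall>n\<ge>M. N i (X m - X n) < e"
  obtains l where "l \<in> B i" "conv i X l sequentially"
proof -
  interpret Metric_space "B i" "ndist (B i) (N i)" by (rule Metric_space_B[OF assms(1)])
  have "MCauchy X"
    unfolding MCauchy_def using assms(2,3) by (auto simp: ndist_def)
  then obtain l where "limitin mtopology X l sequentially"
    using B_mcomplete[OF assms(1)] by (auto simp: mcomplete_def)
  from limitin_B_imp_conv[OF assms(1,2) this] show thesis using that by blast
qed

lemma ball_seq_compact:
  assumes "i \<le> 2" "\<And>n. X n \<in> B (Suc i)" "\<And>n. N (Suc i) (X n) \<le> M"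
  obtains l \<rho> where "l \<in> B i" "strict_mono (\<rho> :: nat \<Rightarrow> nat)" "conv i (X \<circ> \<rho>) l sequentially"
proof -
  have i3: "i \<le> 3" "Suc i \<le> 3" using assms(1) by auto
  interpret Metric_space "B i" "ndist (B i) (N i)" by (rule Metric_space_B[OF i3(1)])
  define c where "c = max M 1"
  have c: "c > 0" "M \<le> c" by (auto simp: c_def)
  define U where "U = {h \<in> B (Suc i). N (Suc i) h \<le> 1}"
  define Y where "Y n = dscale (1 / c) (X n)" for n
  have "Y n \<in> U" for n
  proof -
    have "N (Suc i) (Y n) = N (Suc i) (X n) / c"
      unfolding Y_def using N_scale[OF i3(2) assms(2)] c by simp
    also have "\<dots> \<le> 1" using assms(3)[of n] c by (simp add: divide_le_eq)
    finally show ?thesis using B_scale[OF i3(2) assms(2)] by (simp add: U_def Y_def)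
  qed
  moreover have UB: "U \<subseteq> B i" using B_mono[OF assms(1)] by (auto simp: U_def)
  ultimately have "range Y \<subseteq> mtopology closure_of U"
    using closure_of_subset[of U mtopology] by auto
  then obtain l \<rho> where l: "strict_mono (\<rho> :: nat \<Rightarrow> nat)" "limitin mtopology (Y \<circ> \<rho>) l sequentially"
    using A4[OF assms(1)] unfolding compactin_sequentially U_def by blast
  have XB: "X n \<in> B i" for n using assms(2) B_mono[OF assms(1)] by blast
  then have YB: "(Y \<circ> \<rho>) n \<in> B i" for n by (simp add: Y_def B_scale[OF i3(1)])
  have lB: "l \<in> B i" "conv i (Y \<circ> \<rho>) l sequentially"
    using limitin_B_imp_conv[OF i3(1) YB l(2)] by auto
  have "conv i (\<lambda>n. dscale c ((Y \<circ> \<rho>) n)) (dscale c l) sequentially"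
    using lB YB by (intro conv_scale[OF i3(1)]) auto
  then have "conv i (X \<circ> \<rho>) (dscale c l) sequentially"
    using c by (simp add: Y_def o_def)
  with that[of "dscale c l" \<rho>] l lB show thesis by (simp add: B_scale[OF i3(1)])
qed

section \<open>Weak convergence in relatively compact sets\<close>

text \<open>The closure in \<open>B i\<close> of the ball of radius \<open>M\<close> of \<open>B (Suc i)\<close>. Limits in \<open>B i\<close> of bounded
sequences of \<open>B (Suc i)\<close> need not belong to \<open>B (Suc i)\<close>, and even if they do, nothing is known about their norms
there; this closure keeps the information that survives.\<close>
definition ball_closure :: "nat \<Rightarrow> real \<Rightarrow> 'd distr \<Rightarrow> bool"
  where "ball_closure i M f \<longleftrightarrow> f \<in> B i \<and> (\<forall>\<epsilon>>0. \<exists>g\<in>B (Suc i). N (Suc i) g \<le> M \<and> N i (f - g) < \<epsilon>)"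

lemma ball_closure_D: "ball_closure i M f \<Longrightarrow> f \<in> B i"
  by (simp add: ball_closure_def)

lemma ball_closure_ball: "i \<le> 2 \<Longrightarrow> f \<in> B (Suc i) \<Longrightarrow> N (Suc i) f \<le> M \<Longrightarrow> ball_closure i M f"
  unfolding ball_closure_def using B_mono[of i] by (auto intro!: bexI[of _ f] simp: N_0)

lemma ball_closure_add:
  assumes "i \<le> 2" "ball_closure i M f" "ball_closure i M' f'"
  shows "ball_closure i (M + M') (f + f')"
  unfolding ball_closure_def
proof (intro conjI allI impI)
  have i3: "i \<le> 3" "Suc i \<le> 3" using assms(1) by auto
  show "f + f' \<in> B i" using assms by (intro B_add i3 ball_closure_D)
  fix \<epsilon> :: real assume "\<epsilon> > 0"
  then obtain g g' where g: "g \<in> B (Suc i)" "N (Suc i) g \<le> M" "N i (f - g) < \<epsilon> / 2"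
    "g' \<in> B (Suc i)" "N (Suc i) g' \<le> M'" "N i (f' - g') < \<epsilon> / 2"
    using assms unfolding ball_closure_def by (metis half_gt_zero)
  have gB: "g \<in> B i" "g' \<in> B i" using g B_mono[OF assms(1)] by auto
  have "N (Suc i) (g + g') \<le> M + M'" using N_triangle[OF i3(2) g(1) g(4)] g by linarith
  moreover have "N i (f + f' - (g + g')) < \<epsilon>"
  proof -
    have eq: "f + f' - (g + g') = (f - g) + (f' - g')" by simp
    have "N i (f + f' - (g + g')) \<le> N i (f - g) + N i (f' - g')"
      unfolding eq
      by (rule N_triangle[OF i3(1) B_diff[OF i3(1) ball_closure_D[OF assms(2)] gB(1)] B_diff[OF i3(1) ball_closure_D[OF assms(3)] gB(2)]])
    then show ?thesis using g by linarith
  qed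
  ultimately show "\<exists>g\<in>B (Suc i). N (Suc i) g \<le> M + M' \<and> N i (f + f' - g) < \<epsilon>"
    using B_add[OF i3(2) g(1) g(4)] by blast
qed

lemma ball_closure_closed:
  assumes "i \<le> 2" "\<And>n. ball_closure i M (X n)" "l \<in> B i" "conv i X l sequentially"
  shows "ball_closure i M l"
  unfolding ball_closure_def
proof (intro conjI allI impI)
  have i3: "i \<le> 3" using assms(1) by auto
  fix \<epsilon> :: real assume e: "\<epsilon> > 0"
  then have "\<forall>\<^sub>F n in sequentially. N i (X n - l) < \<epsilon> / 2"
    using assms(4) order_tendstoD(2)[of _ 0 sequentially "\<epsilon> / 2"] by auto
  then obtain n where n: "N i (X n - l) < \<epsilon> / 2" by (auto simp: eventually_sequentially)
  obtain g where g: "g \<in> B (Suc i)" "N (Suc i) g \<le> M" "N i (X n - g) < \<epsilon> / 2"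
    using assms(2)[of n] e unfolding ball_closure_def by (metis half_gt_zero)
  have "N i (l - g) \<le> N i (l - X n) + N i (X n - g)"
    using g assms(3) ball_closure_D[OF assms(2)] B_mono[OF assms(1)] by (intro N_diff_triangle[OF i3]) auto
  also have "\<dots> < \<epsilon>" using n g N_commute[OF i3 assms(3) ball_closure_D[OF assms(2)], of n] by linarith
  finally show "\<exists>g\<in>B (Suc i). N (Suc i) g \<le> M \<and> N i (l - g) < \<epsilon>" using g by blast
qed fact

lemma ball_closure_seq_compact:
  assumes "i \<le> 2" "\<And>n. ball_closure i M (X n)"
  obtains l \<rho> where "l \<in> B i" "strict_mono (\<rho> :: nat \<Rightarrow> nat)" "conv i (X \<circ> \<rho>) l sequentially"
proof -
  have i3: "i \<le> 3" "Suc i \<le> 3" using assms(1) by auto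
  have "\<forall>n. \<exists>g\<in>B (Suc i). N (Suc i) g \<le> M \<and> N i (X n - g) < 1 / real (Suc n)"
    using assms(2) unfolding ball_closure_def by simp
  then obtain g where g: "\<And>n. g n \<in> B (Suc i)" "\<And>n. N (Suc i) (g n) \<le> M"
    "\<And>n. N i (X n - g n) < 1 / real (Suc n)" by metis
  obtain l \<rho> where l: "l \<in> B i" "strict_mono (\<rho> :: nat \<Rightarrow> nat)" "conv i (g \<circ> \<rho>) l sequentially"
    by (rule ball_seq_compact[OF assms(1) g(1,2)])
  have gB: "g n \<in> B i" for n using g(1) B_mono[OF assms(1)] by blast
  have "conv i (X \<circ> \<rho>) l sequentially"
  proof (rule conv_bound[OF i3(1)])
    have "N i (X (\<rho> n) - l) \<le> 1 / real (Suc (\<rho> n)) + N i (g (\<rho> n) - l)" for n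
      using N_diff_triangle[OF i3(1) ball_closure_D[OF assms(2)] gB l(1), of "\<rho> n" "\<rho> n"] g(3)[of "\<rho> n"] by linarith
    then show "\<forall>\<^sub>F n in sequentially. N i ((X \<circ> \<rho>) n - l) \<le> 1 / real (Suc (\<rho> n)) + N i (g (\<rho> n) - l)"
      by auto
    have "(\<lambda>n. 1 / real (Suc (\<rho> n))) \<longlonglongrightarrow> 0"
      using LIMSEQ_subseq_LIMSEQ[OF LIMSEQ_Suc[OF lim_1_over_n] l(2)] by (simp add: o_def)
    then show "(\<lambda>n. 1 / real (Suc (\<rho> n)) + N i (g (\<rho> n) - l)) \<longlonglongrightarrow> 0"
      using tendsto_add[OF _ l(3)] by (simp add: o_def)
  qed (use l ball_closure_D[OF assms(2)] in auto)
  then show thesis by (rule that[OF l(1,2)])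
qed

text \<open>Every subsequence has a further subsequence that converges in \<open>B i\<close>, and its limit is
identified by test functions.\<close>
lemma ball_closure_weak_imp_conv_seq:
  assumes "i \<le> 2" "\<And>n. ball_closure i M (X n)" "f \<in> dual r"
    and weak: "\<And>\<phi>. \<phi> \<in> CT (Suc r) \<Longrightarrow> (\<lambda>n. X n \<phi>) \<longlonglongrightarrow> f \<phi>"
  shows "ball_closure i M f" "conv i X f sequentially"
proof -
  have i3: "i \<le> 3" using assms(1) by auto
  have sub: "f \<in> B i \<and> (\<exists>\<rho>'. strict_mono (\<rho>' :: nat \<Rightarrow> nat) \<and> conv i (X \<circ> \<rho> \<circ> \<rho>') f sequentially)"
    if \<rho>: "strict_mono (\<rho> :: nat \<Rightarrow> nat)" for \<rho>
  proof -
    have K: "ball_closure i M ((X \<circ> \<rho>) n)" for n using assms(2) by simp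
    obtain l \<rho>' where l: "l \<in> B i" "strict_mono (\<rho>' :: nat \<Rightarrow> nat)"
      "conv i (X \<circ> \<rho> \<circ> \<rho>') l sequentially" by (rule ball_closure_seq_compact[OF assms(1) K])
    have "l = f"
    proof (rule dual_eqI[OF B_dual[OF i3 l(1)] assms(3)])
      fix \<phi> :: "real ^ 'd \<Rightarrow> real" assume \<phi>: "\<phi> \<in> CT (Suc r)"
      have "(\<lambda>n. (X \<circ> \<rho> \<circ> \<rho>') n \<phi>) \<longlonglongrightarrow> l \<phi>"
        by (rule conv_eval[OF l(3) i3 _ l(1) CT_le[OF \<phi>]]) (simp_all add: ball_closure_D[OF assms(2)])
      moreover have "(\<lambda>n. (X \<circ> \<rho> \<circ> \<rho>') n \<phi>) \<longlonglongrightarrow> f \<phi>"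
        using LIMSEQ_subseq_LIMSEQ[OF weak[OF \<phi>] strict_mono_o[OF \<rho> l(2)]] by (simp add: o_def)
      ultimately show "l \<phi> = f \<phi>" by (rule LIMSEQ_unique)
    qed
    then show ?thesis using l(1) l(2) l(3) by (intro conjI exI[of _ \<rho>']) simp_all
  qed
  have fB: "f \<in> B i" using sub[of id] by (simp add: strict_mono_id)
  show c: "conv i X f sequentially"
  proof (rule ccontr)
    assume "\<not> conv i X f sequentially"
    then obtain e where e: "e > 0" "\<And>m. \<exists>n\<ge>m. \<not> norm (N i (X n - f) - 0) < e"
      unfolding LIMSEQ_iff by blast
    define P where "P n \<longleftrightarrow> \<not> norm (N i (X n - f) - 0) < e" for n
    have "infinite {n. P n}" using e(2) by (auto simp: infinite_nat_iff_unbounded_le P_def)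
    then obtain \<rho> :: "nat \<Rightarrow> nat" where \<rho>: "strict_mono \<rho>" "\<And>n. P (\<rho> n)"
      using infinite_enumerate by blast
    obtain \<rho>' where \<rho>': "conv i (X \<circ> \<rho> \<circ> \<rho>') f sequentially" using sub[OF \<rho>(1)] by blast
    then obtain n where "norm (N i ((X \<circ> \<rho> \<circ> \<rho>') n - f) - 0) < e"
      using e(1) unfolding LIMSEQ_iff by blast
    then show False using \<rho>(2)[of "\<rho>' n"] by (simp add: P_def)
  qed
  show "ball_closure i M f" by (rule ball_closure_closed[OF assms(1,2) fB c])
qed

lemma ball_closure_weak_imp_conv:
  fixes f :: "real \<Rightarrow> 'd distr"
  assumes "i \<le> 2" "\<And>u. u \<in> S - {s} \<Longrightarrow> ball_closure i M (f u)" "g \<in> dual r"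
    and weak: "\<And>\<phi>. \<phi> \<in> CT (Suc r) \<Longrightarrow> ((\<lambda>u. f u \<phi>) \<longlongrightarrow> g \<phi>) (at s within S)"
  shows "conv i f g (at s within S)"
  unfolding tendsto_at_iff_sequentially
proof (intro allI impI)
  fix X assume X: "\<forall>n. X n \<in> S - {s}" "X \<longlonglongrightarrow> s"
  have "conv i (f \<circ> X) g sequentially"
  proof (rule ball_closure_weak_imp_conv_seq(2)[OF assms(1) _ assms(3)])
    show "ball_closure i M ((f \<circ> X) n)" for n using X assms(2) by simp
    show "(\<lambda>n. (f \<circ> X) n \<phi>) \<longlonglongrightarrow> g \<phi>" if "\<phi> \<in> CT (Suc r)" for \<phi>
      using weak[OF that] X unfolding tendsto_at_iff_sequentially by (auto simp: o_def)
  qed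
  then show "((\<lambda>x. N i (f x - g)) \<circ> X) \<longlonglongrightarrow> 0" by (simp add: o_def)
qed

lemma eventually_within_I: "(\<And>u. u \<in> S \<Longrightarrow> u \<noteq> s \<Longrightarrow> P u) \<Longrightarrow> \<forall>\<^sub>F u in at s within S. P u"
  by (auto simp: eventually_at_filter)

text \<open>A replacement for the estimate of a vector valued integral: \<open>E\<close> is weakly the integral of \<open>y\<close>
over the unit interval, hence the weak limit of Riemann sums, which lie in the ball.\<close>
lemma ball_closure_mean_value:
  assumes "i \<le> 2" and y: "\<And>t. t \<in> {0..1} \<Longrightarrow> y t \<in> B (Suc i)" "\<And>t. t \<in> {0..1} \<Longrightarrow> N (Suc i) (y t) \<le> M"
    and E: "E \<in> dual r"
    and weak: "\<And>\<phi>. \<phi> \<in> CT (Suc r) \<Longrightarrow> continuous_on {0..1} (\<lambda>t. y t \<phi>) \<and>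
      (\<exists>g. (\<forall>t\<in>{0..1}. (g has_real_derivative y t \<phi>) (at t within {0..1})) \<and> E \<phi> = g 1 - g 0)"
  shows "ball_closure i M E"
proof (rule ball_closure_weak_imp_conv_seq(1)[OF assms(1) _ E])
  have i3: "Suc i \<le> 3" using assms(1) by auto
  define R where "R n = dscale (1 / real (Suc n)) (\<Sum>k<Suc n. y (real k / real (Suc n)))" for n
  have pt: "real k / real (Suc n) \<in> {0..1}" if "k \<le> Suc n" for k n
    using that by (auto simp: divide_le_eq)
  show "ball_closure i M (R n)" for n
  proof (rule ball_closure_ball[OF assms(1)])
    have s: "(\<Sum>k<Suc n. y (real k / real (Suc n))) \<in> B (Suc i)"
      using y(1)[OF pt[of _ n]] by (intro B_sum[OF i3]) auto
    show "R n \<in> B (Suc i)" unfolding R_def by (rule B_scale[OF i3 s])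
    have "N (Suc i) (\<Sum>k<Suc n. y (real k / real (Suc n))) \<le> (\<Sum>k<Suc n. N (Suc i) (y (real k / real (Suc n))))"
      using y(1)[OF pt[of _ n]] by (intro N_sum[OF i3]) auto
    also have "\<dots> \<le> (\<Sum>k<Suc n. M)"
      by (rule sum_mono) (use y(2)[OF pt[of _ n]] in auto)
    also have "\<dots> = real (Suc n) * M" by simp
    finally show "N (Suc i) (R n) \<le> M" unfolding R_def N_scale[OF i3 s]
      by (simp add: divide_le_eq mult.commute)
  qed
  fix \<phi> :: "real ^ 'd \<Rightarrow> real" assume \<phi>: "\<phi> \<in> CT (Suc r)"
  from weak[OF \<phi>] obtain g where cont: "continuous_on {0..1} (\<lambda>t. y t \<phi>)"
    and g: "\<And>t. t \<in> {0..1} \<Longrightarrow> (g has_real_derivative y t \<phi>) (at t within {0..1})" "E \<phi> = g 1 - g 0" by blast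
  have "uniformly_continuous_on {0..1} (\<lambda>t. y t \<phi>)"
    by (rule compact_uniformly_continuous[OF cont]) auto
  note uc = this[unfolded uniformly_continuous_on_def, rule_format]
  show "(\<lambda>n. R n \<phi>) \<longlonglongrightarrow> E \<phi>"
  proof (rule LIMSEQ_I)
    fix e :: real assume "e > 0"
    then obtain d where d: "d > 0" "\<And>s t. s \<in> {0..1} \<Longrightarrow> t \<in> {0..1} \<Longrightarrow> dist t s < d \<Longrightarrow>
        dist (y t \<phi>) (y s \<phi>) < e / 2" using uc[of "e / 2"] by auto
    obtain m where m: "1 / real (Suc m) < d" using d(1) nat_approx_posE by blast
    have "norm (R n \<phi> - E \<phi>) < e" if n: "n \<ge> m" for n
    proof -
      define p where "p k = real k / real (Suc n)" for k
      have step: "\<bar>g (p (Suc k)) - g (p k) - y (p k) \<phi> / real (Suc n)\<bar> \<le> (e / 2) / real (Suc n)" if "k < Suc n" for k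
      proof -
        have len: "p (Suc k) - p k = 1 / real (Suc n)" by (simp add: p_def field_simps)
        have le: "p k \<le> p (Suc k)" by (simp add: p_def divide_right_mono)
        have "1 / real (Suc n) \<le> 1 / real (Suc m)" using n by (intro divide_left_mono) auto
        then have small: "1 / real (Suc n) < d" using m by linarith
        have sub: "{p k..p (Suc k)} \<subseteq> {0..1}" using pt[of k n] pt[of "Suc k" n] \<open>k < Suc n\<close> by (auto simp: p_def)
        have "norm ((g (p (Suc k)) - p (Suc k) * y (p k) \<phi>) - (g (p k) - p k * y (p k) \<phi>)) \<le> (e / 2) * norm (p (Suc k) - p k)"
        proof (rule field_differentiable_bound[where S = "{p k..p (Suc k)}"])
          fix t assume t: "t \<in> {p k..p (Suc k)}"
          show "((\<lambda>t. g t - t * y (p k) \<phi>) has_field_derivative (y t \<phi> - y (p k) \<phi>)) (at t within {p k..p (Suc k)})"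
            using t sub by (auto intro!: derivative_eq_intros DERIV_subset[OF g(1) sub])
          have "dist t (p k) < d" using t len small by (auto simp: dist_real_def)
          then show "norm (y t \<phi> - y (p k) \<phi>) \<le> e / 2"
            using d(2)[of "p k" t] t sub by (force simp: dist_real_def)
        qed (use le in auto)
        then have "\<bar>g (p (Suc k)) - g (p k) - (p (Suc k) - p k) * y (p k) \<phi>\<bar> \<le> (e / 2) * (p (Suc k) - p k)"
          using le by (simp add: algebra_simps)
        then show ?thesis unfolding len by simp
      qed
      have "(\<Sum>k<Suc n. g (p (Suc k)) - g (p k)) = g (p (Suc n)) - g (p 0)"
        by (rule sum_lessThan_telescope)
      then have tele: "E \<phi> = (\<Sum>k<Suc n. g (p (Suc k)) - g (p k))" by (simp add: g(2) p_def)
      have "R n \<phi> = (\<Sum>k<Suc n. y (p k) \<phi> / real (Suc n))"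
        by (simp only: R_def dscale_apply sum_distr_apply p_def sum_divide_distrib[symmetric]) simp
      then have "E \<phi> - R n \<phi> = (\<Sum>k<Suc n. g (p (Suc k)) - g (p k) - y (p k) \<phi> / real (Suc n))"
        by (simp only: tele sum_subtractf)
      also have "\<bar>\<dots>\<bar> \<le> (\<Sum>k<Suc n. (e / 2) / real (Suc n))"
        using step by (intro order_trans[OF sum_abs] sum_mono) auto
      also have "\<dots> = e / 2" by (simp del: of_nat_Suc)
      finally have "\<bar>E \<phi> - R n \<phi>\<bar> \<le> e / 2" .
      then show ?thesis
        unfolding real_norm_def abs_minus_commute[of "R n \<phi>"] using \<open>e > 0\<close> by linarith
    qed
    then show "\<exists>no. \<forall>n\<ge>no. norm (R n \<phi> - E \<phi>) < e" by blast
  qed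
qed

end

section \<open>Regularity of the transfer operators in the parameter\<close>

text \<open>A periodic $C^1$ function is bounded and Lipschitz, which yields any Hoelder exponent below one by treating
distances smaller and larger than one separately.\<close>
lemma smooth_imp_CH:
  assumes "\<And>n. a \<in> CT n"
  shows "a \<in> CH s"
proof -
  have "\<exists>C. \<forall>x y. \<bar>foldr pd ks a x - foldr pd ks a y\<bar> \<le> C * dist x y powr frac s" if "frac s \<noteq> 0" for ks
  proof -
    define f where "f = foldr pd ks a"
    have f: "f \<in> CT 1" using CT_foldr_pd[OF assms, of ks "length ks + 1"] by (simp add: f_def)
    obtain M where M: "\<And>x. \<bar>f x\<bar> \<le> M" using CT_bounded[OF f] by blast
    have "\<exists>D. \<forall>x. \<bar>pd k f x\<bar> \<le> D" for k
      using CT_bounded[OF CT_pd[of f 0 k]] f by simp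
    then obtain D where D: "\<And>k x. \<bar>pd k f x\<bar> \<le> D k" by metis
    define P where "P = (\<Sum>k\<in>UNIV. D k)"
    have Lip: "\<bar>f x - f y\<bar> \<le> P * dist x y" for x y
    proof -
      have "norm (f x - f y) \<le> P * norm (x - y)"
      proof (rule differentiable_bound[where S = UNIV])
        have fd: "f differentiable (at z)" for z using f by (simp add: CT_def)
        show D': "(f has_derivative (\<lambda>v. \<Sum>k\<in>UNIV. v $ k * pd k f z)) (at z within UNIV)" for z
          using has_derivative_pd[OF fd] by simp
        show "onorm (\<lambda>v. \<Sum>k\<in>UNIV. v $ k * pd k f z) \<le> P" for z
        proof (rule onorm_le)
          fix v
          have "norm (\<Sum>k\<in>UNIV. v $ k * pd k f z) \<le> (\<Sum>k\<in>UNIV. norm v * D k)"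
            by (rule sum_norm_le) (auto simp: abs_mult component_le_norm_cart intro!: mult_mono D)
          then show "norm (\<Sum>k\<in>UNIV. v $ k * pd k f z) \<le> P * norm v"
            by (simp add: P_def sum_distrib_left mult.commute)
        qed
      qed auto
      then show ?thesis by (simp add: dist_norm)
    qed
    have M0: "0 \<le> M" using M[of 0] by linarith
    have P0: "0 \<le> P" unfolding P_def by (intro sum_nonneg) (use D in \<open>force intro: order_trans[OF abs_ge_zero]\<close>)
    have "\<bar>f x - f y\<bar> \<le> (P + 2 * M) * dist x y powr frac s" for x y
    proof (cases "dist x y \<le> 1")
      case True
      have "dist x y \<le> dist x y powr frac s"
      proof (cases "x = y")
        case False
        then have "dist x y powr 1 \<le> dist x y powr frac s"
          using True frac_lt_1[of s] by (intro powr_mono') auto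
        then show ?thesis using False by simp
      qed simp
      then have "P * dist x y \<le> P * dist x y powr frac s" using P0 by (intro mult_left_mono) auto
      also have "\<dots> \<le> (P + 2 * M) * dist x y powr frac s" using M0 by (intro mult_right_mono) auto
      finally show ?thesis using Lip[of x y] by linarith
    next
      case False
      have "1 \<le> dist x y powr frac s" using False frac_ge_0[of s] by (intro ge_one_powr_ge_zero) auto
      then have "(P + 2 * M) * 1 \<le> (P + 2 * M) * dist x y powr frac s" using P0 M0 by (intro mult_left_mono) auto
      moreover have "\<bar>f x - f y\<bar> \<le> 2 * M" using M[of x] M[of y] by linarith
      moreover have "2 * M \<le> (P + 2 * M) * 1" using P0 by simp
      ultimately show ?thesis by (meson order_trans)
    qed
    then show ?thesis unfolding f_def by blast
  qed
  then show ?thesis using assms by (auto simp: CH_def)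
qed

lemma dual_lincomb:
  assumes "g \<in> dual n" "h \<in> dual n"
  shows "dscale c g + dscale d h \<in> dual n"
proof -
  obtain C where C: "\<And>f. f \<in> CT n \<Longrightarrow> \<bar>g f\<bar> \<le> C * CT_norm n f"
    using assms(1) unfolding dual_def by blast
  obtain D where D: "\<And>f. f \<in> CT n \<Longrightarrow> \<bar>h f\<bar> \<le> D * CT_norm n f"
    using assms(2) unfolding dual_def by blast
  have "\<bar>c * g f + d * h f\<bar> \<le> (\<bar>c\<bar> * C + \<bar>d\<bar> * D) * CT_norm n f" if "f \<in> CT n" for f
  proof -
    have "\<bar>c * g f + d * h f\<bar> \<le> \<bar>c\<bar> * \<bar>g f\<bar> + \<bar>d\<bar> * \<bar>h f\<bar>" using abs_triangle_ineq by (metis abs_mult)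
    also have "\<dots> \<le> \<bar>c\<bar> * (C * CT_norm n f) + \<bar>d\<bar> * (D * CT_norm n f)"
      using C[OF that] D[OF that] by (intro add_mono mult_left_mono) auto
    finally show ?thesis by (simp add: algebra_simps)
  qed
  then have "\<exists>E. \<forall>f\<in>CT n. \<bar>c * g f + d * h f\<bar> \<le> E * CT_norm n f" by blast
  moreover have "\<forall>f. f \<notin> CT n \<longrightarrow> c * g f + d * h f = 0" using assms by (simp add: dual_def)
  ultimately show ?thesis
    unfolding dual_def[of n] mem_Collect_eq plus_fun_apply dscale_apply
    using dual_add[OF assms(1)] dual_add[OF assms(2)] dual_cmult[OF assms(1)] dual_cmult[OF assms(2)]
    by (simp add: algebra_simps)
qed

context mean_field_setting
begin

lemma in_I: "\<nu> \<in> {0..\<nu>s} \<Longrightarrow> h \<in> prob_distr r \<Longrightarrow> \<nu> * h \<alpha> \<in> I"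
  unfolding I_def by blast

lemma prob_distr_convex:
  assumes "g \<in> prob_distr r" "h \<in> prob_distr r" "0 \<le> c" "0 \<le> d" "c + d = 1"
  shows "dscale c g + dscale d h \<in> prob_distr r"
  using assms dual_lincomb[of g r h c d] unfolding prob_distr_def nonneg_def by simp

text \<open>A convex combination \<open>c * (\<nu> * g \<alpha>) + d * (\<mu> * h \<alpha>)\<close> is again of this form, with
the parameter \<open>c * \<nu> + d * \<mu>\<close> and the correspondingly weighted mixture of \<open>g\<close> and \<open>h\<close>.\<close>
lemma convex_I: "convex I"
proof (rule convexI)
  fix x y c d :: real assume xy: "x \<in> I" "y \<in> I" and cd: "0 \<le> c" "0 \<le> d" "c + d = 1"
  from xy obtain \<nu> \<mu> g h where *: "x = \<nu> * g \<alpha>" "y = \<mu> * h \<alpha>" "\<nu> \<in> {0..\<nu>s}" "\<mu> \<in> {0..\<nu>s}"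
    "g \<in> prob_distr r" "h \<in> prob_distr r" unfolding I_def by blast
  define \<kappa> where "\<kappa> = c * \<nu> + d * \<mu>"
  have "c * \<nu> + d * \<mu> \<le> c * \<nu>s + d * \<nu>s" using * cd by (intro add_mono mult_left_mono) auto
  also have "\<dots> = \<nu>s" using cd by (simp add: distrib_right[symmetric])
  finally have \<kappa>: "\<kappa> \<in> {0..\<nu>s}" using * cd by (simp add: \<kappa>_def)
  show "c *\<^sub>R x + d *\<^sub>R y \<in> I"
  proof (cases "\<kappa> = 0")
    case True
    have nn: "0 \<le> c * \<nu>" "0 \<le> d * \<mu>" using * cd by auto
    with True have "c * \<nu> = 0" "d * \<mu> = 0" unfolding \<kappa>_def by linarith+
    then have "c *\<^sub>R x + d *\<^sub>R y = 0 * g \<alpha>" using * by (auto simp: mult.assoc[symmetric])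
    then show ?thesis using in_I[of 0 g] *(5) \<nu>s_pos by simp
  next
    case False
    have "dscale (c * \<nu> / \<kappa>) g + dscale (d * \<mu> / \<kappa>) h \<in> prob_distr r"
    proof (rule prob_distr_convex[OF *(5,6)])
      show "c * \<nu> / \<kappa> + d * \<mu> / \<kappa> = 1" using False by (simp add: add_divide_distrib[symmetric] \<kappa>_def)
    qed (use * cd \<kappa> in auto)
    from in_I[OF \<kappa> this] have "\<kappa> * ((c * \<nu> / \<kappa>) * g \<alpha> + (d * \<mu> / \<kappa>) * h \<alpha>) \<in> I" by simp
    moreover have "\<kappa> * ((c * \<nu> / \<kappa>) * g \<alpha> + (d * \<mu> / \<kappa>) * h \<alpha>) = c *\<^sub>R x + d *\<^sub>R y"
      using False * by (simp add: distrib_left)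
    ultimately show ?thesis by simp
  qed
qed

lemma segment_in_I: "s \<in> I \<Longrightarrow> s' \<in> I \<Longrightarrow> t \<in> {0..1} \<Longrightarrow> s + t * (s' - s) \<in> I"
  using convexD_alt[OF convex_I, of s s' t] by (simp add: algebra_simps)

lemma L_B: "u \<in> I \<Longrightarrow> i \<le> 3 \<Longrightarrow> h \<in> B i \<Longrightarrow> L u h \<in> B i"
  using A1[OF drift_in_TT, of u i] unfolding bdd_op_def by blast

lemma L_bound:
  assumes "u \<in> I" "i \<in> {1..3}" "h \<in> B i"
  shows "N i (L u h) \<le> (Cs + K) * N i h"
proof -
  have h0: "h \<in> B (i - 1)" using B_le[of "i - 1" i h] assms by auto
  have nn: "0 \<le> N i h" using assms by (intro N_nonneg) auto
  have "N i (L u h) \<le> Cs * \<theta> * N i h + K * N (i - 1) h"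
    using A5_strong[of "[drift u]" i h] assms drift_in_TT by simp
  also have "\<dots> \<le> Cs * 1 * N i h + K * N i h"
    using Cs_ge_1 K_ge_1 \<theta> nn assms N_le[of "i - 1" i h]
    by (intro add_mono mult_mono mult_left_mono mult_right_mono mult_nonneg_nonneg) (auto simp: mult_le_one)
  finally show ?thesis by (simp add: algebra_simps)
qed

lemma b_op: "i \<le> 3 \<Longrightarrow> bdd_op (B i) (N i) (B i) (N i) (b k)"
proof -
  assume i: "i \<le> 3"
  from A3_mult[OF i smooth_imp_CH[OF \<beta>_smooth[of k]]] obtain M where
    M: "bdd_op (B i) (N i) (B i) (N i) M" "\<And>h. h \<in> B i \<Longrightarrow> M h = b k h"
    using \<beta>_smooth[of k r] by blast
  have "b k h \<in> B i" if "h \<in> B i" for h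
    using M(1) M(2)[OF that] that unfolding bdd_op_def by metis
  moreover have "\<exists>C. \<forall>h\<in>B i. N i (b k h) \<le> C * N i h"
    using M unfolding bdd_op_def by metis
  ultimately show ?thesis
    unfolding bdd_op_def by (auto simp: fun_eq_iff mult_def)
qed

lemma b_B: "i \<le> 3 \<Longrightarrow> h \<in> B i \<Longrightarrow> b k h \<in> B i"
  using b_op[of i k] unfolding bdd_op_def by blast

lemma dpartial_op: "i \<le> 2 \<Longrightarrow> bdd_op (B (Suc i)) (N (Suc i)) (B i) (N i) (dpartial r k)"
  using A2 by blast

lemma dpartial_B: "i \<le> 2 \<Longrightarrow> h \<in> B (Suc i) \<Longrightarrow> dpartial r k h \<in> B i"
  using dpartial_op[of i k] unfolding bdd_op_def by blast

lemma dpartial_eval: "h \<in> B 1 \<Longrightarrow> \<phi> \<in> CT (Suc r) \<Longrightarrow> dpartial r k h \<phi> = - h (pd k \<phi>)"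
  using A2[of 0 k] unfolding has_dpartial_def by auto

lemma finite_family_bound:
  assumes "\<And>k::'d. \<exists>C\<ge>0. \<forall>x\<in>X. P k x \<le> C * Q x" "\<And>x. x \<in> X \<Longrightarrow> 0 \<le> (Q x :: real)"
  shows "\<exists>C\<ge>0. \<forall>k. \<forall>x\<in>X. P k x \<le> C * Q x"
proof -
  obtain C where C: "\<And>k. C k \<ge> 0" "\<And>k x. x \<in> X \<Longrightarrow> P k x \<le> C k * Q x" using assms(1) by metis
  have "P k x \<le> (\<Sum>k\<in>UNIV. C k) * Q x" if "x \<in> X" for k x
  proof -
    have "C k \<le> (\<Sum>k\<in>UNIV. C k)" by (rule member_le_sum) (use C in auto)
    then show ?thesis using C(2)[OF that, of k] mult_right_mono assms(2)[OF that] by (meson order_trans)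
  qed
  then show ?thesis using C by (intro exI[of _ "\<Sum>k\<in>UNIV. C k"]) (auto intro: sum_nonneg)
qed

text \<open>The derivative of \<open>u \<mapsto> L u h\<close>: differentiating \<open>\<phi> (T x + u *\<^sub>R \<beta> x)\<close> in \<open>u\<close> and moving the derivative of
\<open>\<phi>\<close> to the distribution gives minus the divergence of \<open>L u (\<beta> h)\<close>.\<close>
definition vel :: "real \<Rightarrow> 'd distr \<Rightarrow> 'd distr"
  where "vel u h = - (\<Sum>k\<in>UNIV. dpartial r k (L u (b k h)))"

lemma vel_B: "u \<in> I \<Longrightarrow> i \<le> 2 \<Longrightarrow> h \<in> B (Suc i) \<Longrightarrow> vel u h \<in> B i"
  unfolding vel_def by (intro B_minus B_sum dpartial_B L_B b_B) auto

lemma vel_bound: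
  assumes i: "i \<le> 2"
  shows "\<exists>C\<ge>0. \<forall>u\<in>I. \<forall>h\<in>B (Suc i). N i (vel u h) \<le> C * N (Suc i) h"
proof -
  have i3: "i \<le> 3" "Suc i \<le> 3" using i by auto
  have nn: "0 \<le> N (Suc i) h" if "h \<in> B (Suc i)" for h using that i3 by (intro N_nonneg) auto
  obtain Cb where Cb: "Cb \<ge> 0" "\<And>k h. h \<in> B (Suc i) \<Longrightarrow> N (Suc i) (b k h) \<le> Cb * N (Suc i) h"
    using finite_family_bound[of "B (Suc i)" "\<lambda>k h. N (Suc i) (b k h)" "N (Suc i)"]
      bdd_op_bound[OF b_op i3(2)] i3 nn by auto
  obtain Cd where Cd: "Cd \<ge> 0" "\<And>k h. h \<in> B (Suc i) \<Longrightarrow> N i (dpartial r k h) \<le> Cd * N (Suc i) h"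
    using finite_family_bound[of "B (Suc i)" "\<lambda>k h. N i (dpartial r k h)" "N (Suc i)"]
      bdd_op_bound[OF dpartial_op[OF i] i3(2)] nn by auto
  define C where "C = real CARD('d) * (Cd * ((Cs + K) * Cb))"
  have "N i (vel u h) \<le> C * N (Suc i) h" if u: "u \<in> I" and h: "h \<in> B (Suc i)" for u h
  proof -
    have "N i (vel u h) = N i (\<Sum>k\<in>UNIV. dpartial r k (L u (b k h)))"
      unfolding vel_def by (intro N_minus B_sum dpartial_B L_B b_B i3 i u h)
    also have "\<dots> \<le> (\<Sum>k\<in>UNIV. N i (dpartial r k (L u (b k h))))"
      by (intro N_sum dpartial_B L_B b_B i3 i u h)
    also have "\<dots> \<le> (\<Sum>k\<in>(UNIV::'d set). Cd * ((Cs + K) * (Cb * N (Suc i) h)))"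
    proof (rule sum_mono)
      fix k
      have "N i (dpartial r k (L u (b k h))) \<le> Cd * N (Suc i) (L u (b k h))"
        by (intro Cd L_B b_B i3 u h)
      also have "\<dots> \<le> Cd * ((Cs + K) * N (Suc i) (b k h))"
        using i by (intro mult_left_mono L_bound b_B i3 u h Cd) auto
      also have "\<dots> \<le> Cd * ((Cs + K) * (Cb * N (Suc i) h))"
        using Cs_ge_1 K_ge_1 by (intro mult_left_mono Cb Cd h) auto
      finally show "N i (dpartial r k (L u (b k h))) \<le> Cd * ((Cs + K) * (Cb * N (Suc i) h))" .
    qed
    finally show ?thesis by (simp add: C_def mult_ac)
  qed
  moreover have "C \<ge> 0" using Cb Cd Cs_ge_1 K_ge_1 by (simp add: C_def)
  ultimately show ?thesis by blast
qed

lemma dpartial_mass: "h \<in> B 1 \<Longrightarrow> mass (dpartial r k h) = 0"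
  using dpartial_eval[of h "\<lambda>_. 1" k] CT_const[of 1 "Suc r"] B_dual[of 1 h] by (simp add: dual_zero)

lemma vel_mass: "u \<in> I \<Longrightarrow> h \<in> B 1 \<Longrightarrow> mass (vel u h) = 0"
  by (simp add: vel_def sum_distr_apply dpartial_mass L_B b_B)

lemma L_apply: "\<phi> \<in> CT r \<Longrightarrow> L u h \<phi> = h (\<lambda>x. \<phi> (T x + u *\<^sub>R \<beta> x))"
  by (simp add: transfer_op_def drift_def o_def)

lemma L_mass: "mass (L u h) = mass h"
  using L_apply[OF CT_const[of 1 r]] by simp

lemma vel_apply:
  assumes "u \<in> I" "h \<in> B 1" "\<phi> \<in> CT (Suc r)"
  shows "vel u h \<phi> = (\<Sum>k\<in>UNIV. h (\<lambda>x. \<beta> x $ k * pd k \<phi> (T x + u *\<^sub>R \<beta> x)))"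
proof -
  have "dpartial r k (L u (b k h)) \<phi> = - h (\<lambda>x. \<beta> x $ k * pd k \<phi> (T x + u *\<^sub>R \<beta> x))" for k
  proof -
    have c: "(\<lambda>x. pd k \<phi> (T x + u *\<^sub>R \<beta> x)) \<in> CT r"
      using CT_compose[OF CT_pd[OF assms(3)] drift_torus_maps[of u]] by (simp add: drift_def)
    have "dpartial r k (L u (b k h)) \<phi> = - L u (b k h) (pd k \<phi>)"
      using assms by (intro dpartial_eval L_B b_B) auto
    also have "\<dots> = - h (\<lambda>x. \<beta> x $ k * pd k \<phi> (T x + u *\<^sub>R \<beta> x))"
      using L_apply[OF CT_pd[OF assms(3)]] c by (simp add: mult_def)
    finally show ?thesis .
  qed
  then show ?thesis by (simp add: vel_def sum_distr_apply sum_negf)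
qed

lemma L_weak_derivative:
  assumes "u \<in> I" "h \<in> B 1" "\<phi> \<in> CT (Suc r)"
  shows "((\<lambda>u. L u h \<phi>) has_real_derivative vel u h \<phi>) (at u)"
  using dual_drift_derivative[OF T_smooth \<beta>_smooth assms(3) B_dual[OF _ assms(2)], of u]
  by (simp add: vel_apply[OF assms] L_apply[OF CT_le[OF assms(3)]])

text \<open>Strong continuity is lost by one space, since it comes from the compactness of the embedding.\<close>
lemma L_continuous:
  assumes i: "i \<le> 2" and h: "h \<in> B (Suc i)" and s: "s \<in> I"
  shows "conv i (\<lambda>u. L u h) (L s h) (at s within I)"
proof (rule ball_closure_weak_imp_conv[OF i])
  show "ball_closure i ((Cs + K) * N (Suc i) h) (L u h)" if "u \<in> I - {s}" for u
    using that i h by (intro ball_closure_ball L_B L_bound) auto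
  show "L s h \<in> dual r" using B_dual[of "Suc i"] L_B[OF s] i h by auto
  show "((\<lambda>u. L u h \<phi>) \<longlongrightarrow> L s h \<phi>) (at s within I)" if "\<phi> \<in> CT (Suc r)" for \<phi>
    using DERIV_isCont[OF L_weak_derivative[OF s B_le[of 1 "Suc i" h] that]] i h
    by (auto simp: isCont_def intro: tendsto_within_subset)
qed

lemma vel_continuous:
  assumes i: "i \<le> 1" and h: "h \<in> B (Suc (Suc i))" and s: "s \<in> I"
  shows "conv i (\<lambda>u. vel u h) (vel s h) (at s within I)"
proof -
  have i3: "i \<le> 3" "Suc i \<le> 3" "i \<le> 2" "Suc i \<le> 2" "Suc (Suc i) \<le> 3" using i by auto
  have h': "h \<in> B (Suc i)" using B_le[of "Suc i" "Suc (Suc i)" h] i3 h by auto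
  have "conv i (\<lambda>u. dpartial r k (L u (b k h))) (dpartial r k (L s (b k h))) (at s within I)" for k
    using L_continuous[OF i3(4) b_B[OF i3(5) h] s]
    by (intro conv_op[OF dpartial_op[OF i3(3)] i3(2,1)] eventually_within_I L_B b_B i3 h' s) auto
  then have "conv i (\<lambda>u. \<Sum>k\<in>UNIV. dpartial r k (L u (b k h))) (\<Sum>k\<in>UNIV. dpartial r k (L s (b k h))) (at s within I)"
    by (intro conv_sum[OF i3(1)] eventually_within_I dpartial_B L_B b_B i3 h' s) auto
  then show ?thesis
    unfolding vel_def
    by (intro conv_minus[OF i3(1)] eventually_within_I B_sum dpartial_B L_B b_B i3 h' s) auto
qed

lemma conv_eval_within:
  assumes "conv i f g (at s within S)" "i \<le> 3" "\<And>u. u \<in> S \<Longrightarrow> f u \<in> B i" "g \<in> B i" "\<phi> \<in> CT r"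
  shows "((\<lambda>x. f x \<phi>) \<longlongrightarrow> g \<phi>) (at s within S)"
  using assms by (intro conv_eval[of i f g]) (auto intro: eventually_within_I)

lemma segment_image: "s \<in> I \<Longrightarrow> s' \<in> I \<Longrightarrow> (\<lambda>t. s + t * (s' - s)) ` {0..1} \<subseteq> I"
  using segment_in_I by blast

lemma continuous_on_I:
  assumes "\<And>s. s \<in> I \<Longrightarrow> (f \<longlongrightarrow> f s) (at s within I)"
  shows "continuous_on I f"
  using assms by (simp add: continuous_on_def)

text \<open>The difference quotient is the average of \<open>vel\<close> over the segment from \<open>s\<close> to \<open>s'\<close>.\<close>
lemma L_quotient_ball_closure:
  assumes i: "i \<le> 1" and h: "h \<in> B (Suc (Suc i))"
  shows "\<exists>M. \<forall>s\<in>I. \<forall>s'\<in>I. s \<noteq> s' \<longrightarrow> ball_closure i M (dscale (1 / (s' - s)) (L s' h - L s h))"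
proof -
  have i3: "i \<le> 3" "Suc i \<le> 3" "i \<le> 2" "Suc i \<le> 2" "Suc (Suc i) \<le> 3" using i by auto
  have h1: "h \<in> B 1" "h \<in> B i" using B_le[of 1 "Suc (Suc i)" h] B_le[of i "Suc (Suc i)" h] i3 h by auto
  obtain C where C: "\<And>u. u \<in> I \<Longrightarrow> N (Suc i) (vel u h) \<le> C * N (Suc (Suc i)) h"
    using vel_bound[OF i3(4)] h by blast
  have "ball_closure i (C * N (Suc (Suc i)) h) (dscale (1 / (s' - s)) (L s' h - L s h))" if s: "s \<in> I" "s' \<in> I" "s \<noteq> s'" for s s'
  proof (rule ball_closure_mean_value[OF i3(3)])
    fix t :: real assume "t \<in> {0..1}"
    from segment_in_I[OF s(1,2) this] show "vel (s + t * (s' - s)) h \<in> B (Suc i)"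
      "N (Suc i) (vel (s + t * (s' - s)) h) \<le> C * N (Suc (Suc i)) h"
      by (auto intro!: vel_B C i3 h)
  next
    show "dscale (1 / (s' - s)) (L s' h - L s h) \<in> dual r"
      by (rule B_dual[OF i3(1)]) (intro B_scale B_diff L_B i3 s h1)
  next
    fix \<phi> :: "real ^ 'd \<Rightarrow> real" assume \<phi>: "\<phi> \<in> CT (Suc r)"
    have "continuous_on I (\<lambda>u. vel u h \<phi>)"
      by (intro continuous_on_I conv_eval_within[OF vel_continuous[OF i h]] vel_B i3)
         (auto intro: CT_le[OF \<phi>] vel_B i3 h B_le[of "Suc i" "Suc (Suc i)"])
    then have c: "continuous_on {0..1} (\<lambda>t. vel (s + t * (s' - s)) h \<phi>)"
      by (rule continuous_on_compose2[OF _ _ segment_image[OF s(1,2)]]) (intro continuous_intros)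
    define g where "g t = L (s + t * (s' - s)) h \<phi> / (s' - s)" for t
    have "(g has_real_derivative vel (s + t * (s' - s)) h \<phi>) (at t within {0..1})" if t: "t \<in> {0..1}" for t
    proof -
      have "((\<lambda>t. s + t * (s' - s)) has_real_derivative (s' - s)) (at t)"
        by (auto intro!: derivative_eq_intros)
      from DERIV_chain2[OF L_weak_derivative[OF segment_in_I[OF s(1,2) t] h1(1) \<phi>] this]
      have "((\<lambda>t. L (s + t * (s' - s)) h \<phi>) has_real_derivative vel (s + t * (s' - s)) h \<phi> * (s' - s)) (at t)" .
      from DERIV_cdivide[OF this, of "s' - s"] have "(g has_real_derivative vel (s + t * (s' - s)) h \<phi>) (at t)"
        using s(3) by (simp add: g_def[abs_def])
      then show ?thesis by (rule has_field_derivative_at_within)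
    qed
    moreover have "dscale (1 / (s' - s)) (L s' h - L s h) \<phi> = g 1 - g 0"
      by (simp add: g_def diff_divide_distrib)
    ultimately show "continuous_on {0..1} (\<lambda>t. vel (s + t * (s' - s)) h \<phi>) \<and>
      (\<exists>g. (\<forall>t\<in>{0..1}. (g has_real_derivative vel (s + t * (s' - s)) h \<phi>) (at t within {0..1})) \<and>
        dscale (1 / (s' - s)) (L s' h - L s h) \<phi> = g 1 - g 0)" using c by blast
  qed
  then show ?thesis by blast
qed

lemma L_derivative:
  assumes i: "i \<le> 1" and h: "h \<in> B (Suc (Suc i))" and s: "s \<in> I"
  shows "conv i (\<lambda>s'. dscale (1 / (s' - s)) (L s' h - L s h)) (vel s h) (at s within I)"
proof -
  have i3: "i \<le> 3" "Suc i \<le> 3" "i \<le> 2" "Suc i \<le> 2" "Suc (Suc i) \<le> 3" using i by auto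
  obtain M where M: "\<And>s s'. s \<in> I \<Longrightarrow> s' \<in> I \<Longrightarrow> s \<noteq> s' \<Longrightarrow> ball_closure i M (dscale (1 / (s' - s)) (L s' h - L s h))"
    using L_quotient_ball_closure[OF i h] by blast
  have h1: "h \<in> B 1" using B_le[of 1 "Suc (Suc i)" h] i3 h by auto
  show ?thesis
  proof (rule ball_closure_weak_imp_conv[OF i3(3)])
    show "ball_closure i M (dscale (1 / (s' - s)) (L s' h - L s h))" if "s' \<in> I - {s}" for s'
      using M[OF s, of s'] that by auto
    show "vel s h \<in> dual r" using B_dual[OF i3(2)] vel_B[OF s i3(4) h] by blast
    fix \<phi> :: "real ^ 'd \<Rightarrow> real" assume "\<phi> \<in> CT (Suc r)"
    from has_field_derivative_at_within[OF L_weak_derivative[OF s h1 this], of I]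
    show "((\<lambda>s'. dscale (1 / (s' - s)) (L s' h - L s h) \<phi>) \<longlongrightarrow> vel s h \<phi>) (at s within I)"
      unfolding has_field_derivative_iff by simp
  qed
qed

text \<open>The second derivative of \<open>u \<mapsto> L u h\<close>.\<close>
definition acc :: "real \<Rightarrow> 'd distr \<Rightarrow> 'd distr"
  where "acc u h = - (\<Sum>k\<in>UNIV. dpartial r k (vel u (b k h)))"

lemma acc_B: "u \<in> I \<Longrightarrow> i \<le> 1 \<Longrightarrow> h \<in> B (Suc (Suc i)) \<Longrightarrow> acc u h \<in> B i"
  unfolding acc_def by (intro B_minus B_sum dpartial_B vel_B b_B) auto

lemma acc_mass: "u \<in> I \<Longrightarrow> h \<in> B 2 \<Longrightarrow> mass (acc u h) = 0"
  using vel_B[of u 1 "b _ h"] b_B[of 2 h]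
  by (simp add: acc_def sum_distr_apply dpartial_mass numeral_2_eq_2)

lemma acc_bound:
  assumes h: "h \<in> B 3"
  shows "\<exists>C. \<forall>u\<in>I. N 1 (acc u h) \<le> C"
proof -
  obtain C where C: "C \<ge> 0" "\<And>u h. u \<in> I \<Longrightarrow> h \<in> B 3 \<Longrightarrow> N 2 (vel u h) \<le> C * N 3 h"
    using vel_bound[of 2] by (auto simp: numeral_3_eq_3 numeral_2_eq_2)
  have "\<exists>D\<ge>0. \<forall>h\<in>B 2. N 1 (dpartial r k h) \<le> D * N 2 h" for k
    using bdd_op_bound[OF dpartial_op[of 1 k]] by (simp add: numeral_2_eq_2)
  then obtain D where D: "\<And>k. D k \<ge> 0" "\<And>k h. h \<in> B 2 \<Longrightarrow> N 1 (dpartial r k h) \<le> D k * N 2 h" by metis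
  have "N 1 (acc u h) \<le> (\<Sum>k\<in>UNIV. D k * (C * N 3 (b k h)))" if u: "u \<in> I" for u
  proof -
    have b3: "b k h \<in> B 3" for k using b_B[OF _ h] by simp
    have v2: "vel u (b k h) \<in> B 2" for k using vel_B[OF u, of 2] b3 by (simp add: numeral_3_eq_3 numeral_2_eq_2)
    have d1: "dpartial r k (vel u (b k h)) \<in> B 1" for k using dpartial_B[of 1] v2 by (simp add: numeral_2_eq_2)
    have "N 1 (acc u h) = N 1 (\<Sum>k\<in>UNIV. dpartial r k (vel u (b k h)))"
      unfolding acc_def by (intro N_minus B_sum d1) auto
    also have "\<dots> \<le> (\<Sum>k\<in>UNIV. N 1 (dpartial r k (vel u (b k h))))"
      by (intro N_sum d1) auto
    also have "\<dots> \<le> (\<Sum>k\<in>UNIV. D k * (C * N 3 (b k h)))"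
      by (intro sum_mono order_trans[OF D(2)[OF v2]] mult_left_mono C D u b3)
    finally show ?thesis .
  qed
  then show ?thesis by blast
qed

lemma acc_continuous:
  assumes h: "h \<in> B 3" and s: "s \<in> I"
  shows "conv 0 (\<lambda>u. acc u h) (acc s h) (at s within I)"
proof -
  have b3: "b k h \<in> B 3" for k using b_B[OF _ h] by simp
  have b1: "b k h \<in> B (Suc 1)" for k using B_le[OF _ _ b3, of "Suc 1"] by simp
  have v1: "vel u (b k h) \<in> B 1" if "u \<in> I" for u k using vel_B[OF that, of 1] b1 by simp
  have c: "conv 0 (\<lambda>u. dpartial r k (vel u (b k h))) (dpartial r k (vel s (b k h))) (at s within I)" for k
    using vel_continuous[of 1 "b k h" s] b3 s v1
    by (intro conv_op[OF dpartial_op[of 0]] eventually_within_I) (auto simp: numeral_3_eq_3)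
  have d0: "dpartial r k (vel u (b k h)) \<in> B 0" if "u \<in> I" for u k
    using dpartial_B[of 0] v1[OF that] by simp
  have "conv 0 (\<lambda>u. \<Sum>k\<in>UNIV. dpartial r k (vel u (b k h))) (\<Sum>k\<in>UNIV. dpartial r k (vel s (b k h))) (at s within I)"
    by (intro conv_sum c eventually_within_I d0 s) auto
  then show ?thesis
    unfolding acc_def by (intro conv_minus eventually_within_I B_sum d0 s) auto
qed

lemma vel_derivative:
  assumes h: "h \<in> B 3" and s: "s \<in> I" and \<phi>: "\<phi> \<in> CT r"
  shows "((\<lambda>u. vel u h \<phi>) has_real_derivative acc s h \<phi>) (at s within I)"
proof -
  define q where "q k s' = dscale (1 / (s' - s)) (L s' (b k h) - L s (b k h))" for k s'
  have b3: "b k h \<in> B 3" for k using b_B[OF _ h] by simp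
  have b1: "b k h \<in> B 1" "b k h \<in> B (Suc 1)" for k using B_le[OF _ _ b3, of 1] B_le[OF _ _ b3, of "Suc 1"] by auto
  have q1: "q k s' \<in> B 1" if "s' \<in> I" for k s'
    unfolding q_def using that by (intro B_scale B_diff L_B b1 s) auto
  have v1: "vel s (b k h) \<in> B 1" for k using vel_B[OF s, of 1] b1 by simp
  have conv_q: "conv 1 (q k) (vel s (b k h)) (at s within I)" for k
    unfolding q_def using b3 by (intro L_derivative s) (auto simp: numeral_3_eq_3)
  have c: "conv 0 (\<lambda>s'. dpartial r k (q k s')) (dpartial r k (vel s (b k h))) (at s within I)" for k
    using conv_q q1 v1 by (intro conv_op[OF dpartial_op[of 0]] eventually_within_I) auto
  have t: "((\<lambda>s'. dpartial r k (q k s') \<phi>) \<longlongrightarrow> dpartial r k (vel s (b k h)) \<phi>) (at s within I)" for k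
    using dpartial_B[of 0] q1 v1 by (intro conv_eval_within[OF c] \<phi>) auto
  have lin: "dpartial r k (q k s') \<phi> = (dpartial r k (L s' (b k h)) \<phi> - dpartial r k (L s (b k h)) \<phi>) / (s' - s)"
    if s': "s' \<in> I" for k s'
  proof -
    have op: "bdd_op (B 1) (N 1) (B 0) (N 0) (dpartial r k)" using dpartial_op[of 0 k] by simp
    have L1: "L s' (b k h) \<in> B 1" "L s (b k h) \<in> B 1"       by (rule L_B[OF s' _ b1(1)], simp) (rule L_B[OF s _ b1(1)], simp)
    have "dpartial r k (q k s') = dscale (1 / (s' - s)) (dpartial r k (L s' (b k h) - L s (b k h)))"
      unfolding q_def using op B_diff[OF _ L1] unfolding bdd_op_def by simp
    also have "dpartial r k (L s' (b k h) - L s (b k h)) = dpartial r k (L s' (b k h)) - dpartial r k (L s (b k h))"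
      using bdd_op_diff[OF op _ L1] by simp
    finally show ?thesis by simp
  qed
  have "((\<lambda>s'. - (\<Sum>k\<in>UNIV. dpartial r k (q k s') \<phi>)) \<longlongrightarrow> acc s h \<phi>) (at s within I)"
    unfolding acc_def using t by (auto simp: sum_distr_apply intro!: tendsto_intros)
  moreover have "\<forall>\<^sub>F s' in at s within I. - (\<Sum>k\<in>UNIV. dpartial r k (q k s') \<phi>) = (vel s' h \<phi> - vel s h \<phi>) / (s' - s)"
    by (rule eventually_within_I)
       (simp add: lin vel_def sum_distr_apply sum_divide_distrib[symmetric] sum_subtractf diff_divide_distrib)
  ultimately show ?thesis
    unfolding has_field_derivative_iff using Lim_transform_eventually by fast
qed

lemma L_derivative_apply:
  assumes h: "h \<in> B 2" and s: "s \<in> I" and \<phi>: "\<phi> \<in> CT r"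
  shows "((\<lambda>u. L u h \<phi>) has_real_derivative vel s h \<phi>) (at s within I)"
proof -
  have h0: "h \<in> B 0" "h \<in> B (Suc 0)" using B_le[OF _ _ h, of 0] B_le[OF _ _ h, of 1] by auto
  have "((\<lambda>s'. dscale (1 / (s' - s)) (L s' h - L s h) \<phi>) \<longlongrightarrow> vel s h \<phi>) (at s within I)"
    using h s h0 by (intro conv_eval_within[OF L_derivative[of 0]] \<phi> B_scale B_diff L_B vel_B) (auto simp: numeral_2_eq_2)
  then show ?thesis unfolding has_field_derivative_iff by simp
qed

text \<open>Taylor's formula with integral remainder: the quotient is the integral of \<open>1 - t\<close> times \<open>acc\<close> at
the point \<open>s + t * (s' - s)\<close>.\<close>
lemma L_second_order:
  assumes h: "h \<in> B 3" and s: "s \<in> I"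
  defines "q \<equiv> \<lambda>s'. dscale (1 / (s' - s)\<^sup>2) (L s' h - L s h - dscale (s' - s) (vel s h))"
  shows "\<exists>M. \<forall>s'\<in>I. s' \<noteq> s \<longrightarrow> ball_closure 0 M (q s')" "conv 0 q (dscale (1/2) (acc s h)) (at s within I)"
proof -
  obtain M where M: "\<And>u. u \<in> I \<Longrightarrow> N 1 (acc u h) \<le> M" using acc_bound[OF h] by blast
  have hle: "h \<in> B 2" "h \<in> B 1" "h \<in> B 0" "h \<in> B (Suc (Suc 1))" "h \<in> B (Suc (Suc 0))"
    using B_le[OF _ _ h, of 2] B_le[OF _ _ h, of 1] B_le[OF _ _ h, of 0] h by (auto simp: numeral_3_eq_3 numeral_2_eq_2)
  have accB: "acc u h \<in> B 1" "acc u h \<in> B 0" if "u \<in> I" for u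
    using acc_B[OF that, of 1] acc_B[OF that, of 0] hle by auto
  have qB: "q s' \<in> B 0" if "s' \<in> I" for s'
    unfolding q_def using hle s that by (intro B_scale B_diff L_B vel_B) auto
  have primitive: "(G has_real_derivative (1 - t) * (acc (s + t * (s' - s)) h \<phi> - c)) (at t within {0..1}) \<and>
      q s' \<phi> - c / 2 = G 1 - G 0"
    if s': "s' \<in> I" "s' \<noteq> s" and t: "t \<in> {0..1}" and \<phi>: "\<phi> \<in> CT r"
      and G: "G = (\<lambda>t. (L (s + t * (s' - s)) h \<phi> + (1 - t) * (s' - s) * vel (s + t * (s' - s)) h \<phi>) / (s' - s)\<^sup>2
        + (1 - t)\<^sup>2 / 2 * c)" for G c s' t \<phi>
  proof
    define e where "e = s' - s"
    have e: "e \<noteq> 0" using s' by (simp add: e_def)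
    have st: "s + t * e \<in> I" unfolding e_def by (rule segment_in_I[OF s s'(1) t])
    have lin: "((\<lambda>t. s + t * e) has_real_derivative e) (at t within {0..1})"
      by (auto intro!: derivative_eq_intros)
    have im: "(\<lambda>t. s + t * e) ` {0..1} \<subseteq> I" unfolding e_def by (rule segment_image[OF s s'(1)])
    have dL: "((\<lambda>t. L (s + t * e) h \<phi>) has_real_derivative vel (s + t * e) h \<phi> * e) (at t within {0..1})"
      using DERIV_image_chain[OF DERIV_subset[OF L_derivative_apply[OF hle(1) st \<phi>] im] lin] by (simp add: o_def)
    have dV: "((\<lambda>t. vel (s + t * e) h \<phi>) has_real_derivative acc (s + t * e) h \<phi> * e) (at t within {0..1})"
      using DERIV_image_chain[OF DERIV_subset[OF vel_derivative[OF h st \<phi>] im] lin] by (simp add: o_def)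
    have l2: "((\<lambda>t. (1 - t) * e) has_real_derivative - e) (at t within {0..1})"
      by (auto intro!: derivative_eq_intros)
    have l3: "((\<lambda>t. (1 - t)\<^sup>2 / 2 * c) has_real_derivative - (1 - t) * c) (at t within {0..1})"
      by (auto intro!: derivative_eq_intros)
    have "(G has_real_derivative (vel (s + t * e) h \<phi> * e + (- e * vel (s + t * e) h \<phi>
        + acc (s + t * e) h \<phi> * e * ((1 - t) * e))) / e\<^sup>2 + - (1 - t) * c) (at t within {0..1})"
      unfolding G e_def[symmetric]
      by (rule DERIV_add[OF DERIV_cdivide[OF DERIV_add[OF dL DERIV_mult[OF l2 dV]]] l3])
    moreover have "(vel (s + t * e) h \<phi> * e + (- e * vel (s + t * e) h \<phi>
        + acc (s + t * e) h \<phi> * e * ((1 - t) * e))) / e\<^sup>2 + - (1 - t) * c = (1 - t) * (acc (s + t * e) h \<phi> - c)"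
      using e by (simp add: field_simps power2_eq_square)
    ultimately show "(G has_real_derivative (1 - t) * (acc (s + t * (s' - s)) h \<phi> - c)) (at t within {0..1})"
      by (simp add: e_def)
    show "q s' \<phi> - c / 2 = G 1 - G 0"
      using e unfolding G q_def e_def[symmetric] by (simp add: e_def field_simps)
  qed
  have cont_acc: "continuous_on I (\<lambda>u. acc u h \<phi>)" if "\<phi> \<in> CT r" for \<phi>
    by (intro continuous_on_I conv_eval_within[OF acc_continuous[OF h]] accB that) auto
  have ball_closure: "ball_closure 0 M (q s')" if s': "s' \<in> I" "s' \<noteq> s" for s'
  proof (rule ball_closure_mean_value)
    fix t :: real assume t: "t \<in> {0..1}"
    have a1: "acc (s + t * (s' - s)) h \<in> B 1" by (intro accB segment_in_I s s' t)
    then show "dscale (1 - t) (acc (s + t * (s' - s)) h) \<in> B (Suc 0)" by (simp add: B_scale)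
    have "N 1 (dscale (1 - t) (acc (s + t * (s' - s)) h)) = (1 - t) * N 1 (acc (s + t * (s' - s)) h)"
      using N_scale[OF _ a1, of "1 - t"] t by simp
    also have "\<dots> \<le> 1 * N 1 (acc (s + t * (s' - s)) h)"
      using t by (intro mult_right_mono N_nonneg a1) auto
    also have "\<dots> \<le> M" using M[OF segment_in_I[OF s s'(1) t]] by simp
    finally show "N (Suc 0) (dscale (1 - t) (acc (s + t * (s' - s)) h)) \<le> M" by simp
  next
    show "q s' \<in> dual r" by (rule B_dual[OF _ qB[OF s'(1)]]) simp
  next
    fix \<phi> :: "real ^ 'd \<Rightarrow> real" assume "\<phi> \<in> CT (Suc r)"
    then have \<phi>: "\<phi> \<in> CT r" by (rule CT_le) simp
    have "continuous_on {0..1} (\<lambda>t. acc (s + t * (s' - s)) h \<phi>)"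
      by (rule continuous_on_compose2[OF cont_acc[OF \<phi>] _ segment_image[OF s s'(1)]]) (intro continuous_intros)
    then have cont: "continuous_on {0..1} (\<lambda>t. dscale (1 - t) (acc (s + t * (s' - s)) h) \<phi>)"
      unfolding dscale_apply by (intro continuous_intros)
    define G where "G = (\<lambda>t. (L (s + t * (s' - s)) h \<phi> + (1 - t) * (s' - s) * vel (s + t * (s' - s)) h \<phi>) / (s' - s)\<^sup>2
        + (1 - t)\<^sup>2 / 2 * 0)"
    have *: "(G has_real_derivative dscale (1 - t) (acc (s + t * (s' - s)) h) \<phi>) (at t within {0..1}) \<and> q s' \<phi> = G 1 - G 0"
      if "t \<in> {0..1}" for t
      using primitive[OF s' that \<phi> G_def] unfolding dscale_apply by (simp only: diff_0_right div_0)
    have "q s' \<phi> = G 1 - G 0" using *[of 0] by simp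
    then show "continuous_on {0..1} (\<lambda>t. dscale (1 - t) (acc (s + t * (s' - s)) h) \<phi>) \<and>
      (\<exists>g. (\<forall>t\<in>{0..1}. (g has_real_derivative dscale (1 - t) (acc (s + t * (s' - s)) h) \<phi>) (at t within {0..1})) \<and>
        q s' \<phi> = g 1 - g 0)"
      by (intro conjI[OF cont] exI[of _ G] conjI ballI conjunct1[OF *])
  qed simp
  then show "\<exists>M. \<forall>s'\<in>I. s' \<noteq> s \<longrightarrow> ball_closure 0 M (q s')" by blast
  show "conv 0 q (dscale (1/2) (acc s h)) (at s within I)"
  proof (rule ball_closure_weak_imp_conv)
    show "ball_closure 0 M (q u)" if "u \<in> I - {s}" for u using ball_closure that by auto
    show "dscale (1/2) (acc s h) \<in> dual r" by (rule B_dual[of 0]) (auto intro: B_scale accB s)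
    fix \<phi> :: "real ^ 'd \<Rightarrow> real" assume "\<phi> \<in> CT (Suc r)"
    then have \<phi>: "\<phi> \<in> CT r" by (rule CT_le) simp
    show "((\<lambda>u. q u \<phi>) \<longlongrightarrow> dscale (1/2) (acc s h) \<phi>) (at s within I)"
    proof (rule tendstoI)
      fix e :: real assume e: "e > 0"
      have "((\<lambda>u. acc u h \<phi>) \<longlongrightarrow> acc s h \<phi>) (at s within I)"
        using cont_acc[OF \<phi>] s by (simp add: continuous_on_def)
      from tendstoD[OF this, of "e / 2"] e
      have "\<forall>\<^sub>F u in at s within I. dist (acc u h \<phi>) (acc s h \<phi>) < e / 2" by simp
      then obtain d where d: "d > 0" "\<forall>u\<in>I. u \<noteq> s \<and> dist u s < d \<longrightarrow> dist (acc u h \<phi>) (acc s h \<phi>) < e / 2"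
        unfolding eventually_at by blast
      have "dist (q s' \<phi>) (dscale (1/2) (acc s h) \<phi>) < e" if s': "s' \<in> I" "s' \<noteq> s" "dist s' s < d" for s'
      proof -
        define c where "c = acc s h \<phi>"
        define G where "G = (\<lambda>t. (L (s + t * (s' - s)) h \<phi> + (1 - t) * (s' - s) * vel (s + t * (s' - s)) h \<phi>) / (s' - s)\<^sup>2
          + (1 - t)\<^sup>2 / 2 * c)"
        have "norm (G 1 - G 0) \<le> e / 2 * norm (1 - 0 :: real)"
        proof (rule field_differentiable_bound[where S = "{0..1}"])
          fix t :: real assume t: "t \<in> {0..1}"
          show "(G has_field_derivative (1 - t) * (acc (s + t * (s' - s)) h \<phi> - c)) (at t within {0..1})"
            using primitive[OF s'(1,2) t \<phi> G_def] by blast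
          have "\<bar>acc (s + t * (s' - s)) h \<phi> - c\<bar> \<le> e / 2"
          proof (cases "t = 0")
            case False
            have "\<bar>t * (s' - s)\<bar> \<le> 1 * \<bar>s' - s\<bar>" unfolding abs_mult using t by (intro mult_right_mono) auto
            then have "dist (s + t * (s' - s)) s < d" using s'(3) by (simp add: dist_real_def)
            then show ?thesis using d(2)[rule_format, OF segment_in_I[OF s s'(1) t]] False s'(2)
              by (auto simp: c_def dist_real_def intro: less_imp_le)
          qed (use e in \<open>simp add: c_def\<close>)
          then have "\<bar>1 - t\<bar> * \<bar>acc (s + t * (s' - s)) h \<phi> - c\<bar> \<le> 1 * (e / 2)"
            using t by (intro mult_mono) auto
          then show "norm ((1 - t) * (acc (s + t * (s' - s)) h \<phi> - c)) \<le> e / 2" by (simp add: abs_mult)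
        qed auto
        moreover have "q s' \<phi> - c / 2 = G 1 - G 0" using primitive[OF s'(1,2) _ \<phi> G_def, of 0] by auto
        ultimately show ?thesis using e by (simp add: dist_real_def c_def)
      qed
      then show "\<forall>\<^sub>F u in at s within I. dist (q u \<phi>) (dscale (1/2) (acc s h) \<phi>) < e"
        unfolding eventually_at using d(1) by blast
    qed
  qed simp
qed

end

section \<open>The resolvent\<close>

context mean_field_setting
begin

abbreviation Lpow :: "real \<Rightarrow> nat \<Rightarrow> 'd distr \<Rightarrow> 'd distr"
  where "Lpow u n \<equiv> (L u) ^^ n"

abbreviation R :: "real \<Rightarrow> 'd distr \<Rightarrow> 'd distr"
  where "R u \<equiv> resolvent r B (drift u)"

lemma fold_transfer_op: "fold (transfer_op r) (replicate n S) h = (transfer_op r S ^^ n) h"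
  by (induction n arbitrary: h) (simp_all add: funpow_swap1)

lemma Lpow_B: "u \<in> I \<Longrightarrow> i \<le> 3 \<Longrightarrow> h \<in> B i \<Longrightarrow> Lpow u n h \<in> B i"
  by (induction n) (auto intro: L_B)

lemma Lpow_mass: "mass (Lpow u n h) = mass h"
  by (induction n) (auto simp: L_mass)

lemma Lpow_diff: "Lpow u n (g - h) = Lpow u n g - Lpow u n h"
proof (induction n)
  case 0 show ?case by (simp only: funpow.simps id_apply)
next
  case (Suc n) show ?case by (simp only: funpow.simps o_apply Suc.IH transfer_op_diff)
qed

lemma VV_iff: "h \<in> VV B \<longleftrightarrow> h \<in> B 1 \<and> mass h = 0"
  by (auto simp: VV_def)

lemma VV_I: "1 \<le> i \<Longrightarrow> i \<le> 3 \<Longrightarrow> h \<in> B i \<Longrightarrow> mass h = 0 \<Longrightarrow> h \<in> VV B \<inter> B i"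
  using B_le[of 1 i h] by (auto simp: VV_iff)

lemma Lpow_weak: "u \<in> I \<Longrightarrow> h \<in> B 1 \<Longrightarrow> N 0 (Lpow u n h) \<le> Cs * N 0 h"
proof -
  assume "u \<in> I" "h \<in> B 1"
  moreover from this have "set (replicate n (drift u)) \<subseteq> TT" using drift_in_TT[of u] by auto
  ultimately show ?thesis using A5_weak[of "replicate n (drift u)" 1 h] by (simp add: fold_transfer_op)
qed

text \<open>The contraction is only assumed for long compositions; the Lasota-Yorke inequality covers the remaining finitely
many iterates at the price of a constant.\<close>
lemma Lpow_decay:
  "\<exists>C\<ge>1. \<forall>i\<in>{1..3}. \<forall>u\<in>I. \<forall>n. \<forall>h\<in>VV B \<inter> B i. N i (Lpow u n h) \<le> C * \<theta> ^ n * N i h"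
proof -
  obtain nbar where nbar: "\<And>Ss i. length Ss \<ge> nbar \<Longrightarrow> set Ss \<subseteq> TT \<Longrightarrow> i \<in> {1..3} \<Longrightarrow>
      \<exists>c < \<theta> ^ length Ss. \<forall>h\<in>VV B \<inter> B i. N i (fold (transfer_op r) Ss h) \<le> c * N i h"
    using A6 by blast
  define C where "C = (Cs + K) / \<theta> ^ nbar"
  have C1: "C \<ge> 1"
    using Cs_ge_1 K_ge_1 \<theta> power_le_one[of \<theta> nbar] by (auto simp: C_def le_divide_eq)
  have "N i (Lpow u n h) \<le> C * \<theta> ^ n * N i h" if i: "i \<in> {1..3}" and u: "u \<in> I" and h: "h \<in> VV B \<inter> B i" for i u n h
  proof -
    have nn: "0 \<le> N i h" using i h by (intro N_nonneg) auto
    have set: "set (replicate n (drift u)) \<subseteq> TT" using drift_in_TT[OF u] by auto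
    show ?thesis
    proof (cases "n \<ge> nbar")
      case True
      then obtain c where c: "c < \<theta> ^ n" "N i (Lpow u n h) \<le> c * N i h"
        using nbar[of "replicate n (drift u)" i] set i h by (auto simp: fold_transfer_op)
      have "c * N i h \<le> \<theta> ^ n * N i h" using c nn by (intro mult_right_mono) auto
      also have "\<dots> \<le> (C * \<theta> ^ n) * N i h" using C1 \<theta> nn by (intro mult_right_mono) auto
      finally show ?thesis using c by linarith
    next
      case False
      have "N i (Lpow u n h) \<le> Cs * \<theta> ^ n * N i h + K * N (i - 1) h"
        using A5_strong[OF set i, of h] h by (simp add: fold_transfer_op)
      also have "\<dots> \<le> Cs * 1 * N i h + K * N i h"
        using Cs_ge_1 K_ge_1 \<theta> nn i h N_le[of "i - 1" i h] power_le_one[of \<theta> n]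
        by (intro add_mono mult_mono mult_left_mono mult_right_mono mult_nonneg_nonneg) auto
      also have "\<dots> = (Cs + K) * N i h" by (simp add: algebra_simps)
      also have "\<dots> \<le> (C * \<theta> ^ n) * N i h"
      proof (rule mult_right_mono[OF _ nn])
        have "\<theta> ^ nbar \<le> \<theta> ^ n" using False \<theta> by (intro power_decreasing) auto
        then have "1 \<le> \<theta> ^ n / \<theta> ^ nbar" using \<theta> by (simp add: le_divide_eq)
        then have "(Cs + K) * 1 \<le> (Cs + K) * (\<theta> ^ n / \<theta> ^ nbar)" using Cs_ge_1 K_ge_1 by (intro mult_left_mono) auto
        then show "Cs + K \<le> C * \<theta> ^ n" by (simp add: C_def)
      qed
      finally show ?thesis .
    qed
  qed
  with C1 show ?thesis by blast
qed

lemma conv_unique: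
  assumes "i \<le> 3" "conv i f g F" "conv i f g' F" "\<forall>\<^sub>F x in F. f x \<in> B i" "g \<in> B i" "g' \<in> B i" "F \<noteq> bot"
  shows "g = g'"
proof -
  have "((\<lambda>x. N i (f x - g) + N i (f x - g')) \<longlongrightarrow> 0 + 0) F"
    by (rule tendsto_add[OF assms(2,3)])
  moreover have "\<forall>\<^sub>F x in F. N i (g - g') \<le> N i (f x - g) + N i (f x - g')"
    using assms(4)
  proof eventually_elim
    case (elim x)
    then show ?case
      using N_diff_triangle[OF assms(1,5) elim assms(6)] N_commute[OF assms(1,5) elim] by simp
  qed
  ultimately have "N i (g - g') \<le> 0"
    using tendsto_lowerbound[of _ "0 + 0" F "N i (g - g')"] assms(7) by auto
  then have "N i (g - g') = 0" using N_nonneg[OF assms(1) B_diff[OF assms(1,5,6)]] by simp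
  then have "g - g' = 0" using N_eq_0[OF assms(1) B_diff[OF assms(1,5,6)]] by blast
  then show ?thesis by simp
qed

text \<open>The Neumann series converges in \<open>B i\<close> because the iterates decay geometrically on zero average elements.\<close>
lemma resolvent_exists:
  assumes u: "u \<in> I" and i: "i \<in> {1..3}" and f: "f \<in> VV B \<inter> B i"
  shows "\<exists>g\<in>VV B \<inter> B i. g - L u g = f"
proof -
  have i3: "i \<le> 3" using i by simp
  obtain C where C: "C \<ge> 1" "\<And>n h. h \<in> VV B \<inter> B i \<Longrightarrow> N i (Lpow u n h) \<le> C * \<theta> ^ n * N i h"
    using Lpow_decay u i by blast
  define X where "X m = (\<Sum>n<m. Lpow u n f)" for m
  have fB: "f \<in> B i" "mass f = 0" using f by (auto simp: VV_iff)
  have XB: "X m \<in> B i" for m unfolding X_def using fB by (intro B_sum i3 Lpow_B u)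
  have telescope: "X m - L u (X m) = f - Lpow u m f" for m
  proof (induction m)
    case 0 show ?case by (simp add: X_def transfer_op_def fun_eq_iff)
  next
    case (Suc m)
    have "X (Suc m) = X m + Lpow u m f" by (simp add: X_def)
    then have eq: "X (Suc m) - L u (X (Suc m)) = (X m - L u (X m)) + (Lpow u m f - Lpow u (Suc m) f)"
      by (simp add: transfer_op_add)
    have IH: "X m - L u (X m) = f - Lpow u m f" by (rule Suc.IH)
    show "X (Suc m) - L u (X (Suc m)) = f - Lpow u (Suc m) f" unfolding eq IH by simp
  qed
  have tail: "N i (X m - X n) \<le> C * N i f * (\<theta> ^ n / (1 - \<theta>))" if "n \<le> m" for m n
  proof -
    have "X m = X n + (\<Sum>k\<in>{n..<m}. Lpow u k f)"
      unfolding X_def lessThan_atLeast0 by (rule sum.atLeastLessThan_concat[symmetric]) (use that in auto)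
    then have "N i (X m - X n) = N i (\<Sum>k\<in>{n..<m}. Lpow u k f)" by simp
    also have "\<dots> \<le> (\<Sum>k\<in>{n..<m}. N i (Lpow u k f))"
      using fB by (intro N_sum i3 Lpow_B u)
    also have "\<dots> \<le> (\<Sum>k\<in>{n..<m}. C * N i f * \<theta> ^ k)"
      using C(2)[OF f] by (intro sum_mono) (simp add: mult_ac)
    also have "\<dots> = C * N i f * (\<Sum>k\<in>{n..<m}. \<theta> ^ k)" by (simp add: sum_distrib_left)
    also have "\<dots> \<le> C * N i f * (\<theta> ^ n / (1 - \<theta>))"
    proof (intro mult_left_mono)
      have "(\<Sum>k\<in>{n..<m}. \<theta> ^ k) * (1 - \<theta>) = \<theta> ^ n - \<theta> ^ m"
        using that
      proof (induction m rule: dec_induct)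
        case (step k)
        have "(\<Sum>k\<in>{n..<Suc k}. \<theta> ^ k) * (1 - \<theta>) = (\<Sum>k\<in>{n..<k}. \<theta> ^ k) * (1 - \<theta>) + \<theta> ^ k * (1 - \<theta>)"
          using step.hyps by (simp add: distrib_right)
        also have "\<dots> = \<theta> ^ n - \<theta> ^ Suc k" unfolding step.IH by (simp add: right_diff_distrib)
        finally show ?case .
      qed simp
      then have "(\<Sum>k\<in>{n..<m}. \<theta> ^ k) = (\<theta> ^ n - \<theta> ^ m) / (1 - \<theta>)"
        using \<theta> by (simp add: eq_divide_eq)
      also have "\<dots> \<le> \<theta> ^ n / (1 - \<theta>)" using \<theta> by (intro divide_right_mono) auto
      finally show "(\<Sum>k\<in>{n..<m}. \<theta> ^ k) \<le> \<theta> ^ n / (1 - \<theta>)" .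
      show "0 \<le> C * N i f" using C(1) N_nonneg[OF i3 fB(1)] by simp
    qed
    finally show ?thesis .
  qed
  obtain g where g: "g \<in> B i" "conv i X g sequentially"
  proof (rule B_complete[OF i3 XB])
    fix e :: real assume e: "e > 0"
    have "(\<lambda>n. C * N i f * (\<theta> ^ n / (1 - \<theta>))) \<longlonglongrightarrow> C * N i f * (0 / (1 - \<theta>))"
      using \<theta> by (intro tendsto_intros LIMSEQ_realpow_zero) auto
    then have "\<forall>\<^sub>F n in sequentially. C * N i f * (\<theta> ^ n / (1 - \<theta>)) < e"
      using e by (intro order_tendstoD(2)) auto
    then obtain M where M: "\<And>n. n \<ge> M \<Longrightarrow> C * N i f * (\<theta> ^ n / (1 - \<theta>)) < e"
      by (auto simp: eventually_sequentially)
    have "N i (X m - X n) < e" if "m \<ge> M" "n \<ge> M" for m n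
    proof (cases "n \<le> m")
      case True then show ?thesis using tail[OF True] M[OF that(2)] by linarith
    next
      case False
      then show ?thesis using tail[of m n] M[OF that(1)] N_commute[OF i3 XB XB, of m n] by linarith
    qed
    then show "\<exists>M. \<forall>m\<ge>M. \<forall>n\<ge>M. N i (X m - X n) < e" by blast
  qed
  have LX: "L u (X m) \<in> B i" for m by (rule L_B[OF u i3 XB])
  have Lg: "L u g \<in> B i" by (rule L_B[OF u i3 g(1)])
  have "conv i (\<lambda>m. X m - L u (X m)) (g - L u g) sequentially"
  proof -
    have "conv i (\<lambda>m. L u (X m)) (L u g) sequentially"
      using XB by (intro conv_op[OF A1[OF drift_in_TT[OF u] i3] i3 i3 g(2) _ g(1)]) auto
    then have "conv i (\<lambda>m. - L u (X m)) (- L u g) sequentially"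
      by (rule conv_minus[OF i3 _ always_eventually[OF allI[OF LX]] Lg])
    from conv_add[OF i3 g(2) this always_eventually[OF allI[OF XB]] g(1)
        always_eventually[OF allI[OF B_minus[OF i3 LX]]] B_minus[OF i3 Lg]]
    show ?thesis by simp
  qed
  moreover have "conv i (\<lambda>m. X m - L u (X m)) f sequentially"
  proof (rule conv_bound[OF i3])
    show "\<forall>\<^sub>F m in sequentially. N i (X m - L u (X m) - f) \<le> C * \<theta> ^ m * N i f"
      using N_minus[OF i3 Lpow_B[OF u i3 fB(1)]] C(2)[OF f] unfolding telescope by simp
    show "\<forall>\<^sub>F m in sequentially. X m - L u (X m) \<in> B i"
      by (rule always_eventually[OF allI[OF B_diff[OF i3 XB LX]]])
    have "(\<lambda>m. C * \<theta> ^ m * N i f) \<longlonglongrightarrow> C * 0 * N i f"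
      using \<theta> by (intro tendsto_intros LIMSEQ_realpow_zero) auto
    then show "(\<lambda>m. C * \<theta> ^ m * N i f) \<longlonglongrightarrow> 0" by simp
  qed (use fB in auto)
  ultimately have "g - L u g = f"
    by (rule conv_unique[OF i3 _ _ always_eventually[OF allI[OF B_diff[OF i3 XB LX]]] B_diff[OF i3 g(1) Lg] fB(1)]) simp
  moreover have "mass g = 0"
  proof -
    have "(\<lambda>m. mass (X m)) \<longlonglongrightarrow> mass g"
      by (rule conv_eval[OF g(2) i3 always_eventually[OF allI[OF XB]] g(1) CT_const])
    moreover have "mass (X m) = 0" for m by (simp add: X_def sum_distr_apply Lpow_mass fB)
    ultimately show ?thesis by (simp add: LIMSEQ_const_iff)
  qed
  ultimately show ?thesis using g VV_I[of i g] i by auto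
qed

lemma L_fixed_VV:
  assumes u: "u \<in> I" and d: "d \<in> VV B" "L u d = d"
  shows "d = 0"
proof -
  obtain C where C: "\<And>n. N 1 (Lpow u n d) \<le> C * \<theta> ^ n * N 1 d"
    using Lpow_decay u d by (metis IntI VV_iff atLeastAtMost_iff one_le_numeral order_refl)
  have "Lpow u n d = d" for n by (induction n) (simp_all add: d)
  with C have "N 1 d \<le> C * \<theta> ^ n * N 1 d" for n by simp
  moreover have "(\<lambda>n. C * \<theta> ^ n * N 1 d) \<longlonglongrightarrow> C * 0 * N 1 d"
    using \<theta> by (intro tendsto_intros LIMSEQ_realpow_zero) auto
  ultimately have "N 1 d \<le> 0" using LIMSEQ_le_const by fastforce
  then show ?thesis using N_nonneg[of 1 d] N_eq_0[of 1 d] d by (auto simp: VV_iff)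
qed

lemma VV_diff: "g \<in> VV B \<Longrightarrow> h \<in> VV B \<Longrightarrow> g - h \<in> VV B"
  by (auto simp: VV_iff intro: B_diff)
lemma VV_add: "g \<in> VV B \<Longrightarrow> h \<in> VV B \<Longrightarrow> g + h \<in> VV B"
  by (auto simp: VV_iff intro: B_add)
lemma VV_scale: "h \<in> VV B \<Longrightarrow> dscale c h \<in> VV B"
  by (auto simp: VV_iff intro: B_scale)

text \<open>Uniqueness among zero average elements of \<open>B 1\<close>: the difference of two solutions is fixed by \<open>L u\<close>, so it is
zero by contraction. All identities for \<open>R u\<close> below are obtained by this rule.\<close>
lemma R_eqI:
  assumes u: "u \<in> I" and g: "g \<in> VV B" "g - L u g = f"
  shows "R u f = g"
  unfolding resolvent_def
proof (rule the_equality)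
  show "g \<in> VV B \<and> g - L u g = f" using g by blast
  fix g' assume g': "g' \<in> VV B \<and> g' - L u g' = f"
  have "L u (g' - g) = g' - g"
    unfolding transfer_op_diff
  proof
    fix \<phi>
    have "g \<phi> - L u g \<phi> = f \<phi>" using g(2) by auto
    moreover have "g' \<phi> - L u g' \<phi> = f \<phi>" using g' by auto
    ultimately show "(L u g' - L u g) \<phi> = (g' - g) \<phi>" by simp
  qed
  then have "g' - g = 0" using L_fixed_VV[OF u] VV_diff g g' by blast
  then show "g' = g" by simp
qed

lemma R_in:
  assumes "u \<in> I" "1 \<le> i" "i \<le> 3" "f \<in> B i" "mass f = 0"
  shows "R u f \<in> VV B" "R u f \<in> B i" "R u f - L u (R u f) = f"
proof -
  obtain g where g: "g \<in> VV B" "g \<in> B i" "g - L u g = f"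
    using resolvent_exists[OF assms(1) _ VV_I[OF assms(2-5)]] assms by auto
  then show "R u f \<in> VV B" "R u f \<in> B i" "R u f - L u (R u f) = f"
    using R_eqI[OF assms(1) g(1,3)] by auto
qed

lemma R_VV:
  assumes "u \<in> I" "f \<in> VV B"
  shows "R u f \<in> VV B" "R u f - L u (R u f) = f"
  using R_in[OF assms(1), of 1 f] assms(2) by (auto simp: VV_iff)

lemma R_add:
  assumes "u \<in> I" "f \<in> VV B" "g \<in> VV B"
  shows "R u (f + g) = R u f + R u g"
proof (rule R_eqI[OF assms(1) VV_add])
  have "R u f + R u g - L u (R u f + R u g) = (R u f - L u (R u f)) + (R u g - L u (R u g))"
    by (simp add: transfer_op_add)
  then show "R u f + R u g - L u (R u f + R u g) = f + g" by (simp only: R_VV[OF assms(1)] assms)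
qed (use R_VV assms in auto)

lemma R_scale:
  assumes "u \<in> I" "f \<in> VV B"
  shows "R u (dscale c f) = dscale c (R u f)"
proof (rule R_eqI[OF assms(1) VV_scale])
  have "dscale c (R u f) - L u (dscale c (R u f)) = dscale c (R u f - L u (R u f))"
    by (simp add: transfer_op_dscale dscale_diff)
  then show "dscale c (R u f) - L u (dscale c (R u f)) = dscale c f" by (simp only: R_VV[OF assms])
qed (use R_VV assms in auto)

lemma R_minus:
  assumes "u \<in> I" "f \<in> VV B"
  shows "R u (- f) = - R u f"
  using R_scale[OF assms, of "-1"] by (simp add: dscale_minus1)

lemma VV_0: "0 \<in> VV B"
  by (simp add: VV_iff B_zero)

lemma VV_sum: "(\<And>k. k \<in> A \<Longrightarrow> f k \<in> VV B) \<Longrightarrow> (\<Sum>k\<in>A. f k) \<in> VV B"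
  by (induction A rule: infinite_finite_induct) (auto intro: VV_0 VV_add)

lemma R_0: "u \<in> I \<Longrightarrow> R u 0 = 0"
  using R_scale[OF _ VV_0, of u 0] by (simp add: dscale_def zero_fun_def)

lemma R_sum:
  assumes "u \<in> I" "finite A" "\<And>k. k \<in> A \<Longrightarrow> f k \<in> VV B"
  shows "R u (\<Sum>k\<in>A. f k) = (\<Sum>k\<in>A. R u (f k))"
  using assms(2,3)
proof (induction A rule: finite_induct)
  case (insert k A)
  have IH: "R u (\<Sum>k\<in>A. f k) = (\<Sum>k\<in>A. R u (f k))" by (rule insert.IH) (use insert.prems in auto)
  have "R u (f k + (\<Sum>k\<in>A. f k)) = R u (f k) + R u (\<Sum>k\<in>A. f k)"
    by (rule R_add[OF assms(1)]) (use insert.prems in \<open>auto intro: VV_sum\<close>)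
  then show "R u (\<Sum>k\<in>insert k A. f k) = (\<Sum>k\<in>insert k A. R u (f k))"
    unfolding sum.insert[OF insert.hyps] IH .
qed (simp add: R_0[OF assms(1)])

lemma R_partial_sum:
  assumes "u \<in> I" "f \<in> VV B"
  shows "R u f - Lpow u m (R u f) = (\<Sum>n<m. Lpow u n f)"
proof (induction m)
  case (Suc m)
  have "Lpow u m (R u f) - Lpow u (Suc m) (R u f) = Lpow u m (R u f - L u (R u f))"
    by (simp add: Lpow_diff funpow_swap1)
  also have "\<dots> = Lpow u m f" by (simp only: R_VV(2)[OF assms])
  finally have "R u f - Lpow u (Suc m) (R u f) = (R u f - Lpow u m (R u f)) + Lpow u m f"
    by (simp add: algebra_simps)
  also have "\<dots> = (\<Sum>n<m. Lpow u n f) + Lpow u m f" by (simp only: Suc.IH)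
  finally show "R u f - Lpow u (Suc m) (R u f) = (\<Sum>n<Suc m. Lpow u n f)"
    by (simp only: sum.lessThan_Suc)
qed simp

text \<open>The bound is uniform in the parameter because the constants of the contraction are.\<close>
lemma R_bound: "\<exists>C\<ge>0. \<forall>i\<in>{1..3}. \<forall>u\<in>I. \<forall>f\<in>VV B \<inter> B i. N i (R u f) \<le> C * N i f"
proof -
  obtain C where C: "C \<ge> 1" "\<And>i u n h. i \<in> {1..3} \<Longrightarrow> u \<in> I \<Longrightarrow> h \<in> VV B \<inter> B i \<Longrightarrow> N i (Lpow u n h) \<le> C * \<theta> ^ n * N i h"
    using Lpow_decay by blast
  have "N i (R u f) \<le> C / (1 - \<theta>) * N i f" if i: "i \<in> {1..3}" and u: "u \<in> I" and f: "f \<in> VV B \<inter> B i" for i u f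
  proof -
    have i3: "i \<le> 3" "1 \<le> i" using i by auto
    have fB: "f \<in> B i" "f \<in> VV B" "mass f = 0" using f by (auto simp: VV_iff)
    have Rf: "R u f \<in> VV B \<inter> B i" using R_in[OF u i3(2,1) fB(1,3)] by auto
    have "N i (R u f) \<le> C / (1 - \<theta>) * N i f + C * \<theta> ^ m * N i (R u f)" for m
    proof -
      have "N i (\<Sum>n<m. Lpow u n f) \<le> (\<Sum>n<m. N i (Lpow u n f))"
        by (intro N_sum i3 Lpow_B u fB)
      also have "\<dots> \<le> (\<Sum>n<m. C * N i f * \<theta> ^ n)"
        using C(2)[OF i u f] by (intro sum_mono) (simp add: mult_ac)
      also have "\<dots> = C * N i f * (\<Sum>n<m. \<theta> ^ n)" by (simp add: sum_distrib_left)
      also have "\<dots> \<le> C * N i f * (1 / (1 - \<theta>))"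
      proof (intro mult_left_mono)
        have "(\<Sum>n<m. \<theta> ^ n) = (1 - \<theta> ^ m) / (1 - \<theta>)" using \<theta> by (simp add: sum_gp_strict)
        also have "\<dots> \<le> 1 / (1 - \<theta>)" using \<theta> by (intro divide_right_mono) auto
        finally show "(\<Sum>n<m. \<theta> ^ n) \<le> 1 / (1 - \<theta>)" .
        show "0 \<le> C * N i f" using C(1) N_nonneg[OF i3(1) fB(1)] by simp
      qed
      finally have "N i (R u f - Lpow u m (R u f)) \<le> C / (1 - \<theta>) * N i f"
        by (simp add: R_partial_sum[OF u fB(2)] mult_ac)
      moreover have "N i (R u f) \<le> N i (R u f - Lpow u m (R u f)) + N i (Lpow u m (R u f))"
        using Rf by (intro N_le_add_diff i3 Lpow_B u) auto
      ultimately show ?thesis using C(2)[OF i u Rf, of m] by linarith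
    qed
    moreover have "(\<lambda>m. C / (1 - \<theta>) * N i f + C * \<theta> ^ m * N i (R u f)) \<longlonglongrightarrow> C / (1 - \<theta>) * N i f + C * 0 * N i (R u f)"
      using \<theta> by (intro tendsto_intros LIMSEQ_realpow_zero) auto
    ultimately show ?thesis using LIMSEQ_le_const by fastforce
  qed
  moreover have "0 \<le> C / (1 - \<theta>)" using C(1) \<theta> by simp
  ultimately show ?thesis by blast
qed

section \<open>The invariant probability distribution\<close>

text \<open>Lebesgue measure.\<close>
definition one :: "'d distr" where "one = emb r (\<lambda>_. 1)"

lemma one_B: "i \<le> 3 \<Longrightarrow> one \<in> B i"
  unfolding one_def by (rule B_le[of i 3]) (auto intro: CT_B3 CT_const)

lemma one_mass: "mass one = 1"
proof -
  have "(0 :: real ^ 'd) \<in> cbox 0 1" by (simp add: mem_box_cart)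
  then have ne: "cbox 0 (1 :: real ^ 'd) \<noteq> {}" by blast
  have "(LINT x:cbox 0 (1 :: real ^ 'd)|lborel. (1::real)) = measure lborel (cbox 0 (1 :: real ^ 'd))"
    by (simp add: set_lebesgue_integral_def)
  also have "\<dots> = 1"
    using content_cbox_cart[OF ne] by simp
  finally show ?thesis by (simp add: one_def emb_def CT_const)
qed

lemma one_nonneg: "nonneg r one"
  unfolding nonneg_def one_def emb_def
  by (auto simp: set_lebesgue_integral_def indicator_def intro!: integral_nonneg_AE)

text \<open>Here \<open>\<phi>\<close> composed with \<open>drift u\<close> is again a nonnegative test function.\<close>
lemma L_nonneg: "h \<in> dual r \<Longrightarrow> nonneg r h \<Longrightarrow> nonneg r (L u h)"
  unfolding nonneg_def
  using CT_compose[OF _ drift_torus_maps[of u]] by (auto simp: transfer_op_def o_def)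

text \<open>The invariant probability distribution of \<open>drift u\<close>, as a correction of Lebesgue measure. This formula makes its
membership in \<open>B 3\<close> and the bound on its norm immediate.\<close>
definition stat :: "real \<Rightarrow> 'd distr"
  where "stat u = one + R u (L u one - one)"

lemma stat_aux: "u \<in> I \<Longrightarrow> 1 \<le> i \<Longrightarrow> i \<le> 3 \<Longrightarrow> L u one - one \<in> B i \<and> mass (L u one - one) = 0"
  by (auto intro: B_diff L_B one_B simp: L_mass one_mass)

lemma stat_B: assumes "u \<in> I" "i \<le> 3" shows "stat u \<in> B i"
proof -
  have "stat u \<in> B 3"
    unfolding stat_def using stat_aux[OF assms(1), of 3] by (intro B_add one_B R_in[OF assms(1)]) auto
  then show ?thesis using B_le[of i 3] assms by auto
qed

lemma stat_mass: assumes "u \<in> I" shows "mass (stat u) = 1"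
  using R_in(1)[OF assms, of 1] stat_aux[OF assms, of 1] by (simp add: stat_def one_mass VV_iff)

lemma stat_fixed: assumes "u \<in> I" shows "L u (stat u) = stat u"
proof -
  define g where "g = R u (L u one - one)"
  have eq: "g - L u g = L u one - one"
    unfolding g_def using stat_aux[OF assms, of 1] by (intro R_in[OF assms, of 1]) auto
  show ?thesis
    unfolding stat_def g_def[symmetric] transfer_op_add
  proof
    fix \<phi>
    show "(L u one + L u g) \<phi> = (one + g) \<phi>" using fun_cong[OF eq, of \<phi>] by simp
  qed
qed

lemma stat_unique:
  assumes "u \<in> I" "q \<in> B 1" "mass q = 1" "L u q = q"
  shows "q = stat u"
proof -
  have "q - stat u \<in> VV B" using assms stat_B[OF assms(1)] stat_mass[OF assms(1)] by (auto simp: VV_iff intro: B_diff)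
  moreover have "L u (q - stat u) = q - stat u" by (simp add: transfer_op_diff assms stat_fixed)
  ultimately have "q - stat u = 0" by (rule L_fixed_VV[OF assms(1)])
  then show ?thesis by simp
qed

text \<open>The invariant distribution is the limit of the iterates of Lebesgue measure, which are nonnegative.\<close>
lemma stat_nonneg: assumes u: "u \<in> I" shows "nonneg r (stat u)"
  unfolding nonneg_def
proof (intro ballI impI)
  fix \<phi> :: "real ^ 'd \<Rightarrow> real" assume \<phi>: "\<phi> \<in> CT r" "\<forall>x. 0 \<le> \<phi> x"
  have pos: "nonneg r (Lpow u n one) \<and> Lpow u n one \<in> B 3" for n
    by (induction n) (auto intro: one_nonneg one_B L_nonneg B_dual[of 3] L_B u)
  define d where "d = one - stat u"
  have "one - stat u \<in> B 1" by (intro B_diff one_B stat_B u) auto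
  then have d: "d \<in> VV B \<inter> B 1" using stat_mass[OF u] by (simp add: d_def VV_iff one_mass)
  obtain C where C: "\<And>n. N 1 (Lpow u n d) \<le> C * \<theta> ^ n * N 1 d"
    using Lpow_decay u d by (metis atLeastAtMost_iff one_le_numeral order_refl)
  have eq: "Lpow u n one - stat u = Lpow u n d" for n
  proof -
    have "Lpow u n (stat u) = stat u" by (induction n) (simp_all add: stat_fixed[OF u])
    then show ?thesis by (simp add: d_def Lpow_diff)
  qed
  have LB: "Lpow u n one \<in> B 1" for n by (intro Lpow_B u one_B) auto
  have pB: "stat u \<in> B 1" by (rule stat_B[OF u]) simp
  have "conv 1 (\<lambda>n. Lpow u n one) (stat u) sequentially"
  proof (rule conv_bound)
    show "\<forall>\<^sub>F n in sequentially. N 1 (Lpow u n one - stat u) \<le> C * \<theta> ^ n * N 1 d" using C eq by simp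
    have "(\<lambda>m. C * \<theta> ^ m * N 1 d) \<longlonglongrightarrow> C * 0 * N 1 d"
      using \<theta> by (intro tendsto_intros LIMSEQ_realpow_zero) auto
    then show "(\<lambda>m. C * \<theta> ^ m * N 1 d) \<longlonglongrightarrow> 0" by simp
  qed (use LB pB in auto)
  then have "(\<lambda>n. Lpow u n one \<phi>) \<longlonglongrightarrow> stat u \<phi>"
    by (rule conv_eval) (use LB pB \<phi> in auto)
  moreover have "0 \<le> Lpow u n one \<phi>" for n using pos \<phi> unfolding nonneg_def by blast
  ultimately show "0 \<le> stat u \<phi>" by (auto intro: LIMSEQ_le_const)
qed

lemma stat_bound: "\<exists>K0>0. \<forall>u\<in>I. N 1 (stat u) \<le> K0"
proof -
  obtain C where C: "C \<ge> 0" "\<And>u f. u \<in> I \<Longrightarrow> f \<in> VV B \<inter> B 1 \<Longrightarrow> N 1 (R u f) \<le> C * N 1 f"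
    using R_bound by (metis atLeastAtMost_iff one_le_numeral order_refl)
  have nn: "0 \<le> N 1 one" by (intro N_nonneg one_B) auto
  have "N 1 (stat u) \<le> 1 + N 1 one + C * ((Cs + K) * N 1 one + N 1 one)" if u: "u \<in> I" for u
  proof -
    have aux: "L u one - one \<in> VV B \<inter> B 1" using stat_aux[OF u, of 1] by (auto simp: VV_iff)
    have "N 1 (stat u) \<le> N 1 one + N 1 (R u (L u one - one))"
      unfolding stat_def using stat_aux[OF u, of 1] by (intro N_triangle one_B R_in[OF u]) auto
    also have "N 1 (R u (L u one - one)) \<le> C * N 1 (L u one - one)" by (rule C(2)[OF u aux])
    also have "\<dots> \<le> C * (N 1 (L u one) + N 1 one)"
      using C(1) by (intro mult_left_mono N_diff_le L_B u one_B) auto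
    also have "\<dots> \<le> C * ((Cs + K) * N 1 one + N 1 one)"
      using C(1) by (intro mult_left_mono add_right_mono L_bound[OF u] one_B) auto
    finally show ?thesis by simp
  qed
  moreover have "0 < 1 + N 1 one + C * ((Cs + K) * N 1 one + N 1 one)"
    using nn C(1) Cs_ge_1 K_ge_1 by (intro add_pos_nonneg mult_nonneg_nonneg add_nonneg_nonneg) auto
  ultimately show ?thesis by blast
qed

end

section \<open>Dependence of the invariant distribution on the parameter\<close>

context mean_field_setting
begin

text \<open>The derivative of \<open>stat\<close>, that is, the linear response; see \<open>stat_derivative\<close>.\<close>
definition resp :: "real \<Rightarrow> 'd distr"
  where "resp u = R u (vel u (stat u))"

lemma vel_VV: "u \<in> I \<Longrightarrow> h \<in> B 2 \<Longrightarrow> vel u h \<in> VV B"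
  using vel_B[of u 1 h] vel_mass[of u h] B_le[of 1 2 h] by (simp add: VV_iff numeral_2_eq_2)

lemma resp_B2:
  assumes "u \<in> I" shows "resp u \<in> B 2" "resp u \<in> VV B"
proof -
  have "vel u (stat u) \<in> B 2" using vel_B[OF assms, of 2 "stat u"] stat_B[OF assms, of 3] by (simp add: numeral_3_eq_3 numeral_2_eq_2)
  moreover have "mass (vel u (stat u)) = 0" using stat_B[OF assms, of 1] by (intro vel_mass assms) auto
  ultimately show "resp u \<in> B 2" "resp u \<in> VV B" unfolding resp_def using R_in[OF assms, of 2] by auto
qed

text \<open>The perturbation formula on which all regularity of \<open>stat\<close> rests.\<close>
lemma stat_difference:
  assumes "s \<in> I" "s' \<in> I"
  shows "stat s' - stat s = R s' (L s' (stat s) - L s (stat s))"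
proof (rule R_eqI[symmetric])
  have "stat s' - stat s \<in> B 1" by (intro B_diff stat_B assms) auto
  then show "stat s' - stat s \<in> VV B" using stat_mass assms by (simp add: VV_iff)
  show "stat s' - stat s - L s' (stat s' - stat s) = L s' (stat s) - L s (stat s)"
    unfolding transfer_op_diff stat_fixed[OF assms(2)] stat_fixed[OF assms(1)]
    by (rule ext) simp
qed fact

lemma R_unif_bound:
  assumes "i \<in> {1..3}"
  obtains C where "C \<ge> 0" "\<And>u f. u \<in> I \<Longrightarrow> f \<in> B i \<Longrightarrow> mass f = 0 \<Longrightarrow> N i (R u f) \<le> C * N i f"
proof -
  obtain C where C: "C \<ge> 0" "\<And>u f. u \<in> I \<Longrightarrow> f \<in> VV B \<inter> B i \<Longrightarrow> N i (R u f) \<le> C * N i f"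
    using R_bound assms by blast
  show thesis
    by (rule that[OF C(1)], rule C(2)) (use VV_I[of i] assms in auto)
qed

lemma stat_continuous:
  assumes s: "s \<in> I"
  shows "conv 2 stat (stat s) (at s within I)"
proof -
  obtain C where C: "C \<ge> 0" "\<And>u f. u \<in> I \<Longrightarrow> f \<in> B 2 \<Longrightarrow> mass f = 0 \<Longrightarrow> N 2 (R u f) \<le> C * N 2 f"
    using R_unif_bound[of 2] by auto
  have p3: "stat s \<in> B (Suc 2)" using stat_B[OF s, of 3] by (simp add: numeral_3_eq_3 numeral_2_eq_2)
  show ?thesis
  proof (rule conv_bound)
    show "\<forall>\<^sub>F u in at s within I. N 2 (stat u - stat s) \<le> C * N 2 (L u (stat s) - L s (stat s))"
    proof (rule eventually_within_I)
      fix u assume u: "u \<in> I"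
      have "L u (stat s) - L s (stat s) \<in> B 2" by (intro B_diff L_B stat_B s u) auto
      then show "N 2 (stat u - stat s) \<le> C * N 2 (L u (stat s) - L s (stat s))"
        unfolding stat_difference[OF s u] by (intro C(2) u) (simp_all add: L_mass)
    qed
    show "((\<lambda>u. C * N 2 (L u (stat s) - L s (stat s))) \<longlongrightarrow> 0) (at s within I)"
      by (rule tendsto_mult_right_zero[OF L_continuous[OF _ p3 s]]) simp
  qed (auto intro!: eventually_within_I stat_B s)
qed

text \<open>The limit has to be one space better than the convergence: the difference of the resolvents at \<open>u\<close> and \<open>s\<close>
is \<open>R u (L u x - L s x)\<close> with \<open>x = R s g\<close>, and \<open>L_continuous\<close> loses one space.\<close>
lemma R_continuous:
  assumes s: "s \<in> I" and f: "\<And>u. u \<in> I \<Longrightarrow> f u \<in> VV B" and g: "g \<in> B 2" "mass g = 0"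
    and c: "conv 1 f g (at s within I)"
  shows "conv 1 (\<lambda>u. R u (f u)) (R s g) (at s within I)"
proof -
  obtain C where C: "C \<ge> 0" "\<And>u f. u \<in> I \<Longrightarrow> f \<in> B 1 \<Longrightarrow> mass f = 0 \<Longrightarrow> N 1 (R u f) \<le> C * N 1 f"
    using R_unif_bound[of 1] by auto
  have g1: "g \<in> B 1" "g \<in> VV B" using B_le[of 1 2 g] g by (auto simp: VV_iff)
  define x where "x = R s g"
  have x: "x \<in> B 2" "x \<in> VV B" "x - L s x = g" using R_in[OF s, of 2 g] g by (auto simp: x_def)
  have x1: "x \<in> B 1" using x by (simp add: VV_iff)
  have diff: "R u g - x = R u (L u x - L s x)" if u: "u \<in> I" for u
  proof (rule R_eqI[OF u, symmetric])
    show "R u g - x \<in> VV B" by (intro VV_diff R_VV u g1 x)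
    show "R u g - x - L u (R u g - x) = L u x - L s x"
    proof
      fix \<phi>
      have "R u g \<phi> - L u (R u g) \<phi> = g \<phi>" using fun_cong[OF R_VV(2)[OF u g1(2)], of \<phi>] by simp
      moreover have "x \<phi> - L s x \<phi> = g \<phi>" using fun_cong[OF x(3), of \<phi>] by simp
      ultimately show "(R u g - x - L u (R u g - x)) \<phi> = (L u x - L s x) \<phi>"
        unfolding transfer_op_diff by simp
    qed
  qed
  show ?thesis
    unfolding x_def[symmetric]
  proof (rule conv_bound)
    show "\<forall>\<^sub>F u in at s within I. N 1 (R u (f u) - x) \<le> C * N 1 (f u - g) + C * N 1 (L u x - L s x)"
    proof (rule eventually_within_I)
      fix u assume u: "u \<in> I"
      have fg: "f u - g \<in> B 1" "mass (f u - g) = 0" "f u \<in> B 1"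
        using f[OF u] g1 by (auto simp: VV_iff intro: B_diff)
      have Lx: "L u x - L s x \<in> B 1" "mass (L u x - L s x) = 0"
        using B_diff[OF _ L_B[OF u _ x1] L_B[OF s _ x1]] by (auto simp: L_mass)
      have d: "R u (f u) - R u g = R u (f u - g)"
        using R_add[OF u f[OF u], of "- g"] R_minus[OF u g1(2)] VV_scale[OF g1(2), of "-1"] by (simp add: dscale_minus1)
      have "R u (f u) - x = (R u (f u) - R u g) + (R u g - x)" by simp
      then have eq: "R u (f u) - x = R u (f u - g) + R u (L u x - L s x)"
        unfolding d diff[OF u] .
      have "N 1 (R u (f u) - x) \<le> N 1 (R u (f u - g)) + N 1 (R u (L u x - L s x))"
        unfolding eq by (intro N_triangle R_in(2)[OF u] fg Lx) auto
      also have "\<dots> \<le> C * N 1 (f u - g) + C * N 1 (L u x - L s x)"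
        by (intro add_mono C(2) u fg Lx)
      finally show "N 1 (R u (f u) - x) \<le> C * N 1 (f u - g) + C * N 1 (L u x - L s x)" .
    qed
    have "conv 1 (\<lambda>u. L u x) (L s x) (at s within I)"
      using x(1) by (intro L_continuous s) (auto simp: numeral_2_eq_2)
    then show "((\<lambda>u. C * N 1 (f u - g) + C * N 1 (L u x - L s x)) \<longlongrightarrow> 0) (at s within I)"
      using c by (intro tendsto_add_zero tendsto_mult_right_zero)
    show "\<forall>\<^sub>F u in at s within I. R u (f u) \<in> B 1"
      by (rule eventually_within_I) (use R_VV(1) f in \<open>auto simp: VV_iff\<close>)
  qed (use x1 in auto)
qed

lemma stat_derivative:
  assumes s: "s \<in> I"
  shows "conv 1 (\<lambda>s'. dscale (1 / (s' - s)) (stat s' - stat s)) (resp s) (at s within I)"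
proof -
  define q where "q s' = dscale (1 / (s' - s)) (L s' (stat s) - L s (stat s))" for s'
  have VV: "L s' (stat s) - L s (stat s) \<in> VV B" if "s' \<in> I" for s'
    using B_diff[OF _ L_B[OF that _ stat_B[OF s]] L_B[OF s _ stat_B[OF s]], of 1] by (simp add: VV_iff L_mass)
  have v2: "vel s (stat s) \<in> B 2" using vel_B[OF s, of 2 "stat s"] stat_B[OF s, of 3] by (simp add: numeral_3_eq_3 numeral_2_eq_2)
  have "conv 1 (\<lambda>u. R u (q u)) (R s (vel s (stat s))) (at s within I)"
  proof (rule R_continuous[OF s])
    show "q u \<in> VV B" if "u \<in> I" for u unfolding q_def by (rule VV_scale[OF VV[OF that]])
    show "vel s (stat s) \<in> B 2" by fact
    show "mass (vel s (stat s)) = 0" by (rule vel_mass[OF s stat_B[OF s]]) simp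
    show "conv 1 q (vel s (stat s)) (at s within I)"
      unfolding q_def[abs_def] using stat_B[OF s, of 3] by (intro L_derivative s) (auto simp: numeral_3_eq_3)
  qed
  moreover have "R u (q u) = dscale (1 / (u - s)) (stat u - stat s)" if "u \<in> I" for u
    unfolding q_def stat_difference[OF s that] by (rule R_scale[OF that VV[OF that]])
  then have "\<forall>\<^sub>F u in at s within I. N 1 (R u (q u) - resp s) = N 1 (dscale (1 / (u - s)) (stat u - stat s) - resp s)"
    by (intro eventually_within_I) simp
  ultimately show ?thesis
    unfolding resp_def[of s, symmetric] by (rule Lim_transform_eventually)
qed

lemma vel_diff:
  assumes "u \<in> I" "g \<in> B 1" "h \<in> B 1"
  shows "vel u (g - h) = vel u g - vel u h"
proof
  fix \<phi>
  have "dpartial r k (L u (b k (g - h))) = dpartial r k (L u (b k g)) - dpartial r k (L u (b k h))" for k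
    unfolding mult_diff transfer_op_diff
    by (rule bdd_op_diff[OF dpartial_op[of 0, simplified]]) (use L_B[OF assms(1)] b_B assms in auto)
  then show "vel u (g - h) \<phi> = (vel u g - vel u h) \<phi>"
    by (simp add: vel_def sum_distr_apply sum_subtractf)
qed

lemma resp_continuous:
  assumes s: "s \<in> I"
  shows "conv 1 resp (resp s) (at s within I)"
  unfolding resp_def
proof (rule R_continuous[OF s])
  have le: "stat u \<in> B 3" "stat u \<in> B 2" "stat u \<in> B 1" if "u \<in> I" for u using stat_B[OF that] by auto
  show "vel u (stat u) \<in> VV B" if "u \<in> I" for u by (rule vel_VV[OF that le(2)[OF that]])
  show "vel s (stat s) \<in> B 2" using vel_B[OF s, of 2 "stat s"] le(1)[OF s] by (simp add: numeral_3_eq_3 numeral_2_eq_2)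
  show "mass (vel s (stat s)) = 0" by (rule vel_mass[OF s le(3)[OF s]])
  obtain C where C: "C \<ge> 0" "\<And>u h. u \<in> I \<Longrightarrow> h \<in> B 2 \<Longrightarrow> N 1 (vel u h) \<le> C * N 2 h"
    using vel_bound[of 1] by (auto simp: numeral_2_eq_2)
  have v1: "vel u h \<in> B 1" if "u \<in> I" "h \<in> B 2" for u h
    using vel_VV[OF that] by (simp add: VV_iff)
  show "conv 1 (\<lambda>u. vel u (stat u)) (vel s (stat s)) (at s within I)"
  proof (rule conv_bound)
    show "\<forall>\<^sub>F u in at s within I. N 1 (vel u (stat u) - vel s (stat s)) \<le> C * N 2 (stat u - stat s) + N 1 (vel u (stat s) - vel s (stat s))"
    proof (rule eventually_within_I)
      fix u assume u: "u \<in> I"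
      have d2: "stat u - stat s \<in> B 2" by (intro B_diff le u s) auto
      have eq: "vel u (stat u) - vel s (stat s) = vel u (stat u - stat s) + (vel u (stat s) - vel s (stat s))"
        unfolding vel_diff[OF u le(3)[OF u] le(3)[OF s]] by simp
      have "N 1 (vel u (stat u) - vel s (stat s)) \<le> N 1 (vel u (stat u - stat s)) + N 1 (vel u (stat s) - vel s (stat s))"
        unfolding eq by (intro N_triangle v1[OF u d2] B_diff v1 u s le) simp_all
      then show "N 1 (vel u (stat u) - vel s (stat s)) \<le> C * N 2 (stat u - stat s) + N 1 (vel u (stat s) - vel s (stat s))"
        using C(2)[OF u d2] by linarith
    qed
    have "conv 1 (\<lambda>u. vel u (stat s)) (vel s (stat s)) (at s within I)"
      using le(1)[OF s] by (intro vel_continuous s) (auto simp: numeral_3_eq_3)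
    then show "((\<lambda>u. C * N 2 (stat u - stat s) + N 1 (vel u (stat s) - vel s (stat s))) \<longlongrightarrow> 0) (at s within I)"
      by (intro tendsto_add_zero tendsto_mult_right_zero stat_continuous s)
    show "\<forall>\<^sub>F u in at s within I. vel u (stat u) \<in> B 1"
      by (rule eventually_within_I) (rule v1[OF _ le(2)])
    show "vel s (stat s) \<in> B 1" by (rule v1[OF s le(2)[OF s]])
  qed simp
qed

text \<open>For elements of the ball of \<open>B 1\<close> the decay in \<open>B 1\<close> gives the decay in \<open>B 0\<close>, and the latter is
stable under limits in \<open>B 0\<close> since the iterates are uniformly bounded there. Approximants from the ball need not have zero
average, so a small multiple of Lebesgue measure is subtracted from them.\<close>
lemma ball_closure_Lpow_decay:
  "\<exists>C\<ge>0. \<forall>u\<in>I. \<forall>n M f. 0 \<le> M \<longrightarrow> f \<in> VV B \<longrightarrow> ball_closure 0 M f \<longrightarrow> N 0 (Lpow u n f) \<le> C * M * \<theta> ^ n"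
proof -
  obtain C where C: "C \<ge> 1" "\<And>u n h. u \<in> I \<Longrightarrow> h \<in> VV B \<Longrightarrow> N 1 (Lpow u n h) \<le> C * \<theta> ^ n * N 1 h"
  proof -
    obtain C where "C \<ge> 1" "\<forall>i\<in>{1..3}. \<forall>u\<in>I. \<forall>n. \<forall>h\<in>VV B \<inter> B i. N i (Lpow u n h) \<le> C * \<theta> ^ n * N i h"
      using Lpow_decay by blast
    then show thesis by (intro that[of C]) (auto simp: VV_iff)
  qed
  have "N 0 (Lpow u n f) \<le> C * M * \<theta> ^ n" if u: "u \<in> I" and M: "0 \<le> M" and f: "f \<in> VV B" "ball_closure 0 M f" for u n M f
  proof -
    have f1: "f \<in> B 1" "f \<in> B 0" "mass f = 0" using f B_le[of 0 1 f] by (auto simp: VV_iff)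
    have o: "one \<in> B 1" "one \<in> B 0" "0 \<le> N 0 one" "0 \<le> N 1 one" using one_B N_nonneg by auto
    define A where "A = Cs * (1 + Cs * N 0 one) + C * (Cs * N 1 one)"
    have A: "A \<ge> 0" using o C(1) Cs_ge_1 unfolding A_def by (intro add_nonneg_nonneg mult_nonneg_nonneg) auto
    have key: "N 0 (Lpow u n f) \<le> A * \<epsilon> + C * M * \<theta> ^ n" if \<epsilon>: "\<epsilon> > 0" for \<epsilon>
    proof -
      obtain g where g: "g \<in> B 1" "N 1 g \<le> M" "N 0 (f - g) < \<epsilon>"
        using f(2) \<epsilon> unfolding ball_closure_def by auto
      have g0: "g \<in> B 0" using B_le[of 0 1 g] g by auto
      define g' where "g' = g - dscale (mass g) one"
      have g': "g' \<in> B 1" "g' \<in> B 0" "g' \<in> VV B"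
        using B_diff[OF _ g(1) B_scale[OF _ o(1)]] B_diff[OF _ g0 B_scale[OF _ o(2)]] by (auto simp: g'_def VV_iff one_mass)
      have "\<bar>mass g\<bar> = \<bar>mass (f - g)\<bar>" using f1 by simp
      also have "\<dots> \<le> Cs * N 0 (f - g)" by (rule A3_mass[OF B_diff[OF _ f1(2) g0]]) simp
      also have "\<dots> \<le> Cs * \<epsilon>" using g(3) Cs_ge_1 by (intro mult_left_mono) auto
      finally have m: "\<bar>mass g\<bar> \<le> Cs * \<epsilon>" .
      have "N 1 g' \<le> N 1 g + N 1 (dscale (mass g) one)"
        unfolding g'_def using N_diff_le[OF _ g(1) B_scale[OF _ o(1)]] by simp
      also have "\<dots> = N 1 g + \<bar>mass g\<bar> * N 1 one" using N_scale[OF _ o(1)] by simp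
      also have "\<dots> \<le> M + Cs * \<epsilon> * N 1 one" using g(2) m o by (intro add_mono mult_right_mono) auto
      finally have N1: "N 1 g' \<le> M + Cs * \<epsilon> * N 1 one" .
      have eq: "f - g' = (f - g) + dscale (mass g) one" by (simp add: g'_def)
      have "N 0 (f - g') \<le> N 0 (f - g) + N 0 (dscale (mass g) one)"
        unfolding eq by (intro N_triangle B_diff B_scale f1 g0 o) simp_all
      also have "\<dots> = N 0 (f - g) + \<bar>mass g\<bar> * N 0 one" using N_scale[OF _ o(2)] by simp
      also have "\<dots> \<le> \<epsilon> + Cs * \<epsilon> * N 0 one" using g(3) m o by (intro add_mono mult_right_mono) auto
      finally have N0: "N 0 (f - g') \<le> \<epsilon> + Cs * \<epsilon> * N 0 one" .
      have LB: "Lpow u n f \<in> B 0" "Lpow u n g' \<in> B 0" "Lpow u n g' \<in> B 1" using Lpow_B[OF u] f1 g' by auto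
      have "N 0 (Lpow u n f) \<le> N 0 (Lpow u n f - Lpow u n g') + N 0 (Lpow u n g')"
        using N_le_add_diff[OF _ LB(1,2)] by simp
      also have "N 0 (Lpow u n f - Lpow u n g') \<le> Cs * N 0 (f - g')"
        unfolding Lpow_diff[symmetric] by (rule Lpow_weak[OF u B_diff[OF _ f1(1) g'(1)]]) simp
      also have "\<dots> \<le> Cs * (\<epsilon> + Cs * \<epsilon> * N 0 one)" using N0 Cs_ge_1 by (intro mult_left_mono) auto
      also have "N 0 (Lpow u n g') \<le> N 1 (Lpow u n g')" by (rule N_le[OF _ _ LB(3)]) auto
      also have "\<dots> \<le> C * \<theta> ^ n * N 1 g'" by (rule C(2)[OF u g'(3)])
      also have "\<dots> \<le> C * \<theta> ^ n * (M + Cs * \<epsilon> * N 1 one)" using N1 C(1) \<theta> by (intro mult_left_mono) auto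
      also have "C * \<theta> ^ n * (M + Cs * \<epsilon> * N 1 one) = C * M * \<theta> ^ n + C * \<theta> ^ n * (Cs * \<epsilon> * N 1 one)"
        by (simp add: algebra_simps)
      also have "C * \<theta> ^ n * (Cs * \<epsilon> * N 1 one) \<le> C * 1 * (Cs * \<epsilon> * N 1 one)"
        using C(1) \<theta> o Cs_ge_1 \<epsilon> power_le_one[of \<theta> n] by (intro mult_right_mono mult_left_mono mult_nonneg_nonneg) auto
      finally show ?thesis by (simp add: A_def algebra_simps)
    qed
    show ?thesis
    proof (rule field_le_epsilon)
      fix e :: real assume e: "e > 0"
      have "N 0 (Lpow u n f) \<le> A * (e / (A + 1)) + C * M * \<theta> ^ n" using A e by (intro key) auto
      moreover have "A * (e / (A + 1)) \<le> e" using A e by (simp add: field_simps)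
      ultimately show "N 0 (Lpow u n f) \<le> C * M * \<theta> ^ n + e" by linarith
    qed
  qed
  with C(1) show ?thesis by (intro exI[of _ C]) auto
qed

lemma R_apply_sums:
  assumes u: "u \<in> I" and f: "f \<in> VV B" and \<phi>: "\<phi> \<in> CT r"
  shows "(\<lambda>n. Lpow u n f \<phi>) sums R u f \<phi>"
proof -
  define x where "x = R u f"
  have x: "x \<in> VV B" "x \<in> B 1" using R_VV(1)[OF u f] by (auto simp: x_def VV_iff)
  obtain C where C: "\<And>n. N 1 (Lpow u n x) \<le> C * \<theta> ^ n * N 1 x"
    using Lpow_decay u x by (metis IntI atLeastAtMost_iff one_le_numeral order_refl)
  have Lx: "Lpow u n x \<in> B 1" for n by (rule Lpow_B[OF u _ x(2)]) simp
  have "conv 1 (\<lambda>n. Lpow u n x) 0 sequentially"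
  proof (rule conv_bound)
    show "\<forall>\<^sub>F n in sequentially. N 1 (Lpow u n x - 0) \<le> C * \<theta> ^ n * N 1 x" using C by simp
    have "(\<lambda>m. C * \<theta> ^ m * N 1 x) \<longlonglongrightarrow> C * 0 * N 1 x"
      using \<theta> by (intro tendsto_intros LIMSEQ_realpow_zero) auto
    then show "(\<lambda>m. C * \<theta> ^ m * N 1 x) \<longlonglongrightarrow> 0" by simp
  qed (use Lx B_zero in auto)
  then have "(\<lambda>n. Lpow u n x \<phi>) \<longlonglongrightarrow> 0 \<phi>"
    by (rule conv_eval) (use Lx B_zero \<phi> in auto)
  then have "(\<lambda>m. x \<phi> - Lpow u m x \<phi>) \<longlonglongrightarrow> x \<phi> - 0"
    by (intro tendsto_diff tendsto_const) simp
  moreover have "x \<phi> - Lpow u m x \<phi> = (\<Sum>n<m. Lpow u n f \<phi>)" for m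
    using fun_cong[OF R_partial_sum[OF u f, of m], of \<phi>] by (simp add: x_def sum_distr_apply)
  ultimately show ?thesis by (simp add: sums_def x_def)
qed

lemma L_jointly_continuous:
  assumes s: "s \<in> I" and f: "\<And>u. u \<in> I \<Longrightarrow> f u \<in> B 1" "g \<in> B 1" and c: "conv 0 f g (at s within I)"
  shows "conv 0 (\<lambda>u. L u (f u)) (L s g) (at s within I)"
proof (rule conv_bound)
  have le: "h \<in> B 0" if "h \<in> B 1" for h using B_le[of 0 1 h] that by simp
  show "\<forall>\<^sub>F u in at s within I. N 0 (L u (f u) - L s g) \<le> Cs * N 0 (f u - g) + N 0 (L u g - L s g)"
  proof (rule eventually_within_I)
    fix u assume u: "u \<in> I"
    have B0: "L u (f u) \<in> B 0" "L u g \<in> B 0" "L s g \<in> B 0" using L_B u s le f by auto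
    have "N 0 (L u (f u) - L s g) \<le> N 0 (L u (f u) - L u g) + N 0 (L u g - L s g)"
      using N_diff_triangle[OF _ B0] by simp
    also have "N 0 (L u (f u) - L u g) \<le> Cs * N 0 (f u - g)"
      using Lpow_weak[OF u, of "f u - g" 1] B_diff[OF _ f(1)[OF u] f(2)] by (simp add: transfer_op_diff)
    finally show "N 0 (L u (f u) - L s g) \<le> Cs * N 0 (f u - g) + N 0 (L u g - L s g)" by (simp only: add_le_cancel_right)
  qed
  have "conv 0 (\<lambda>u. L u g) (L s g) (at s within I)" using f by (intro L_continuous s) auto
  then show "((\<lambda>u. Cs * N 0 (f u - g) + N 0 (L u g - L s g)) \<longlongrightarrow> 0) (at s within I)"
    using c by (intro tendsto_add_zero tendsto_mult_right_zero)
  show "\<forall>\<^sub>F u in at s within I. L u (f u) \<in> B 0" by (rule eventually_within_I) (use L_B le f in auto)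
  show "L s g \<in> B 0" using L_B s le f by auto
qed simp

text \<open>Each term of the Neumann series is continuous in the norm of \<open>B 0\<close>, and the terms are dominated by a
geometric series uniformly in \<open>u\<close>.\<close>
lemma R_weakly_continuous:
  assumes s: "s \<in> I" and f: "\<And>u. u \<in> I \<Longrightarrow> f u \<in> VV B" "g \<in> VV B"
    and ball_closure: "\<And>u. u \<in> I \<Longrightarrow> u \<noteq> s \<Longrightarrow> ball_closure 0 M (f u)"
    and c: "conv 0 f g (at s within I)" and \<phi>: "\<phi> \<in> CT r"
  shows "((\<lambda>u. R u (f u) \<phi>) \<longlongrightarrow> R s g \<phi>) (at s within I)"
proof (cases "at s within I = bot")
  case False
  obtain C where C: "C \<ge> 0" "\<And>u n M f. u \<in> I \<Longrightarrow> 0 \<le> M \<Longrightarrow> f \<in> VV B \<Longrightarrow> ball_closure 0 M f \<Longrightarrow> N 0 (Lpow u n f) \<le> C * M * \<theta> ^ n"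
    using ball_closure_Lpow_decay by blast
  obtain D where D: "D \<ge> 0" "\<And>h. h \<in> B 0 \<Longrightarrow> \<bar>h \<phi>\<bar> \<le> D * N 0 h" using eval_bound[OF \<phi>] by blast
  define M' where "M' = max M 0"
  have B1: "f u \<in> B 1" "f u \<in> B 0" if "u \<in> I" for u using f(1)[OF that] B_le[of 0 1 "f u"] by (auto simp: VV_iff)
  have g1: "g \<in> B 1" using f(2) by (simp add: VV_iff)
  have ball_closure': "ball_closure 0 M' (f u)" if "u \<in> I" "u \<noteq> s" for u
    using ball_closure[OF that] unfolding ball_closure_def M'_def by (metis max.coboundedI1)
  have lim: "((\<lambda>u. Lpow u n (f u) \<phi>) \<longlongrightarrow> Lpow s n g \<phi>) (at s within I)" for n
  proof -
    have LB: "Lpow u n (f u) \<in> B 1" if "u \<in> I" for u n using Lpow_B[OF that _ B1(1)[OF that]] by simp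
    have Lg: "Lpow s n g \<in> B 1" for n using Lpow_B[OF s _ g1] by simp
    have "conv 0 (\<lambda>u. Lpow u n (f u)) (Lpow s n g) (at s within I)"
    proof (induction n)
      case 0 show "conv 0 (\<lambda>u. Lpow u 0 (f u)) (Lpow s 0 g) (at s within I)"
        unfolding funpow.simps id_apply by (rule c)
    next
      case (Suc n)
      have IH: "conv 0 (\<lambda>u. Lpow u n (f u)) (Lpow s n g) (at s within I)" by (rule Suc.IH)
      show "conv 0 (\<lambda>u. Lpow u (Suc n) (f u)) (Lpow s (Suc n) g) (at s within I)"
        unfolding funpow.simps o_apply by (rule L_jointly_continuous[OF s LB Lg IH])
    qed
    then show ?thesis
      by (rule conv_eval_within) (use LB Lg B_le[of 0 1] \<phi> in auto)
  qed
  have T: "(\<forall>\<^sub>F u in at s within I. summable (\<lambda>k. norm (Lpow u k (f u) \<phi>))) \<and>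
        summable (\<lambda>k. norm (Lpow s k g \<phi>)) \<and>
        ((\<lambda>u. \<Sum>k. Lpow u k (f u) \<phi>) \<longlongrightarrow> (\<Sum>k. Lpow s k g \<phi>)) (at s within I)"
    proof (rule tannerys_theorem[where M = "\<lambda>k. D * C * M' * \<theta> ^ k"])
      show "eventually (\<lambda>(k, u). norm (Lpow u k (f u) \<phi>) \<le> D * C * M' * \<theta> ^ k) (at_top \<times>\<^sub>F (at s within I))"
        unfolding eventually_prod_filter
      proof (intro exI conjI)
        show "\<forall>\<^sub>F k in at_top. (\<lambda>_. True) k" by simp
        show "\<forall>\<^sub>F u in at s within I. u \<in> I \<and> u \<noteq> s" by (rule eventually_within_I) simp
        show "\<forall>k u. True \<longrightarrow> u \<in> I \<and> u \<noteq> s \<longrightarrow> (case (k, u) of (k, u) \<Rightarrow> norm (Lpow u k (f u) \<phi>) \<le> D * C * M' * \<theta> ^ k)"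
        proof (intro allI impI)
          fix k u assume u: "u \<in> I \<and> u \<noteq> s"
          have "\<bar>Lpow u k (f u) \<phi>\<bar> \<le> D * N 0 (Lpow u k (f u))"
            using u by (intro D(2) Lpow_B B1) auto
          also have "\<dots> \<le> D * (C * M' * \<theta> ^ k)"
            using u D(1) by (intro mult_left_mono C(2) f ball_closure') (auto simp: M'_def)
          finally show "case (k, u) of (k, u) \<Rightarrow> norm (Lpow u k (f u) \<phi>) \<le> D * C * M' * \<theta> ^ k"
            by (simp add: mult_ac)
        qed
      qed
      show "summable (\<lambda>k. D * C * M' * \<theta> ^ k)" using \<theta> by (intro summable_mult summable_geometric) auto
    qed (use lim False in auto)
  have "(\<Sum>k. Lpow s k g \<phi>) = R s g \<phi>" using R_apply_sums[OF s f(2) \<phi>] by (simp add: sums_iff)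
  moreover have "\<forall>\<^sub>F u in at s within I. (\<Sum>k. Lpow u k (f u) \<phi>) = R u (f u) \<phi>"
    by (rule eventually_within_I) (use R_apply_sums[OF _ f(1) \<phi>] in \<open>simp add: sums_iff\<close>)
  ultimately show ?thesis using Lim_transform_eventually[OF conjunct2[OF conjunct2[OF T]]] by simp
qed simp

text \<open>The quotient is the resolvent at \<open>s'\<close> of the sum of the second order quotient of \<open>L s' (stat s)\<close> and
the first order quotient of \<open>L s' (resp s)\<close>.\<close>
lemma stat_second_order:
  assumes s: "s \<in> I" and \<phi>: "\<phi> \<in> CT r"
  defines "g \<equiv> dscale (1/2) (acc s (stat s)) + vel s (resp s)"
  shows "((\<lambda>s'. (stat s' \<phi> - stat s \<phi> - (s' - s) * resp s \<phi>) / (s' - s)\<^sup>2) \<longlongrightarrow> R s g \<phi>) (at s within I)"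
proof -
  have pB: "stat s \<in> B 3" "stat s \<in> B 2" "stat s \<in> B 1" using stat_B[OF s] by auto
  note wB = resp_B2[OF s]
  have w1: "resp s \<in> B 1" using wB by (simp add: VV_iff)
  define q2 where "q2 s' = dscale (1 / (s' - s)\<^sup>2) (L s' (stat s) - L s (stat s) - dscale (s' - s) (vel s (stat s)))" for s'
  define q1 where "q1 s' = dscale (1 / (s' - s)) (L s' (resp s) - L s (resp s))" for s'
  have dp: "L u h - L s h \<in> VV B" if "u \<in> I" "h \<in> B 1" for u h
    using B_diff[OF _ L_B[OF that(1) _ that(2)] L_B[OF s _ that(2)]] by (simp add: VV_iff L_mass)
  have vp: "vel s (stat s) \<in> VV B" by (rule vel_VV[OF s pB(2)])
  have vw: "vel s (resp s) \<in> VV B" by (rule vel_VV[OF s wB(1)])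
  have q2V: "q2 u \<in> VV B" if "u \<in> I" for u
    unfolding q2_def by (intro VV_scale VV_diff dp[OF that] pB vp)
  have q1V: "q1 u \<in> VV B" if "u \<in> I" for u
    unfolding q1_def by (intro VV_scale dp[OF that w1])
  have accV: "acc s (stat s) \<in> VV B"
    using acc_B[OF s, of 1 "stat s"] acc_mass[OF s pB(2)] pB(1) by (simp add: VV_iff numeral_3_eq_3)
  obtain M2 where M2: "\<And>u. u \<in> I \<Longrightarrow> u \<noteq> s \<Longrightarrow> ball_closure 0 M2 (q2 u)"
    using L_second_order(1)[OF pB(1) s] unfolding q2_def by blast
  have c2: "conv 0 q2 (dscale (1/2) (acc s (stat s))) (at s within I)"
    using L_second_order(2)[OF pB(1) s] unfolding q2_def[abs_def] .
  have wS: "resp s \<in> B (Suc (Suc 0))" using wB(1) by (simp add: numeral_2_eq_2)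
  obtain M1 where M1: "\<And>u. u \<in> I \<Longrightarrow> u \<noteq> s \<Longrightarrow> ball_closure 0 M1 (q1 u)"
    using L_quotient_ball_closure[OF _ wS] s unfolding q1_def by (metis zero_le)
  have c1: "conv 0 q1 (vel s (resp s)) (at s within I)"
    unfolding q1_def[abs_def] by (rule L_derivative[OF _ wS s]) simp
  have VB0: "h \<in> B 0" if "h \<in> VV B" for h using that B_le[of 0 1 h] by (auto simp: VV_iff)
  have "((\<lambda>u. R u (q2 u + q1 u) \<phi>) \<longlongrightarrow> R s g \<phi>) (at s within I)"
  proof (rule R_weakly_continuous[OF s])
    show "q2 u + q1 u \<in> VV B" if "u \<in> I" for u by (intro VV_add q2V q1V that)
    show "g \<in> VV B" unfolding g_def by (intro VV_add VV_scale accV vw)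
    show "ball_closure 0 (M2 + M1) (q2 u + q1 u)" if "u \<in> I" "u \<noteq> s" for u
      by (rule ball_closure_add[OF _ M2[OF that] M1[OF that]]) simp
    show "conv 0 (\<lambda>u. q2 u + q1 u) g (at s within I)"
      unfolding g_def by (intro conv_add c2 c1 eventually_within_I VB0 q2V q1V VV_scale accV vw) auto
  qed fact
  moreover have "R u (q2 u + q1 u) \<phi> = (stat u \<phi> - stat s \<phi> - (u - s) * resp s \<phi>) / (u - s)\<^sup>2" if u: "u \<in> I" "u \<noteq> s" for u
  proof -
    have alg: "1 / (u - s)\<^sup>2 * (obs - y - (u - s) * (v + l)) - 1 / (u - s)\<^sup>2 * (obs - c - (u - s) * m) =
        1 / (u - s)\<^sup>2 * (c - y - (u - s) * v) + 1 / (u - s) * (m - l)" for obs y v l c m :: real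
    proof -
      define e where "e = u - s"
      have "e \<noteq> 0" using u by (simp add: e_def)
      then show ?thesis unfolding e_def[symmetric] by (simp add: field_simps power2_eq_square)
    qed
    have "R u (q2 u + q1 u) = dscale (1 / (u - s)\<^sup>2) (stat u - stat s - dscale (u - s) (resp s))"
    proof (rule R_eqI[OF u(1)])
      have "stat u - stat s \<in> B 1" by (intro B_diff stat_B u s) auto
      then have "stat u - stat s \<in> VV B" using stat_mass u s by (simp add: VV_iff)
      then show "dscale (1 / (u - s)\<^sup>2) (stat u - stat s - dscale (u - s) (resp s)) \<in> VV B"
        by (rule VV_scale[OF VV_diff[OF _ VV_scale[OF wB(2)]]])
      show "dscale (1 / (u - s)\<^sup>2) (stat u - stat s - dscale (u - s) (resp s)) -
          L u (dscale (1 / (u - s)\<^sup>2) (stat u - stat s - dscale (u - s) (resp s))) = q2 u + q1 u"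
      proof
        fix \<psi>
        have "resp s \<psi> - L s (resp s) \<psi> = vel s (stat s) \<psi>"
          using fun_cong[OF R_VV(2)[OF s vp], of \<psi>] by (simp add: resp_def)
        then have resp': "resp s \<psi> = vel s (stat s) \<psi> + L s (resp s) \<psi>" by simp
        show "(dscale (1 / (u - s)\<^sup>2) (stat u - stat s - dscale (u - s) (resp s)) -
          L u (dscale (1 / (u - s)\<^sup>2) (stat u - stat s - dscale (u - s) (resp s)))) \<psi> = (q2 u + q1 u) \<psi>"
          unfolding transfer_op_dscale transfer_op_diff stat_fixed[OF u(1)] q2_def q1_def stat_fixed[OF s]
            minus_distr_apply plus_fun_apply dscale_apply resp'
          by (rule alg)
      qed
    qed
    then show ?thesis by simp
  qed
  then have "\<forall>\<^sub>F u in at s within I. R u (q2 u + q1 u) \<phi> = (stat u \<phi> - stat s \<phi> - (u - s) * resp s \<phi>) / (u - s)\<^sup>2"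
    by (intro eventually_within_I)
  ultimately show ?thesis by (rule Lim_transform_eventually)
qed

end

section \<open>Reduction to a scalar equation\<close>

context mean_field_setting
begin

text \<open>The scalar function to which the equation $F = 0$ reduces; \<open>obs'\<close> is its derivative.\<close>
definition obs :: "real \<Rightarrow> real" where "obs u = stat u \<alpha>"

definition obs' :: "real \<Rightarrow> real" where "obs' u = resp u \<alpha>"

lemma \<alpha>_CT: "\<alpha> \<in> CT r"
  by (rule \<alpha>_smooth)

lemma WW_D: "h \<in> WW r B N Ks \<Longrightarrow> h \<in> B 1 \<and> h \<in> prob_distr r"
  using B_dual[of 1 h] by (auto simp: WW_def prob_distr_def)

lemma stat_WW:
  assumes "\<forall>u\<in>I. N 1 (stat u) \<le> Ks" "u \<in> I"
  shows "stat u \<in> WW r B N Ks"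
  using assms stat_B[of u 1] stat_nonneg stat_mass by (auto simp: WW_def)

lemma WW_in_I: "\<nu> \<in> {0..\<nu>s} \<Longrightarrow> h \<in> WW r B N Ks \<Longrightarrow> \<nu> * h \<alpha> \<in> I"
  using WW_D[of h Ks] in_I by blast

lemma HH_eq:
  assumes "\<forall>u\<in>I. N 1 (stat u) \<le> Ks" "\<nu> \<in> {0..\<nu>s}" "h \<in> WW r B N Ks"
  shows "HH r T \<alpha> \<beta> B N Ks \<nu> h = stat (\<nu> * h \<alpha>)"
  unfolding HH_def coupled_eq_drift
proof (rule the_equality)
  have u: "\<nu> * h \<alpha> \<in> I" by (rule WW_in_I[OF assms(2,3)])
  show "stat (\<nu> * h \<alpha>) \<in> WW r B N Ks \<and> L (\<nu> * h \<alpha>) (stat (\<nu> * h \<alpha>)) = stat (\<nu> * h \<alpha>)"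
    using stat_WW[OF assms(1) u] stat_fixed[OF u] by blast
  show "q = stat (\<nu> * h \<alpha>)" if "q \<in> WW r B N Ks \<and> L (\<nu> * h \<alpha>) q = q" for q
    using that by (intro stat_unique[OF u]) (auto simp: WW_def)
qed

lemma FF_eq_0_iff:
  assumes "\<forall>u\<in>I. N 1 (stat u) \<le> Ks" "\<nu> \<in> {0..\<nu>s}" "h \<in> WW r B N Ks"
  shows "FF r T \<alpha> \<beta> B N Ks \<nu> h = 0 \<longleftrightarrow> h = stat (\<nu> * h \<alpha>)"
  unfolding FF_def HH_eq[OF assms] by simp

lemma FF_stat_eq_0:
  assumes "\<forall>u\<in>I. N 1 (stat u) \<le> Ks" "\<nu> \<in> {0..\<nu>s}" "s \<in> I" "s = \<nu> * obs s"
  shows "FF r T \<alpha> \<beta> B N Ks \<nu> (stat s) = 0"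
  using assms(4) by (subst FF_eq_0_iff[OF assms(1,2) stat_WW[OF assms(1,3)]]) (simp_all add: obs_def[symmetric])

lemma vel_eq_minus_sum: "(\<Sum>k\<in>UNIV. dpartial r k (L u (b k h))) = - vel u h"
  by (simp add: vel_def)

lemma vel_p_VV: "u \<in> I \<Longrightarrow> vel u (stat u) \<in> VV B"
  by (rule vel_VV) (auto intro: stat_B)

lemma Theta_eq:
  assumes "\<forall>u\<in>I. N 1 (stat u) \<le> Ks" "\<nu> \<in> {0..\<nu>s}" "h \<in> WW r B N Ks"
  shows "Theta r T \<alpha> \<beta> B N Ks \<nu> h = resp (\<nu> * h \<alpha>)"
proof -
  have u: "\<nu> * h \<alpha> \<in> I" by (rule WW_in_I[OF assms(2,3)])
  show ?thesis
    unfolding Theta_def Let_def HH_eq[OF assms] coupled_eq_drift vel_eq_minus_sum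
      R_minus[OF u vel_p_VV[OF u]] resp_def by simp
qed

lemma DhF_eq:
  assumes "\<forall>u\<in>I. N 1 (stat u) \<le> Ks" "\<nu> \<in> {0..\<nu>s}" "h \<in> WW r B N Ks"
  shows "DhF r T \<alpha> \<beta> B N Ks \<nu> h = (\<lambda>\<phi>. \<phi> - dscale (\<nu> * \<phi> \<alpha>) (resp (\<nu> * h \<alpha>)))"
  unfolding DhF_def[abs_def] Theta_eq[OF assms] ..

lemma dpartial_op1: "bdd_op (B 1) (N 1) (B 0) (N 0) (dpartial r k)"
  using dpartial_op[of 0 k] by simp

text \<open>By linearity the double sums of the formula for $D_h^2F$ collapse: the inner sum over \<open>j\<close> of resolvents is
\<open>- resp u\<close>, the remaining sum over \<open>i\<close> is \<open>- vel u (resp u)\<close>, and the sums of second derivatives give \<open>acc u (stat u)\<close>.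
The result is the limit in \<open>obs_second_order\<close>, up to a factor.\<close>
lemma DhhF_eq:
  assumes "\<forall>u\<in>I. N 1 (stat u) \<le> Ks" "\<nu> \<in> {0..\<nu>s}" "h \<in> WW r B N Ks"
  defines "u \<equiv> \<nu> * h \<alpha>"
  shows "DhhF r T \<alpha> \<beta> B N Ks \<nu> h \<phi> \<psi> f =
    - (\<nu>\<^sup>2 * \<phi> \<alpha> * \<psi> \<alpha>) * (2 * R u (dscale (1/2) (acc u (stat u)) + vel u (resp u)) f)"
proof -
  have u: "u \<in> I" unfolding u_def by (rule WW_in_I[OF assms(2,3)])
  have p3: "stat u \<in> B 3" "stat u \<in> B 2" "stat u \<in> B 1" using stat_B[OF u] by auto
  note wB = resp_B2[OF u]
  have dV: "dpartial r k (L u (b k' g)) \<in> VV B" if "g \<in> B 2" for k k' g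
    using dpartial_B[of 1 "L u (b k' g)" k] L_B[OF u] b_B that dpartial_mass[of "L u (b k' g)" k] B_le[of 1 2 "L u (b k' g)"]
    by (simp add: VV_iff numeral_2_eq_2)
  have lin: "dpartial r i (L u (b i (- g))) = - dpartial r i (L u (b i g))" if g: "g \<in> B 1" for i g
  proof -
    have "dpartial r i (L u (b i (0 - g))) = dpartial r i (L u (b i 0)) - dpartial r i (L u (b i g))"
      unfolding mult_diff transfer_op_diff
      by (rule bdd_op_diff[OF dpartial_op1]) (use L_B[OF u] b_B g B_zero in auto)
    moreover have "dpartial r i (L u (b i 0)) = 0"
      using bdd_op_diff[OF dpartial_op1[of i] _ B_zero B_zero]
      by (simp add: mult_def transfer_op_def zero_fun_def)
    ultimately show ?thesis by simp
  qed
  have w1: "resp u \<in> B 1" using wB by (simp add: VV_iff)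
  have inner: "(\<Sum>j\<in>UNIV. R u (dpartial r j (L u (b j (stat u))))) = - resp u"
  proof -
    have "(\<Sum>j\<in>UNIV. R u (dpartial r j (L u (b j (stat u))))) = R u (\<Sum>j\<in>UNIV. dpartial r j (L u (b j (stat u))))"
      by (rule R_sum[OF u _ dV[OF p3(2)], symmetric]) simp
    then show ?thesis unfolding vel_eq_minus_sum R_minus[OF u vel_p_VV[OF u]] resp_def .
  qed
  have RB: "R u (dpartial r j (L u (b j (stat u)))) \<in> B 2" for j
  proof -
    have "dpartial r j (L u (b j (stat u))) \<in> B 2"
      using dpartial_B[of 2 "L u (b j (stat u))" j] L_B[OF u] b_B p3(1) by (simp add: numeral_3_eq_3 numeral_2_eq_2)
    then show ?thesis using dV[OF p3(2), of j j] by (intro R_in(2)[OF u]) (auto simp: VV_iff)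
  qed
  have RB1: "R u (dpartial r j (L u (b j (stat u)))) \<in> B 1" for j
    using B_le[OF _ _ RB, of 1] by simp
  have sum_inner: "(\<Sum>j\<in>UNIV. dpartial r i (L u (b i (R u (dpartial r j (L u (b j (stat u)))))))) = - dpartial r i (L u (b i (resp u)))" for i
  proof -
    have *: "(\<Sum>j\<in>A. dpartial r i (L u (b i (g j)))) = dpartial r i (L u (b i (\<Sum>j\<in>A. g j)))"
      if "finite A" "\<And>j. g j \<in> B 1" for A :: "'d set" and g
      using that(1)
    proof (induction A rule: finite_induct)
      case empty
      show ?case using bdd_op_diff[OF dpartial_op1[of i] _ B_zero B_zero]
        by (simp add: mult_def transfer_op_def zero_fun_def)
    next
      case (insert j A)
      have IH: "(\<Sum>j\<in>A. dpartial r i (L u (b i (g j)))) = dpartial r i (L u (b i (\<Sum>j\<in>A. g j)))" by (rule insert.IH)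
      have S1: "(\<Sum>j\<in>A. g j) \<in> B 1" by (intro B_sum that) simp
      have S2: "- (\<Sum>j\<in>A. g j) \<in> B 1" by (intro B_minus S1) simp
      have "dpartial r i (L u (b i (g j - (- (\<Sum>j\<in>A. g j))))) = dpartial r i (L u (b i (g j))) - dpartial r i (L u (b i (- (\<Sum>j\<in>A. g j))))"
        unfolding mult_diff transfer_op_diff
        by (rule bdd_op_diff[OF dpartial_op1]) (use L_B[OF u] b_B that(2) S2 in auto)
      then have "dpartial r i (L u (b i (g j + (\<Sum>j\<in>A. g j)))) = dpartial r i (L u (b i (g j))) + dpartial r i (L u (b i (\<Sum>j\<in>A. g j)))"
        unfolding lin[OF S1] by simp
      then show "(\<Sum>j\<in>insert j A. dpartial r i (L u (b i (g j)))) = dpartial r i (L u (b i (\<Sum>j\<in>insert j A. g j)))"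
        unfolding sum.insert[OF insert.hyps] IH by simp
    qed
    show ?thesis unfolding *[OF finite RB1] inner lin[OF w1] ..
  qed
  have first: "(\<Sum>i\<in>UNIV. \<Sum>j\<in>UNIV. R u (dpartial r i (L u (b i (R u (dpartial r j (L u (b j (stat u))))))))) = R u (vel u (resp u))"
  proof -
    have "(\<Sum>i\<in>UNIV. \<Sum>j\<in>UNIV. R u (dpartial r i (L u (b i (R u (dpartial r j (L u (b j (stat u)))))))))
        = (\<Sum>i\<in>UNIV. R u (\<Sum>j\<in>UNIV. dpartial r i (L u (b i (R u (dpartial r j (L u (b j (stat u)))))))))"
      by (intro sum.cong refl R_sum[OF u _ dV[OF RB], symmetric]) simp
    also have "\<dots> = (\<Sum>i\<in>UNIV. - R u (dpartial r i (L u (b i (resp u)))))"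
      unfolding sum_inner R_minus[OF u dV[OF wB(1)]] ..
    also have "\<dots> = - (\<Sum>i\<in>UNIV. R u (dpartial r i (L u (b i (resp u)))))" by (rule sum_negf)
    also have "(\<Sum>i\<in>UNIV. R u (dpartial r i (L u (b i (resp u))))) = R u (\<Sum>i\<in>UNIV. dpartial r i (L u (b i (resp u))))"
      by (rule R_sum[OF u _ dV[OF wB(1)], symmetric]) simp
    also have "\<dots> = - R u (vel u (resp u))"
      unfolding vel_eq_minus_sum by (rule R_minus[OF u vel_VV[OF u wB(1)]])
    finally show ?thesis by simp
  qed
  have second: "(\<Sum>i\<in>UNIV. \<Sum>j\<in>UNIV. dpartial r i (dpartial r j (L u (mult r (\<lambda>x. \<beta> x $ i * \<beta> x $ j) (stat u))))) = acc u (stat u)"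
  proof -
    have mm: "mult r (\<lambda>x. \<beta> x $ i * \<beta> x $ j) h = b j (b i h)" for i j h
      using CT_mult[OF \<beta>_smooth[of j r]] by (auto simp: mult_def fun_eq_iff mult_ac)
    have D1: "dpartial r j (L u (b j (b i (stat u)))) \<in> B 1" for i j
      using dpartial_B[of 1 "L u (b j (b i (stat u)))" j] L_B[OF u] b_B p3(2) by (simp add: numeral_2_eq_2)
    have *: "(\<Sum>j\<in>A. dpartial r i (g j)) = dpartial r i (\<Sum>j\<in>A. g j)"
      if "finite A" "\<And>j. g j \<in> B 1" for A :: "'d set" and g i
      using that(1)
    proof (induction A rule: finite_induct)
      case empty
      have "dpartial r i 0 = 0" using bdd_op_diff[OF dpartial_op1[of i] _ B_zero B_zero] by simp
      then show "(\<Sum>j\<in>{}. dpartial r i (g j)) = dpartial r i (\<Sum>j\<in>{}. g j)" unfolding sum.empty by (rule sym)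
    next
      case (insert j A)
      have IH: "(\<Sum>j\<in>A. dpartial r i (g j)) = dpartial r i (\<Sum>j\<in>A. g j)" by (rule insert.IH)
      have S1: "(\<Sum>j\<in>A. g j) \<in> B 1" by (intro B_sum that) simp
      have "dpartial r i (g j + (\<Sum>j\<in>A. g j)) = dpartial r i (g j) + dpartial r i (\<Sum>j\<in>A. g j)"
        using dpartial_op[of 0 i] that(2) S1 unfolding bdd_op_def by simp
      then show "(\<Sum>j\<in>insert j A. dpartial r i (g j)) = dpartial r i (\<Sum>j\<in>insert j A. g j)"
        unfolding sum.insert[OF insert.hyps] IH by simp
    qed
    have neg: "dpartial r i (- g) = - dpartial r i g" if "g \<in> B 1" for i g
      using bdd_op_diff[OF dpartial_op1[of i] _ B_zero that]
        bdd_op_diff[OF dpartial_op1[of i] _ B_zero B_zero] by simp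
    have "(\<Sum>j\<in>UNIV. dpartial r i (dpartial r j (L u (b j (b i (stat u)))))) = - dpartial r i (vel u (b i (stat u)))" for i
    proof -
      have "vel u (b i (stat u)) \<in> B 1" using vel_VV[OF u b_B[OF _ p3(2)]] by (simp add: VV_iff)
      then show ?thesis unfolding *[OF finite D1] vel_eq_minus_sum by (rule neg)
    qed
    then show ?thesis unfolding mm acc_def by (simp add: sum_negf)
  qed
  have accV: "acc u (stat u) \<in> VV B"
    using acc_B[OF u, of 1 "stat u"] acc_mass[OF u p3(2)] p3(1) by (simp add: VV_iff numeral_3_eq_3)
  have vw: "vel u (resp u) \<in> VV B" by (rule vel_VV[OF u wB(1)])
  have "dscale 2 (R u (vel u (resp u))) + R u (acc u (stat u)) = dscale 2 (R u (dscale (1/2) (acc u (stat u)) + vel u (resp u)))"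
    unfolding R_add[OF u VV_scale[OF accV] vw] R_scale[OF u accV] dscale_add by simp
  then show ?thesis
    unfolding DhhF_def Let_def HH_eq[OF assms(1-3)] coupled_eq_drift u_def[symmetric] first second by simp
qed

text \<open>If \<open>\<nu> * \<Theta> \<alpha> = 1\<close> then \<open>\<Theta>\<close> is in the kernel; otherwise the inverse is explicit, by the
Sherman-Morrison formula.\<close>
lemma invertible_iff:
  assumes \<Theta>: "\<Theta> \<in> VV B"
  shows "invertible_op (VV B) (N 1) (\<lambda>\<phi>. \<phi> - dscale (\<nu> * \<phi> \<alpha>) \<Theta>) \<longleftrightarrow> \<nu> * \<Theta> \<alpha> \<noteq> 1"
proof
  assume inv: "invertible_op (VV B) (N 1) (\<lambda>\<phi>. \<phi> - dscale (\<nu> * \<phi> \<alpha>) \<Theta>)"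
  then obtain A where A: "bdd_op (VV B) (N 1) (VV B) (N 1) A" "\<forall>h\<in>VV B. A (h - dscale (\<nu> * h \<alpha>) \<Theta>) = h"
    unfolding invertible_op_def by blast
  show "\<nu> * \<Theta> \<alpha> \<noteq> 1"
  proof
    assume 1: "\<nu> * \<Theta> \<alpha> = 1"
    have "A (dscale 0 0) = dscale 0 (A 0)" using A(1) VV_0 unfolding bdd_op_def by blast
    then have "A 0 = 0" by (simp add: dscale_def zero_fun_def)
    moreover have "\<Theta> - dscale (\<nu> * \<Theta> \<alpha>) \<Theta> = 0" unfolding 1 by simp
    ultimately have "\<Theta> = 0" using A(2) \<Theta> by metis
    with 1 show False by simp
  qed
next
  assume ne: "\<nu> * \<Theta> \<alpha> \<noteq> 1"
  obtain C where C: "C \<ge> 0" "\<And>h. h \<in> B 1 \<Longrightarrow> \<bar>h \<alpha>\<bar> \<le> C * N 1 h" using eval_bound[OF \<alpha>_CT] by (metis one_le_numeral)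
  have rank_one: "bdd_op (VV B) (N 1) (VV B) (N 1) (\<lambda>\<phi>. \<phi> - dscale (c * \<phi> \<alpha>) \<Theta>)" for c
    unfolding bdd_op_def
  proof (intro conjI ballI allI exI)
    fix g h :: "'d distr" and d assume gh: "g \<in> VV B" "h \<in> VV B"
    show "g - dscale (c * g \<alpha>) \<Theta> \<in> VV B" by (intro VV_diff VV_scale gh \<Theta>)
    show "g + h - dscale (c * (g + h) \<alpha>) \<Theta> = g - dscale (c * g \<alpha>) \<Theta> + (h - dscale (c * h \<alpha>) \<Theta>)"
      by (auto simp: fun_eq_iff algebra_simps)
    show "dscale d g - dscale (c * dscale d g \<alpha>) \<Theta> = dscale d (g - dscale (c * g \<alpha>) \<Theta>)"
      by (auto simp: fun_eq_iff algebra_simps)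
    have g1: "g \<in> B 1" "\<Theta> \<in> B 1" using gh \<Theta> by (auto simp: VV_iff)
    have "N 1 (g - dscale (c * g \<alpha>) \<Theta>) \<le> N 1 g + N 1 (dscale (c * g \<alpha>) \<Theta>)"
      by (intro N_diff_le g1 B_scale) auto
    also have "\<dots> = N 1 g + \<bar>c\<bar> * \<bar>g \<alpha>\<bar> * N 1 \<Theta>" using N_scale[OF _ g1(2)] by (simp add: abs_mult)
    also have "\<dots> \<le> N 1 g + \<bar>c\<bar> * (C * N 1 g) * N 1 \<Theta>"
      using C(2)[OF g1(1)] N_nonneg[OF _ g1(2)] by (intro add_left_mono mult_right_mono mult_left_mono) auto
    also have "\<dots> = (1 + \<bar>c\<bar> * C * N 1 \<Theta>) * N 1 g" by (simp add: algebra_simps)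
    finally show "N 1 (g - dscale (c * g \<alpha>) \<Theta>) \<le> (1 + \<bar>c\<bar> * C * N 1 \<Theta>) * N 1 g" .
  qed
  \<comment> \<open>The coefficient of the rank one term of the inverse.\<close>
  define c where "c = - \<nu> / (1 - \<nu> * \<Theta> \<alpha>)"
  have c: "c * (1 - \<nu> * \<Theta> \<alpha>) = - \<nu>" using ne by (simp add: c_def)
  then have c': "c + \<nu> = c * \<nu> * \<Theta> \<alpha>" by (simp add: algebra_simps)
  have alg: "x - (\<nu> * y) * z - c * (y - (\<nu> * y) * \<Theta> \<alpha>) * z = x" "x - (c * y) * z - \<nu> * (y - (c * y) * \<Theta> \<alpha>) * z = x" for x y z
  proof -
    have "x - (\<nu> * y) * z - c * (y - (\<nu> * y) * \<Theta> \<alpha>) * z = x - (\<nu> + c - c * \<nu> * \<Theta> \<alpha>) * y * z" by (simp add: algebra_simps)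
    also have "\<dots> = x" using c' by simp
    finally show "x - (\<nu> * y) * z - c * (y - (\<nu> * y) * \<Theta> \<alpha>) * z = x" .
    have "x - (c * y) * z - \<nu> * (y - (c * y) * \<Theta> \<alpha>) * z = x - (\<nu> + c - c * \<nu> * \<Theta> \<alpha>) * y * z" by (simp add: algebra_simps)
    also have "\<dots> = x" using c' by simp
    finally show "x - (c * y) * z - \<nu> * (y - (c * y) * \<Theta> \<alpha>) * z = x" .
  qed
  show "invertible_op (VV B) (N 1) (\<lambda>\<phi>. \<phi> - dscale (\<nu> * \<phi> \<alpha>) \<Theta>)"
    unfolding invertible_op_def
    by (intro conjI rank_one exI[of _ "\<lambda>\<phi>. \<phi> - dscale (c * \<phi> \<alpha>) \<Theta>"] ballI)
       (rule ext, simp only: minus_distr_apply dscale_apply alg)+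
qed

lemma obs_derivative:
  assumes s: "s \<in> I"
  shows "(obs has_real_derivative obs' s) (at s within I)"
proof -
  have "((\<lambda>s'. dscale (1 / (s' - s)) (stat s' - stat s) \<alpha>) \<longlongrightarrow> resp s \<alpha>) (at s within I)"
    using resp_B2[OF s] by (intro conv_eval_within[OF stat_derivative[OF s]] \<alpha>_CT B_scale B_diff stat_B s) (auto simp: VV_iff)
  then show ?thesis unfolding has_field_derivative_iff obs_def obs'_def by simp
qed

lemma obs_continuous: "continuous_on I obs"
  using DERIV_continuous_on[of I obs obs'] obs_derivative by blast

lemma obs'_continuous: "continuous_on I obs'"
  unfolding obs'_def
  by (intro continuous_on_I conv_eval_within[OF resp_continuous] \<alpha>_CT) (use resp_B2 in \<open>auto simp: VV_iff\<close>)

lemma obs_second_order: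
  assumes s: "s \<in> I"
  shows "((\<lambda>s'. (obs s' - obs s - (s' - s) * obs' s) / (s' - s)\<^sup>2) \<longlongrightarrow>
    R s (dscale (1/2) (acc s (stat s)) + vel s (resp s)) \<alpha>) (at s within I)"
  unfolding obs_def obs'_def by (rule stat_second_order[OF s \<alpha>_CT])

section \<open>Solutions near a given one\<close>

text \<open>By the mean value theorem two solutions for the same \<open>\<nu>\<close> give a point \<open>x\<close> between them with
\<open>\<nu> * obs' x = 1\<close>, which continuity excludes.\<close>
lemma locally_unique:
  assumes s0: "s0 \<in> I" and \<nu>0: "\<nu>0 \<in> {0..\<nu>s}" and ne: "\<nu>0 * obs' s0 \<noteq> 1"
  shows "\<exists>\<eta>>0. \<forall>\<nu>\<in>{0..\<nu>s}. \<bar>\<nu> - \<nu>0\<bar> < \<eta> \<longrightarrow> (\<forall>s\<in>I. \<forall>s'\<in>I. \<bar>s - s0\<bar> < \<eta> \<longrightarrow> \<bar>s' - s0\<bar> < \<eta> \<longrightarrow>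
    s = \<nu> * obs s \<longrightarrow> s' = \<nu> * obs s' \<longrightarrow> s = s')"
proof -
  define k where "k = \<bar>1 - \<nu>0 * obs' s0\<bar>"
  have k: "k > 0" using ne by (simp add: k_def)
  define e where "e = k / (2 * (\<nu>s + 1))"
  have e: "e > 0" using k \<nu>s_pos by (simp add: e_def)
  from obs'_continuous s0 e obtain d where d: "d > 0" "\<And>u. u \<in> I \<Longrightarrow> dist u s0 < d \<Longrightarrow> dist (obs' u) (obs' s0) < e"
    unfolding continuous_on_iff by metis
  define \<eta> where "\<eta> = min d (k / (2 * (\<bar>obs' s0\<bar> + 1)))"
  have \<eta>: "\<eta> > 0" using d k by (simp add: \<eta>_def)
  have not1: "\<nu> * obs' x \<noteq> 1" if \<nu>: "\<nu> \<in> {0..\<nu>s}" "\<bar>\<nu> - \<nu>0\<bar> < \<eta>" and x: "x \<in> I" "\<bar>x - s0\<bar> < \<eta>" for \<nu> x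
  proof
    assume 1: "\<nu> * obs' x = 1"
    have "\<bar>\<nu> * (obs' x - obs' s0)\<bar> \<le> \<nu>s * e"
      using d(2)[OF x(1)] x(2) \<nu>(1) unfolding abs_mult by (intro mult_mono) (auto simp: dist_real_def \<eta>_def)
    also have "\<dots> < k / 2" using k \<nu>s_pos by (simp add: e_def field_simps)
    finally have A: "\<bar>\<nu> * (obs' x - obs' s0)\<bar> < k / 2" .
    have "\<bar>(\<nu> - \<nu>0) * obs' s0\<bar> \<le> (k / (2 * (\<bar>obs' s0\<bar> + 1))) * \<bar>obs' s0\<bar>"
      using \<nu>(2) unfolding abs_mult by (intro mult_right_mono) (auto simp: \<eta>_def)
    also have "\<dots> \<le> k / 2" using k by (simp add: field_simps)
    finally have "\<bar>(\<nu> - \<nu>0) * obs' s0\<bar> \<le> k / 2" .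
    moreover have "1 - \<nu>0 * obs' s0 = \<nu> * (obs' x - obs' s0) + (\<nu> - \<nu>0) * obs' s0" using 1 by (simp add: algebra_simps)
    then have "k \<le> \<bar>\<nu> * (obs' x - obs' s0)\<bar> + \<bar>(\<nu> - \<nu>0) * obs' s0\<bar>" unfolding k_def by (simp only: abs_triangle_ineq)
    ultimately show False using A by linarith
  qed
  have no_pair: False if \<nu>: "\<nu> \<in> {0..\<nu>s}" "\<bar>\<nu> - \<nu>0\<bar> < \<eta>" and s: "s \<in> I" "s' \<in> I" "\<bar>s - s0\<bar> < \<eta>" "\<bar>s' - s0\<bar> < \<eta>"
    "s = \<nu> * obs s" "s' = \<nu> * obs s'" and lt: "s < s'" for \<nu> s s'
  proof -
    have sub: "{s..s'} \<subseteq> I"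
    proof -
      have "closed_segment s s' \<subseteq> I" using convex_I s(1,2) unfolding convex_contains_segment by blast
      then show ?thesis using lt by (simp add: closed_segment_eq_real_ivl)
    qed
    have "\<exists>x\<in>{s<..<s'}. obs s' - obs s = (*) (obs' x) (s' - s)"
    proof (rule mvt_simple[OF lt])
      fix x assume "s \<le> x" "x \<le> s'"
      then have x: "x \<in> I" using sub by auto
      show "(obs has_derivative (*) (obs' x)) (at x within {s..s'})"
        using DERIV_subset[OF obs_derivative[OF x] sub] unfolding has_field_derivative_def .
    qed
    then obtain x where x: "x \<in> {s<..<s'}" "obs s' - obs s = obs' x * (s' - s)" by auto
    have "s' - s = \<nu> * (obs s' - obs s)" using s(5,6) by (simp add: right_diff_distrib)
    also have "\<dots> = \<nu> * obs' x * (s' - s)" using x(2) by simp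
    finally have "\<nu> * obs' x = 1" using lt by simp
    moreover have "x \<in> I" "\<bar>x - s0\<bar> < \<eta>" using x sub s by auto
    ultimately show False using not1[OF \<nu>] by blast
  qed
  have "s = s'" if "\<nu> \<in> {0..\<nu>s}" "\<bar>\<nu> - \<nu>0\<bar> < \<eta>" "s \<in> I" "s' \<in> I" "\<bar>s - s0\<bar> < \<eta>" "\<bar>s' - s0\<bar> < \<eta>"
    "s = \<nu> * obs s" "s' = \<nu> * obs s'" for \<nu> s s'
    using no_pair[OF that(1-8)] no_pair[OF that(1,2,4,3,6,5,8,7)] by (meson linorder_less_linear)
  with \<eta> show ?thesis by blast
qed

text \<open>The chain rule. The derivative of \<open>stat\<close> is one within \<open>I\<close>, and \<open>\<sigma>\<close> may return to the value
\<open>\<sigma> \<tau>\<close>, so the quotient in \<open>s\<close> is extended by zero there.\<close>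
lemma differentiable_curve_compose:
  assumes \<delta>: "\<tau> \<in> {-\<delta><..<\<delta>}" and \<sigma>: "\<And>x. x \<in> {-\<delta><..<\<delta>} \<Longrightarrow> \<sigma> x \<in> I" "(\<sigma> has_real_derivative d) (at \<tau>)"
  shows "differentiable_curve (B 1) (N 1) (\<lambda>x. stat (\<sigma> x)) \<tau>"
proof -
  define s where "s = \<sigma> \<tau>"
  have s: "s \<in> I" unfolding s_def by (rule \<sigma>(1)[OF \<delta>])
  have w1: "resp s \<in> B 1" using resp_B2[OF s] by (simp add: VV_iff)
  define e where "e s' = (if s' = s then 0 else N 1 (dscale (1 / (s' - s)) (stat s' - stat s) - resp s))" for s'
  define k where "k x = (\<sigma> (\<tau> + x) - s) / x" for x
  have ev: "\<forall>\<^sub>F x in at 0. \<tau> + x \<in> {-\<delta><..<\<delta>}"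
  proof -
    have "((\<lambda>x. \<tau> + x) \<longlongrightarrow> \<tau> + 0) (at 0)" by (intro tendsto_intros)
    then show ?thesis using topological_tendstoD[of _ "\<tau> + 0" _ "{-\<delta><..<\<delta>}"] \<delta> by simp
  qed
  have kd: "(k \<longlongrightarrow> d) (at 0)" using \<sigma>(2) unfolding DERIV_def k_def[abs_def] s_def .
  have e0: "((\<lambda>x. e (\<sigma> (\<tau> + x))) \<longlongrightarrow> 0) (at 0)"
  proof (rule tendstoI)
    fix \<epsilon> :: real assume \<epsilon>: "\<epsilon> > 0"
    have "\<forall>\<^sub>F s' in at s within I. dist (N 1 (dscale (1 / (s' - s)) (stat s' - stat s) - resp s)) 0 < \<epsilon>"
      by (rule tendstoD[OF stat_derivative[OF s] \<epsilon>])
    then obtain \<rho> where \<rho>: "\<rho> > 0" "\<forall>s'\<in>I. s' \<noteq> s \<and> dist s' s < \<rho> \<longrightarrow> dist (N 1 (dscale (1 / (s' - s)) (stat s' - stat s) - resp s)) 0 < \<epsilon>"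
      unfolding eventually_at by blast
    have "((\<lambda>x. \<sigma> (\<tau> + x)) \<longlongrightarrow> s) (at 0)"
      using DERIV_isCont[OF \<sigma>(2)] unfolding isCont_def LIM_offset_zero_iff[of _ _ \<sigma>] s_def by (simp add: LIM_offset_zero_iff)
    from tendstoD[OF this \<rho>(1)] ev show "\<forall>\<^sub>F x in at 0. dist (e (\<sigma> (\<tau> + x))) 0 < \<epsilon>"
    proof eventually_elim
      case (elim x)
      then show ?case using \<rho>(2) \<sigma>(1)[of "\<tau> + x"] \<epsilon> by (auto simp: e_def)
    qed
  qed
  have "((\<lambda>x. N 1 (dscale (1 / x) (stat (\<sigma> (\<tau> + x)) - stat (\<sigma> \<tau>)) - dscale d (resp s))) \<longlongrightarrow> 0) (at 0)"
  proof (rule Lim_null_comparison)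
    show "((\<lambda>x. \<bar>k x\<bar> * e (\<sigma> (\<tau> + x)) + \<bar>k x - d\<bar> * N 1 (resp s)) \<longlongrightarrow> 0) (at 0)"
    proof -
      have "((\<lambda>x. \<bar>k x\<bar> * e (\<sigma> (\<tau> + x)) + \<bar>k x - d\<bar> * N 1 (resp s)) \<longlongrightarrow> \<bar>d\<bar> * 0 + \<bar>d - d\<bar> * N 1 (resp s)) (at 0)"
        by (intro tendsto_intros kd e0)
      then show ?thesis by simp
    qed
    have "\<forall>\<^sub>F x in at 0. x \<noteq> (0::real)" by (simp add: eventually_at_filter)
    with ev show "\<forall>\<^sub>F x in at 0. norm (N 1 (dscale (1 / x) (stat (\<sigma> (\<tau> + x)) - stat (\<sigma> \<tau>)) - dscale d (resp s)))
        \<le> \<bar>k x\<bar> * e (\<sigma> (\<tau> + x)) + \<bar>k x - d\<bar> * N 1 (resp s)"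
    proof eventually_elim
      case (elim x)
      define s' where "s' = \<sigma> (\<tau> + x)"
      have s': "s' \<in> I" unfolding s'_def by (rule \<sigma>(1)[OF elim(1)])
      define y where "y = (if s' = s then 0 else dscale (1 / (s' - s)) (stat s' - stat s) - resp s)"
      have ps: "stat s' - stat s \<in> B 1" by (intro B_diff stat_B s s') auto
      have y: "y \<in> B 1" "N 1 y = e s'"
        using B_diff[OF _ B_scale[OF _ ps] w1] B_zero[of 1] N_0[of 1] by (auto simp: y_def e_def)
      have eq: "dscale (1 / x) (stat s' - stat s) - dscale d (resp s) = dscale (k x) y + dscale (k x - d) (resp s)"
        using elim(2) by (auto simp: fun_eq_iff k_def s'_def[symmetric] y_def field_simps)
      have "N 1 (dscale (1 / x) (stat s' - stat s) - dscale d (resp s)) \<le> N 1 (dscale (k x) y) + N 1 (dscale (k x - d) (resp s))"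
        unfolding eq by (intro N_triangle B_scale y w1) auto
      also have "\<dots> = \<bar>k x\<bar> * e s' + \<bar>k x - d\<bar> * N 1 (resp s)" using N_scale[OF _ y(1)] N_scale[OF _ w1] y(2) by simp
      finally have le: "N 1 (dscale (1 / x) (stat s' - stat s) - dscale d (resp s)) \<le> \<bar>k x\<bar> * e s' + \<bar>k x - d\<bar> * N 1 (resp s)" .
      have "0 \<le> N 1 (dscale (1 / x) (stat s' - stat s) - dscale d (resp s))"
        by (intro N_nonneg B_diff B_scale ps w1) auto
      with le show ?case unfolding s'_def s_def[symmetric] by simp
    qed
  qed
  moreover have "dscale d (resp s) \<in> B 1" by (rule B_scale[OF _ w1]) simp
  ultimately show ?thesis unfolding differentiable_curve_def by blast
qed

lemma quotient_curve_differentiable: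
  assumes \<tau>: "\<tau> \<in> {-\<delta><..<\<delta>}" and \<sigma>: "\<And>x. x \<in> {-\<delta><..<\<delta>} \<Longrightarrow> \<sigma> x \<in> I" "(\<sigma> has_real_derivative d) (at \<tau>)"
    and ne: "obs (\<sigma> \<tau>) \<noteq> 0"
  shows "(\<lambda>x. \<sigma> x / obs (\<sigma> x)) differentiable (at \<tau>)"
proof -
  have at: "at \<tau> within {-\<delta><..<\<delta>} = at \<tau>" by (rule at_within_open[OF \<tau>]) simp
  have im: "\<sigma> ` {-\<delta><..<\<delta>} \<subseteq> I" using \<sigma>(1) by blast
  have "((\<lambda>x. obs (\<sigma> x)) has_real_derivative obs' (\<sigma> \<tau>) * d) (at \<tau>)"
    using DERIV_image_chain[OF DERIV_subset[OF obs_derivative[OF \<sigma>(1)[OF \<tau>]] im] has_field_derivative_at_within[OF \<sigma>(2)]]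
    unfolding at by (simp add: o_def)
  from DERIV_divide[OF \<sigma>(2) this ne] show ?thesis unfolding real_differentiable_def by blast
qed

lemma stat_prob: "u \<in> I \<Longrightarrow> stat u \<in> prob_distr r"
  using stat_nonneg stat_mass B_dual[of 3 "stat u"] stat_B[of u 3] by (simp add: prob_distr_def)

lemma multiples_in_I: "s0 \<in> I \<Longrightarrow> t \<in> {0..\<nu>s} \<Longrightarrow> t * obs s0 \<in> I"
  unfolding obs_def by (intro in_I stat_prob)

text \<open>Near \<open>s0\<close> the quotient \<open>s / obs s\<close> is close to \<open>\<nu>0 < \<nu>s\<close>. If \<open>\<nu>0 > 0\<close> then \<open>s0\<close> is an interior
point of \<open>I\<close>, because \<open>\<nu>0\<close> can be moved in both directions in \<open>\<nu>0 * obs s0\<close>.\<close>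
lemma good_region:
  assumes s0: "s0 \<in> I" "s0 = \<nu>0 * obs s0" "obs s0 \<noteq> 0" and \<nu>0: "\<nu>0 \<in> {0..<\<nu>s}"
  shows "\<exists>\<rho>>0. (\<forall>s\<in>I. \<bar>s - s0\<bar> < \<rho> \<longrightarrow> 0 < obs s * obs s0 \<and> s / obs s < \<nu>s \<and> (\<nu>0 > 0 \<longrightarrow> 0 < s / obs s)) \<and>
    (\<nu>0 > 0 \<longrightarrow> (\<forall>s. \<bar>s - s0\<bar> < \<rho> \<longrightarrow> s \<in> I))"
proof -
  have lim: "(obs \<longlongrightarrow> obs s0) (at s0 within I)" using obs_continuous s0(1) by (simp add: continuous_on_def)
  have q0: "s0 / obs s0 = \<nu>0" using s0(2,3) by (simp add: divide_eq_eq)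
  have quot: "((\<lambda>s. s / obs s) \<longlongrightarrow> s0 / obs s0) (at s0 within I)"
    by (intro tendsto_intros lim s0)
  have "((\<lambda>s. obs s * obs s0) \<longlongrightarrow> obs s0 * obs s0) (at s0 within I)" by (intro tendsto_intros lim)
  moreover have "0 < obs s0 * obs s0" using s0(3) by (metis not_real_square_gt_zero)
  ultimately have e1: "\<forall>\<^sub>F s in at s0 within I. 0 < obs s * obs s0" by (rule order_tendstoD(1))
  have e2: "\<forall>\<^sub>F s in at s0 within I. s / obs s < \<nu>s"
    using \<nu>0 q0 by (intro order_tendstoD(2)[OF quot]) simp
  have e3: "\<forall>\<^sub>F s in at s0 within I. \<nu>0 > 0 \<longrightarrow> 0 < s / obs s"
    using order_tendstoD(1)[OF quot, of 0] q0 by (cases "\<nu>0 > 0") auto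
  from eventually_conj[OF e1 eventually_conj[OF e2 e3]]
  obtain d where d: "d > 0" "\<forall>s\<in>I. s \<noteq> s0 \<and> dist s s0 < d \<longrightarrow> 0 < obs s * obs s0 \<and> s / obs s < \<nu>s \<and> (\<nu>0 > 0 \<longrightarrow> 0 < s / obs s)"
    unfolding eventually_at by blast
  define \<rho> where "\<rho> = (if \<nu>0 > 0 then min d (\<bar>obs s0\<bar> * min \<nu>0 (\<nu>s - \<nu>0)) else d)"
  have \<rho>: "\<rho> > 0" "\<rho> \<le> d" using d(1) s0(3) \<nu>0 by (auto simp: \<rho>_def)
  have "0 < obs s * obs s0 \<and> s / obs s < \<nu>s \<and> (\<nu>0 > 0 \<longrightarrow> 0 < s / obs s)" if "s \<in> I" "\<bar>s - s0\<bar> < \<rho>" for s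
  proof (cases "s = s0")
    case True
    then show ?thesis using \<open>0 < obs s0 * obs s0\<close> q0 \<nu>0 by simp
  next
    case False
    then show ?thesis using d(2) that \<rho>(2) by (simp add: dist_real_def)
  qed
  moreover have "s \<in> I" if "\<nu>0 > 0" "\<bar>s - s0\<bar> < \<rho>" for s
  proof -
    \<comment> \<open>With this \<open>t\<close> the point \<open>s\<close> is \<open>t * obs s0\<close>, attained by the coupling strength \<open>t\<close> and the distribution of \<open>s0\<close>.\<close>
    define t where "t = \<nu>0 + (s - s0) / obs s0"
    have "\<bar>s - s0\<bar> < \<bar>obs s0\<bar> * min \<nu>0 (\<nu>s - \<nu>0)" using that by (simp add: \<rho>_def)
    then have "\<bar>(s - s0) / obs s0\<bar> < min \<nu>0 (\<nu>s - \<nu>0)" 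
      unfolding abs_divide using s0(3) by (simp add: pos_divide_less_eq mult.commute del: min_less_iff_conj min_mult_distrib_right)
    then have "t \<in> {0..\<nu>s}" unfolding t_def atLeastAtMost_iff min_less_iff_conj abs_less_iff by linarith
    from multiples_in_I[OF s0(1) this] have "t * obs s0 \<in> I" .
    moreover have "t * obs s0 = s" using s0(2,3) by (simp add: t_def distrib_right)
    ultimately show ?thesis by simp
  qed
  ultimately show ?thesis using \<rho>(1) by blast
qed

lemma IVT_interval:
  fixes f :: "real \<Rightarrow> real"
  assumes "x \<le> y" "continuous_on {x..y} f" "f x \<le> c" "c \<le> f y"
  shows "\<exists>z\<in>{x..y}. f z = c"
  using IVT'[OF assms(3,4,1,2)] by auto

text \<open>For \<open>\<nu>0 = 0\<close> the point \<open>s0 = 0\<close> may be an endpoint of \<open>I\<close>, so solutions \<open>s\<close> are searched among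
the nonnegative multiples of \<open>obs 0\<close>: with \<open>s = t * obs 0\<close>, the intermediate value theorem applies to an equation in \<open>t\<close>.\<close>
lemma nearby_solution_at_0:
  assumes I0: "0 \<in> I" and a0: "obs 0 \<noteq> 0" and \<kappa>: "\<kappa> > 0"
  shows "\<exists>\<epsilon>>0. \<forall>\<nu>\<in>{0..\<nu>s}. \<bar>\<nu>\<bar> < \<epsilon> \<longrightarrow> (\<exists>s\<in>I. \<bar>s\<bar> < \<kappa> \<and> s = \<nu> * obs s)"
proof -
  define t1 where "t1 = min \<nu>s (\<kappa> / (2 * \<bar>obs 0\<bar>))"
  have t1: "t1 > 0" "t1 \<le> \<nu>s" "\<bar>obs 0\<bar> * t1 < \<kappa>"
  proof -
    show "t1 > 0" "t1 \<le> \<nu>s" using \<nu>s_pos \<kappa> a0 by (auto simp: t1_def)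
    have "\<bar>obs 0\<bar> * t1 \<le> \<bar>obs 0\<bar> * (\<kappa> / (2 * \<bar>obs 0\<bar>))" by (intro mult_left_mono) (auto simp: t1_def)
    also have "\<dots> < \<kappa>" using a0 \<kappa> by simp
    finally show "\<bar>obs 0\<bar> * t1 < \<kappa>" .
  qed
  define \<epsilon> where "\<epsilon> = (obs 0)\<^sup>2 * t1 / (\<bar>obs 0 * obs (t1 * obs 0)\<bar> + 1)"
  have \<epsilon>: "\<epsilon> > 0" using a0 t1 by (simp add: \<epsilon>_def add_nonneg_pos)
  have "\<exists>s\<in>I. \<bar>s\<bar> < \<kappa> \<and> s = \<nu> * obs s" if \<nu>: "\<nu> \<in> {0..\<nu>s}" "\<bar>\<nu>\<bar> < \<epsilon>" for \<nu>
  proof -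
    \<comment> \<open>The equation for \<open>s = t * obs 0\<close>, multiplied by \<open>obs 0\<close> to make the coefficient of \<open>t\<close> positive.\<close>
    define f where "f t = (obs 0)\<^sup>2 * t - \<nu> * (obs 0 * obs (t * obs 0))" for t
    have "continuous_on {0..t1} (\<lambda>t. obs (t * obs 0))"
      by (rule continuous_on_compose2[OF obs_continuous]) (use multiples_in_I[OF I0] t1 in \<open>auto intro!: continuous_intros\<close>)
    then have cont: "continuous_on {0..t1} f" unfolding f_def by (intro continuous_intros)
    have f0: "f 0 \<le> 0" using \<nu> by (simp add: f_def)
    have "\<nu> * (obs 0 * obs (t1 * obs 0)) \<le> \<nu> * (\<bar>obs 0 * obs (t1 * obs 0)\<bar> + 1)"
      using \<nu> by (intro mult_left_mono) auto
    also have "\<dots> \<le> \<epsilon> * (\<bar>obs 0 * obs (t1 * obs 0)\<bar> + 1)"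
      using \<nu> by (intro mult_right_mono) auto
    also have "\<dots> = (obs 0)\<^sup>2 * t1" by (simp add: \<epsilon>_def)
    finally have "0 \<le> f t1" by (simp add: f_def)
    from IVT_interval[OF less_imp_le[OF t1(1)] cont f0 this]
    obtain t where t: "t \<in> {0..t1}" "f t = 0" by blast
    then have "obs 0 * (t * obs 0) = obs 0 * (\<nu> * obs (t * obs 0))" by (simp add: f_def power2_eq_square mult_ac)
    then have "t * obs 0 = \<nu> * obs (t * obs 0)" using a0 by simp
    moreover have "t * obs 0 \<in> I" using multiples_in_I[OF I0] t t1 by simp
    moreover have "\<bar>t * obs 0\<bar> < \<kappa>"
    proof -
      have "\<bar>t * obs 0\<bar> \<le> \<bar>obs 0\<bar> * t1" using t by (simp add: abs_mult mult.commute mult_right_mono)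
      then show ?thesis using t1(3) by linarith
    qed
    ultimately show ?thesis by blast
  qed
  with \<epsilon> show ?thesis by blast
qed

text \<open>The function \<open>s - \<nu>0 * obs s\<close> changes sign at \<open>s0\<close> because its derivative does not vanish, and the
change of sign persists for nearby \<open>\<nu>\<close>.\<close>
lemma nearby_solution:
  assumes s0: "s0 \<in> I" "s0 = \<nu>0 * obs s0" and ne: "\<nu>0 * obs' s0 \<noteq> 1"
    and \<rho>: "\<rho> > 0" "\<And>s. \<bar>s - s0\<bar> < \<rho> \<Longrightarrow> s \<in> I" and \<kappa>: "\<kappa> > 0"
  shows "\<exists>\<epsilon>>0. \<forall>\<nu>. \<bar>\<nu> - \<nu>0\<bar> < \<epsilon> \<longrightarrow> (\<exists>s\<in>I. \<bar>s - s0\<bar> < \<kappa> \<and> s = \<nu> * obs s)"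
proof -
  define D where "D = 1 - \<nu>0 * obs' s0"
  have D: "D \<noteq> 0" using ne by (simp add: D_def)
  \<comment> \<open>The factor \<open>D\<close> makes the derivative at \<open>s0\<close> equal to \<open>D * D\<close>, so the change of sign is always from negative to positive.\<close>
  define f where "f \<nu> s = D * (s - \<nu> * obs s)" for \<nu> s
  have "((\<lambda>s. D * (s - \<nu>0 * obs s)) has_real_derivative D * (1 - \<nu>0 * obs' s0)) (at s0 within I)"
    by (auto intro!: derivative_eq_intros obs_derivative s0)
  then have "((\<lambda>s. (f \<nu>0 s - f \<nu>0 s0) / (s - s0)) \<longlongrightarrow> D * D) (at s0 within I)"
    unfolding has_field_derivative_iff f_def D_def .
  moreover have "f \<nu>0 s0 = 0" using s0(2) by (simp add: f_def)
  ultimately have "((\<lambda>s. f \<nu>0 s / (s - s0)) \<longlongrightarrow> D * D) (at s0 within I)" by simp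
  moreover have "0 < D * D" using D by (metis not_real_square_gt_zero)
  ultimately have "\<forall>\<^sub>F s in at s0 within I. 0 < f \<nu>0 s / (s - s0)" by (rule order_tendstoD(1))
  then obtain d where d: "d > 0" "\<forall>s\<in>I. s \<noteq> s0 \<and> dist s s0 < d \<longrightarrow> 0 < f \<nu>0 s / (s - s0)"
    unfolding eventually_at by blast
  define e where "e = min (min d \<rho>) \<kappa> / 2"
  have e: "e > 0" "e < d" "e < \<rho>" "e < \<kappa>" using d \<rho> \<kappa> by (auto simp: e_def min_def)
  have sub: "{s0 - e..s0 + e} \<subseteq> I" using \<rho>(2) e by (auto simp: abs_le_iff abs_less_iff)
  have "s0 + e \<in> I" "s0 - e \<in> I" using sub e by auto
  then have "0 < f \<nu>0 (s0 + e) / (s0 + e - s0)" "0 < f \<nu>0 (s0 - e) / (s0 - e - s0)"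
    using d(2)[rule_format, of "s0 + e"] d(2)[rule_format, of "s0 - e"] e by (auto simp: dist_real_def)
  then have pos: "0 < f \<nu>0 (s0 + e)" "f \<nu>0 (s0 - e) < 0" using e by (simp_all add: zero_less_divide_iff divide_less_0_iff)
  have "((\<lambda>\<nu>. f \<nu> s) \<longlongrightarrow> f \<nu>0 s) (at \<nu>0)" for s unfolding f_def by (intro tendsto_intros)
  then have ev: "\<forall>\<^sub>F \<nu> in at \<nu>0. f \<nu> (s0 - e) < 0 \<and> 0 < f \<nu> (s0 + e)"
    using pos by (intro eventually_conj order_tendstoD)
  then obtain \<epsilon> where \<epsilon>: "\<epsilon> > 0" "\<forall>\<nu>\<in>UNIV. \<nu> \<noteq> \<nu>0 \<and> dist \<nu> \<nu>0 < \<epsilon> \<longrightarrow> f \<nu> (s0 - e) < 0 \<and> 0 < f \<nu> (s0 + e)"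
    unfolding eventually_at by blast
  have "\<exists>s\<in>I. \<bar>s - s0\<bar> < \<kappa> \<and> s = \<nu> * obs s" if \<nu>: "\<bar>\<nu> - \<nu>0\<bar> < \<epsilon>" for \<nu>
  proof -
    have sg: "f \<nu> (s0 - e) \<le> 0" "0 \<le> f \<nu> (s0 + e)"
      using \<epsilon>(2) \<nu> pos by (cases "\<nu> = \<nu>0"; force simp: dist_real_def)+
    have cont: "continuous_on {s0 - e..s0 + e} (f \<nu>)"
      unfolding f_def by (intro continuous_intros continuous_on_subset[OF obs_continuous sub])
    from IVT_interval[OF _ cont sg] e obtain s where "s \<in> {s0 - e..s0 + e}" "f \<nu> s = 0" by auto
    then show ?thesis using D e sub by (intro bexI[of _ s]) (auto simp: f_def abs_less_iff)
  qed
  with \<epsilon>(1) show ?thesis by blast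
qed

text \<open>By the expansion of \<open>obs\<close> the difference \<open>\<nu>0 - s / obs s\<close> has the same strict sign on both sides of \<open>s0\<close>
and vanishes at \<open>s0\<close>. By the intermediate value theorem it takes a small value of this sign on either side.\<close>
lemma two_solutions:
  assumes s0: "s0 \<in> I" "s0 = \<nu>0 * obs s0" "obs s0 \<noteq> 0" and \<nu>0: "0 < \<nu>0" "\<nu>0 < \<nu>s" and crit: "\<nu>0 * obs' s0 = 1"
    and lim: "((\<lambda>s. (obs s - obs s0 - (s - s0) * obs' s0) / (s - s0)\<^sup>2) \<longlongrightarrow> c) (at s0 within I)" and c: "c \<noteq> 0"
  shows "\<exists>\<nu>\<in>{0<..<\<nu>s}. \<exists>s1\<in>I. \<exists>s2\<in>I. s1 \<noteq> s2 \<and> s1 = \<nu> * obs s1 \<and> s2 = \<nu> * obs s2"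
proof -
  obtain \<rho> where \<rho>: "\<rho> > 0" "\<And>s. \<bar>s - s0\<bar> < \<rho> \<Longrightarrow> s \<in> I"
    "\<And>s. \<bar>s - s0\<bar> < \<rho> \<Longrightarrow> 0 < obs s * obs s0 \<and> s / obs s < \<nu>s \<and> 0 < s / obs s"
    using good_region[OF s0, of] \<nu>0 by (metis atLeastLessThan_iff less_imp_le)
  have "((\<lambda>s. (obs s - obs s0 - (s - s0) * obs' s0) / (s - s0)\<^sup>2 * c) \<longlongrightarrow> c * c) (at s0 within I)"
    by (intro tendsto_intros lim)
  moreover have "0 < c * c" using c by (metis not_real_square_gt_zero)
  ultimately have "\<forall>\<^sub>F s in at s0 within I. 0 < (obs s - obs s0 - (s - s0) * obs' s0) / (s - s0)\<^sup>2 * c"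
    by (rule order_tendstoD(1))
  then obtain d where d: "d > 0" "\<forall>s\<in>I. s \<noteq> s0 \<and> dist s s0 < d \<longrightarrow> 0 < (obs s - obs s0 - (s - s0) * obs' s0) / (s - s0)\<^sup>2 * c"
    unfolding eventually_at by blast
  \<comment> \<open>The factor \<open>c * obs s0\<close> makes the sign positive on both sides of \<open>s0\<close>.\<close>
  define \<psi> where "\<psi> s = (\<nu>0 - s / obs s) * (c * obs s0)" for s
  have \<psi>0: "\<psi> s0 = 0"
  proof -
    have "s0 / obs s0 = \<nu>0" using s0(2,3) by (simp add: divide_eq_eq)
    then show ?thesis by (simp add: \<psi>_def)
  qed
  have \<psi>_pos: "0 < \<psi> s" if s: "s \<noteq> s0" "\<bar>s - s0\<bar> < \<rho>" "\<bar>s - s0\<bar> < d" for s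
  proof -
    define q where "q = (obs s - obs s0 - (s - s0) * obs' s0) / (s - s0)\<^sup>2"
    have q: "0 < q * c" using d(2) \<rho>(2)[OF s(2)] s by (simp add: q_def dist_real_def)
    have as: "obs s = obs s0 + (s - s0) * obs' s0 + q * (s - s0)\<^sup>2" using s(1) by (simp add: q_def)
    have "\<nu>0 * obs s = \<nu>0 * obs s0 + (s - s0) * (\<nu>0 * obs' s0) + \<nu>0 * q * (s - s0)\<^sup>2"
      by (subst as) (simp add: algebra_simps)
    then have eq: "\<nu>0 * obs s - s = \<nu>0 * q * (s - s0)\<^sup>2" using s0(2) crit by simp
    have pos: "0 < obs s * obs s0" using \<rho>(3)[OF s(2)] by blast
    then have ne: "obs s \<noteq> 0" by auto
    have "\<psi> s = (\<nu>0 * obs s - s) / obs s * (c * obs s0)" using ne by (simp add: \<psi>_def field_simps)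
    also have "\<dots> = (\<nu>0 * (s - s0)\<^sup>2) * (q * c) * (obs s * obs s0) / (obs s)\<^sup>2"
      unfolding eq using ne by (simp add: field_simps power2_eq_square)
    also have "\<dots> > 0"
    proof -
      have "0 < \<nu>0 * (s - s0)\<^sup>2" using \<nu>0 s(1) by simp
      then show ?thesis using ne by (intro divide_pos_pos[OF mult_pos_pos[OF mult_pos_pos[OF _ q] pos]]) auto
    qed
    finally show ?thesis .
  qed
  define e where "e = min \<rho> d / 2"
  have e: "e > 0" "e < \<rho>" "e < d" using \<rho> d by (auto simp: e_def min_def)
  have near: "\<bar>s - s0\<bar> < \<rho>" if "s \<in> {s0 - e..s0 + e}" for s using that e by auto
  define m where "m = min (\<psi> (s0 - e)) (\<psi> (s0 + e))"
  have m: "m > 0" using \<psi>_pos[of "s0 - e"] \<psi>_pos[of "s0 + e"] e by (simp add: m_def)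
  have ne: "obs s \<noteq> 0" if "s \<in> {s0 - e..s0 + e}" for s using \<rho>(3)[OF near[OF that]] by auto
  have cont: "continuous_on {s0 - e..s0 + e} \<psi>"
    unfolding \<psi>_def using ne \<rho>(2)[OF near]
    by (intro continuous_intros continuous_on_subset[OF obs_continuous]) auto
  have "\<exists>s\<in>{s0..s0 + e}. \<psi> s = m"
    using e m \<psi>0 by (intro IVT_interval continuous_on_subset[OF cont]) (auto simp: m_def)
  then obtain s2 where s2: "s2 \<in> {s0..s0 + e}" "\<psi> s2 = m" by blast
  have "\<exists>s\<in>{s0 - e..s0}. \<psi> s = m"
    using e m \<psi>0 IVT2'[of \<psi> s0 m "s0 - e"] continuous_on_subset[OF cont, of "{s0 - e..s0}"] by (auto simp: m_def)
  then obtain s1 where s1: "s1 \<in> {s0 - e..s0}" "\<psi> s1 = m" by blast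
  have in1: "s1 \<in> {s0 - e..s0 + e}" and in2: "s2 \<in> {s0 - e..s0 + e}" using s1 s2 e by auto
  have "s1 \<noteq> s0" "s2 \<noteq> s0" using s1 s2 m \<psi>0 by auto
  then have "s1 \<noteq> s2" using s1 s2 by auto
  moreover have "s1 / obs s1 = s2 / obs s2"
  proof -
    have "(\<nu>0 - s1 / obs s1) * (c * obs s0) = (\<nu>0 - s2 / obs s2) * (c * obs s0)" using s1(2) s2(2) by (simp add: \<psi>_def)
    moreover have "c * obs s0 \<noteq> 0" using c s0(3) by simp
    ultimately have "\<nu>0 - s1 / obs s1 = \<nu>0 - s2 / obs s2" by (metis mult_right_cancel)
    then show ?thesis by simp
  qed
  moreover have "s1 / obs s1 \<in> {0<..<\<nu>s}" using \<rho>(3)[OF near[OF in1]] by simp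
  moreover have "s1 = s1 / obs s1 * obs s1" "s2 = s2 / obs s2 * obs s2" using ne[OF in1] ne[OF in2] by auto
  ultimately show ?thesis using \<rho>(2)[OF near[OF in1]] \<rho>(2)[OF near[OF in2]] by metis
qed


lemma differentiable_curve_const:
  "differentiable_curve (B 1) (N 1) (\<lambda>_. h) \<tau>"
  unfolding differentiable_curve_def
  by (rule bexI[of _ 0]) (simp_all add: B_zero N_0)

text \<open>If \<open>obs s0 = 0\<close> then \<open>s0 = 0\<close>, and local uniqueness leaves only the distribution \<open>h0\<close>, for every
\<open>\<nu>\<close>. Otherwise the curve is \<open>s \<mapsto> (s / obs s, stat s)\<close>. For \<open>\<nu>0 = 0\<close> only \<open>\<nu> \<ge> 0\<close> is admissible, so the curve
cannot pass through \<open>\<nu>0\<close>; it runs quadratically into the endpoint and returns. All parametrisations are stretched so that the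
open interval of parameters covers the closed ball of radius \<open>\<delta>\<close>.\<close>
lemma solution_branch:
  assumes Ks: "\<forall>u\<in>I. N 1 (stat u) \<le> Ks"
  defines "W \<equiv> WW r B N Ks" and "F \<equiv> FF r T \<alpha> \<beta> B N Ks" and "\<Theta> \<equiv> Theta r T \<alpha> \<beta> B N Ks"
    and "D \<equiv> DhF r T \<alpha> \<beta> B N Ks"
  assumes \<nu>0: "\<nu>0 \<in> {0..<\<nu>s}" and h0: "h0 \<in> W" "F \<nu>0 h0 = 0"
    and nondegenerate: "invertible_op (VV B) (N 1) (D \<nu>0 h0) \<or>
      (DhhF r T \<alpha> \<beta> B N Ks \<nu>0 h0 (\<Theta> \<nu>0 h0) (\<Theta> \<nu>0 h0) \<alpha> \<noteq> 0 \<and> h0 \<alpha> \<noteq> 0)"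
  shows "\<exists>\<delta>>0.
     (\<exists>G hh.
        (\<forall>\<tau>\<in>{-\<delta><..<\<delta>}. G \<tau> \<in> {0..\<nu>s} \<and> hh \<tau> \<in> W \<and>
           G differentiable (at \<tau>) \<and> differentiable_curve (B 1) (N 1) hh \<tau>) \<and>
        G 0 = \<nu>0 \<and> hh 0 = h0 \<and>
        {(\<nu>, h). \<nu> \<in> {0..\<nu>s} \<and> h \<in> W \<and> \<bar>\<nu> - \<nu>0\<bar> + N 1 (h - h0) \<le> \<delta> \<and> F \<nu> h = 0}
          \<subseteq> (\<lambda>\<tau>. (G \<tau>, hh \<tau>)) ` {-\<delta><..<\<delta>}) \<and>
     (invertible_op (VV B) (N 1) (D \<nu>0 h0) \<longrightarrow>
        (\<exists>\<epsilon>>0. \<forall>\<nu>\<in>{0..\<nu>s}. \<bar>\<nu> - \<nu>0\<bar> < \<epsilon> \<longrightarrow>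
           (\<exists>!h. h \<in> W \<and> \<bar>\<nu> - \<nu>0\<bar> + N 1 (h - h0) \<le> \<delta> \<and> F \<nu> h = 0))) \<and>
     (\<nu>0 > 0 \<and> \<not> invertible_op (VV B) (N 1) (D \<nu>0 h0) \<longrightarrow>
        (\<exists>\<nu>\<in>{0<..<\<nu>s}. \<exists>h1\<in>W. \<exists>h2\<in>W. h1 \<noteq> h2 \<and> F \<nu> h1 = 0 \<and> F \<nu> h2 = 0))"
proof -
  have \<nu>0': "\<nu>0 \<in> {0..\<nu>s}" "0 \<le> \<nu>0" "\<nu>0 < \<nu>s" using \<nu>0 by auto
  define s0 where "s0 = \<nu>0 * h0 \<alpha>"
  have s0: "s0 \<in> I" unfolding s0_def by (rule WW_in_I[OF \<nu>0'(1) h0(1)[unfolded W_def]])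
  have h0_eq: "h0 = stat s0"
    using h0(2) FF_eq_0_iff[OF Ks \<nu>0'(1) h0(1)[unfolded W_def]] by (simp add: F_def s0_def)
  have a0: "obs s0 = h0 \<alpha>" by (simp add: obs_def h0_eq[symmetric])
  have s0_eq: "s0 = \<nu>0 * obs s0" unfolding a0 by (rule s0_def)
  have s0_0: "\<nu>0 = 0 \<Longrightarrow> s0 = 0" by (simp add: s0_def)
  have inv: "invertible_op (VV B) (N 1) (D \<nu>0 h0) \<longleftrightarrow> \<nu>0 * obs' s0 \<noteq> 1"
    unfolding D_def DhF_eq[OF Ks \<nu>0'(1) h0(1)[unfolded W_def]] s0_def[symmetric] obs'_def
    by (rule invertible_iff[OF resp_B2(2)[OF s0]])
  obtain C1 where C1: "C1 \<ge> 0" "\<And>h. h \<in> B 1 \<Longrightarrow> \<bar>h \<alpha>\<bar> \<le> C1 * N 1 h"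
    using eval_bound[OF \<alpha>_CT] by (metis one_le_numeral)
  \<comment> \<open>A Lipschitz constant of \<open>(\<nu>, h) \<mapsto> \<nu> * h \<alpha>\<close>, made at least one.\<close>
  define C where "C = \<nu>s * C1 + \<bar>h0 \<alpha>\<bar> + 1"
  have C: "C \<ge> 1" using C1(1) \<nu>s_pos by (simp add: C_def)
  have W1: "h \<in> B 1" if "h \<in> W" for h using WW_D that by (simp add: W_def)
  have sol: "\<nu> * h \<alpha> \<in> I \<and> h = stat (\<nu> * h \<alpha>) \<and> \<nu> * h \<alpha> = \<nu> * obs (\<nu> * h \<alpha>) \<and>
      \<bar>\<nu> * h \<alpha> - s0\<bar> \<le> C * (\<bar>\<nu> - \<nu>0\<bar> + N 1 (h - h0))"
    if \<nu>: "\<nu> \<in> {0..\<nu>s}" and h: "h \<in> W" "F \<nu> h = 0" for \<nu> h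
  proof -
    have stat: "h = stat (\<nu> * h \<alpha>)" using FF_eq_0_iff[OF Ks \<nu> h(1)[unfolded W_def]] h(2) by (simp add: F_def)
    then have "obs (\<nu> * h \<alpha>) = h \<alpha>" unfolding obs_def by (rule arg_cong[where f = "\<lambda>h. h \<alpha>", symmetric])
    moreover have "\<bar>\<nu> * h \<alpha> - s0\<bar> \<le> C * (\<bar>\<nu> - \<nu>0\<bar> + N 1 (h - h0))"
    proof -
      have hB: "h - h0 \<in> B 1" by (intro B_diff W1 h h0) simp
      have nn: "0 \<le> N 1 (h - h0)" by (rule N_nonneg[OF _ hB]) simp
      have "\<nu> * h \<alpha> - s0 = \<nu> * (h - h0) \<alpha> + (\<nu> - \<nu>0) * h0 \<alpha>" by (simp add: s0_def algebra_simps)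
      then have "\<bar>\<nu> * h \<alpha> - s0\<bar> \<le> \<bar>\<nu>\<bar> * \<bar>(h - h0) \<alpha>\<bar> + \<bar>\<nu> - \<nu>0\<bar> * \<bar>h0 \<alpha>\<bar>"
        unfolding abs_mult[symmetric] by (simp only: abs_triangle_ineq)
      also have "\<dots> \<le> \<nu>s * (C1 * N 1 (h - h0)) + \<bar>\<nu> - \<nu>0\<bar> * \<bar>h0 \<alpha>\<bar>"
        using \<nu> C1(2)[OF hB] by (intro add_right_mono mult_mono) auto
      also have "\<dots> \<le> C * N 1 (h - h0) + C * \<bar>\<nu> - \<nu>0\<bar>"
      proof (rule add_mono)
        have "(\<nu>s * C1) * N 1 (h - h0) \<le> C * N 1 (h - h0)" by (intro mult_right_mono nn) (simp add: C_def)
        then show "\<nu>s * (C1 * N 1 (h - h0)) \<le> C * N 1 (h - h0)" by (simp add: mult.assoc)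
        have "\<bar>h0 \<alpha>\<bar> * \<bar>\<nu> - \<nu>0\<bar> \<le> C * \<bar>\<nu> - \<nu>0\<bar>" using C1(1) \<nu>s_pos by (intro mult_right_mono) (auto simp: C_def)
        then show "\<bar>\<nu> - \<nu>0\<bar> * \<bar>h0 \<alpha>\<bar> \<le> C * \<bar>\<nu> - \<nu>0\<bar>" by (simp add: mult.commute)
      qed
      finally show ?thesis by (simp add: algebra_simps)
    qed
    ultimately show ?thesis using stat WW_in_I[OF \<nu> h(1)[unfolded W_def]] by auto
  qed
  have stat_sol: "stat s \<in> W \<and> F \<nu> (stat s) = 0" if "s \<in> I" "\<nu> \<in> {0..\<nu>s}" "s = \<nu> * obs s" for s \<nu>
    using stat_WW[OF Ks that(1)] FF_stat_eq_0[OF Ks that(2,1,3)] by (simp add: W_def F_def)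
  have "\<exists>\<eta>>0. \<nu>0 * obs' s0 \<noteq> 1 \<longrightarrow> (\<forall>\<nu>\<in>{0..\<nu>s}. \<bar>\<nu> - \<nu>0\<bar> < \<eta> \<longrightarrow> (\<forall>s\<in>I. \<forall>s'\<in>I. \<bar>s - s0\<bar> < \<eta> \<longrightarrow> \<bar>s' - s0\<bar> < \<eta> \<longrightarrow>
    s = \<nu> * obs s \<longrightarrow> s' = \<nu> * obs s' \<longrightarrow> s = s'))"
  proof (cases "\<nu>0 * obs' s0 = 1")
    case False
    then show ?thesis using locally_unique[OF s0 \<nu>0'(1)] by blast
  qed (auto intro: exI[of _ 1])
  then obtain \<eta> where \<eta>: "\<eta> > 0" and loc_uniq: "\<And>\<nu> s s'. \<nu>0 * obs' s0 \<noteq> 1 \<Longrightarrow> \<nu> \<in> {0..\<nu>s} \<Longrightarrow> \<bar>\<nu> - \<nu>0\<bar> < \<eta> \<Longrightarrow>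
      s \<in> I \<Longrightarrow> s' \<in> I \<Longrightarrow> \<bar>s - s0\<bar> < \<eta> \<Longrightarrow> \<bar>s' - s0\<bar> < \<eta> \<Longrightarrow> s = \<nu> * obs s \<Longrightarrow> s' = \<nu> * obs s' \<Longrightarrow> s = s'"
    by blast
  have close: "\<bar>\<nu> * h \<alpha> - s0\<bar> \<le> C * \<delta> \<and> \<bar>\<nu> - \<nu>0\<bar> \<le> \<delta>"
    if "\<nu> \<in> {0..\<nu>s}" "h \<in> W" "F \<nu> h = 0" "\<bar>\<nu> - \<nu>0\<bar> + N 1 (h - h0) \<le> \<delta>" for \<nu> h \<delta>
  proof -
    have "0 \<le> N 1 (h - h0)" by (intro N_nonneg B_diff W1 that h0) auto
    moreover have "C * (\<bar>\<nu> - \<nu>0\<bar> + N 1 (h - h0)) \<le> C * \<delta>" using C that(4) by (intro mult_left_mono) auto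
    ultimately show ?thesis using sol[OF that(1-3)] that(4) by linarith
  qed
  have uniq: "h = h'"
    if \<delta>: "C * \<delta> < \<eta>" "\<delta> < \<eta>" and ne: "\<nu>0 * obs' s0 \<noteq> 1" and \<nu>: "\<nu> \<in> {0..\<nu>s}"
      and h: "h \<in> W" "F \<nu> h = 0" "\<bar>\<nu> - \<nu>0\<bar> + N 1 (h - h0) \<le> \<delta>"
      and h': "h' \<in> W" "F \<nu> h' = 0" "\<bar>\<nu> - \<nu>0\<bar> + N 1 (h' - h0) \<le> \<delta>" for \<delta> \<nu> h h'
  proof -
    note c = close[OF \<nu> h] close[OF \<nu> h']
    have "\<nu> * h \<alpha> = \<nu> * h' \<alpha>"
      by (rule loc_uniq[OF ne \<nu>]) (use c \<delta> sol[OF \<nu> h(1,2)] sol[OF \<nu> h'(1,2)] in auto)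
    then show ?thesis using sol[OF \<nu> h(1,2)] sol[OF \<nu> h'(1,2)] by metis
  qed
  show ?thesis
  proof (cases "obs s0 = 0")
    case True
    then have s00: "s0 = 0" using s0_eq by simp
    have ne: "\<nu>0 * obs' s0 \<noteq> 1" using nondegenerate True a0 inv by auto
    define \<delta> where "\<delta> = min (\<eta> / (2 * C)) (if \<nu>0 > 0 then min \<nu>0 (\<nu>s - \<nu>0) / 2 else \<nu>s / 2)"
    have \<delta>: "\<delta> > 0" using \<eta> C \<nu>0' \<nu>s_pos by (auto simp: \<delta>_def)
    have "C * \<delta> \<le> C * (\<eta> / (2 * C))" using C by (intro mult_left_mono) (auto simp: \<delta>_def)
    also have "\<dots> < \<eta>" using C \<eta> by simp
    finally have \<delta>\<eta>: "C * \<delta> < \<eta>" .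
    have "1 * \<delta> \<le> C * \<delta>" using C \<delta> by (intro mult_right_mono) auto
    then have \<delta>\<eta>': "\<delta> < \<eta>" using \<delta>\<eta> by simp
    have h0_sol: "F \<nu> h0 = 0" if "\<nu> \<in> {0..\<nu>s}" for \<nu>
      using stat_sol[OF s0 that] True s00 h0_eq by simp
    have N00: "N 1 (h0 - h0) = 0" using N_0[of 1] by simp
    have only: "h = h0" if "\<nu> \<in> {0..\<nu>s}" "h \<in> W" "F \<nu> h = 0" "\<bar>\<nu> - \<nu>0\<bar> + N 1 (h - h0) \<le> \<delta>" for \<nu> h
    proof (rule uniq[OF \<delta>\<eta> \<delta>\<eta>' ne that h0(1) h0_sol[OF that(1)]])
      show "\<bar>\<nu> - \<nu>0\<bar> + N 1 (h0 - h0) \<le> \<delta>" using close[OF that] N00 by simp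
    qed
    define G where "G = (\<lambda>\<tau>. if \<nu>0 > 0 then \<nu>0 + 2 * \<tau> else 2 / \<delta> * \<tau>\<^sup>2)"
    have G_range: "G \<tau> \<in> {0..\<nu>s}" if \<tau>: "\<tau> \<in> {-\<delta><..<\<delta>}" for \<tau>
    proof (cases "\<nu>0 > 0")
      case True
      then have "2 * \<delta> \<le> min \<nu>0 (\<nu>s - \<nu>0)" by (simp add: \<delta>_def min_def)
      then show ?thesis using \<tau> True by (auto simp: G_def)
    next
      case False
      have "\<bar>\<tau>\<bar>\<^sup>2 \<le> \<delta>\<^sup>2" using \<tau> by (intro power_mono) auto
      then have "2 / \<delta> * \<tau>\<^sup>2 \<le> 2 / \<delta> * \<delta>\<^sup>2" using \<delta> by (intro mult_left_mono) auto
      also have "\<dots> = 2 * \<delta>" using \<delta> by (simp add: power2_eq_square)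
      also have "\<dots> \<le> \<nu>s" using False by (simp add: \<delta>_def)
      finally show ?thesis using \<delta> False by (simp add: G_def)
    qed
    have G_diff: "G differentiable (at \<tau>)" for \<tau>
      unfolding G_def by (cases "\<nu>0 > 0") (use \<delta> in \<open>auto intro!: derivative_intros\<close>)
    have "\<exists>\<tau>\<in>{-\<delta><..<\<delta>}. G \<tau> = \<nu>" if \<nu>: "\<nu> \<in> {0..\<nu>s}" "\<bar>\<nu> - \<nu>0\<bar> \<le> \<delta>" for \<nu>
    proof (cases "\<nu>0 > 0")
      case True
      then show ?thesis using \<nu>(2) \<delta> by (intro bexI[of _ "(\<nu> - \<nu>0) / 2"]) (auto simp: G_def abs_le_iff field_simps)
    next
      case False
      then have 0: "\<nu>0 = 0" using \<nu>0' by simp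
      define \<tau> where "\<tau> = sqrt (\<nu> * \<delta> / 2)"
      have nn: "0 \<le> \<nu> * \<delta> / 2" using \<nu> \<delta> by simp
      have "\<nu> * \<delta> / 2 \<le> \<delta> * \<delta> / 2" using \<nu> 0 \<delta> by (intro divide_right_mono mult_right_mono) auto
      also have "\<dots> < \<delta>\<^sup>2" using \<delta> by (simp add: power2_eq_square)
      finally have "\<tau> < \<delta>" unfolding \<tau>_def using \<delta> by (intro real_less_lsqrt) auto
      moreover have "0 \<le> \<tau>" using nn by (simp add: \<tau>_def)
      moreover have "G \<tau> = \<nu>" using False nn \<delta> by (simp add: G_def \<tau>_def)
      ultimately show ?thesis using \<delta> by (intro bexI[of _ \<tau>]) auto
    qed
    note G_onto = this
    have part1: "\<exists>G hh.
        (\<forall>\<tau>\<in>{-\<delta><..<\<delta>}. G \<tau> \<in> {0..\<nu>s} \<and> hh \<tau> \<in> W \<and>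
           G differentiable (at \<tau>) \<and> differentiable_curve (B 1) (N 1) hh \<tau>) \<and>
        G 0 = \<nu>0 \<and> hh 0 = h0 \<and>
        {(\<nu>, h). \<nu> \<in> {0..\<nu>s} \<and> h \<in> W \<and> \<bar>\<nu> - \<nu>0\<bar> + N 1 (h - h0) \<le> \<delta> \<and> F \<nu> h = 0}
          \<subseteq> (\<lambda>\<tau>. (G \<tau>, hh \<tau>)) ` {-\<delta><..<\<delta>}"
    proof (intro exI[of _ G] exI[of _ "\<lambda>_. h0"] conjI ballI)
      show "G 0 = \<nu>0" using \<nu>0' by (simp add: G_def)
      show "{(\<nu>, h). \<nu> \<in> {0..\<nu>s} \<and> h \<in> W \<and> \<bar>\<nu> - \<nu>0\<bar> + N 1 (h - h0) \<le> \<delta> \<and> F \<nu> h = 0}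
          \<subseteq> (\<lambda>\<tau>. (G \<tau>, h0)) ` {-\<delta><..<\<delta>}"
      proof clarify
        fix \<nu> h assume *: "\<nu> \<in> {0..\<nu>s}" "h \<in> W" "\<bar>\<nu> - \<nu>0\<bar> + N 1 (h - h0) \<le> \<delta>" "F \<nu> h = 0"
        have "h = h0" by (rule only[OF *(1,2,4,3)])
        moreover obtain \<tau> where "\<tau> \<in> {-\<delta><..<\<delta>}" "G \<tau> = \<nu>"
          using G_onto[OF *(1)] close[OF *(1,2,4,3)] by blast
        ultimately show "(\<nu>, h) \<in> (\<lambda>\<tau>. (G \<tau>, h0)) ` {-\<delta><..<\<delta>}" by auto
      qed
    qed (use G_range G_diff h0 differentiable_curve_const in auto)
    have part2: "\<exists>\<epsilon>>0. \<forall>\<nu>\<in>{0..\<nu>s}. \<bar>\<nu> - \<nu>0\<bar> < \<epsilon> \<longrightarrow>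
           (\<exists>!h. h \<in> W \<and> \<bar>\<nu> - \<nu>0\<bar> + N 1 (h - h0) \<le> \<delta> \<and> F \<nu> h = 0)"
    proof (intro exI[of _ \<delta>] conjI ballI impI \<delta> ex1I[of _ h0])
      fix \<nu> assume \<nu>: "\<nu> \<in> {0..\<nu>s}" "\<bar>\<nu> - \<nu>0\<bar> < \<delta>"
      show "h0 \<in> W" by (rule h0)
      show "\<bar>\<nu> - \<nu>0\<bar> + N 1 (h0 - h0) \<le> \<delta>" using \<nu> N00 by simp
      show "F \<nu> h0 = 0" by (rule h0_sol[OF \<nu>(1)])
      show "h = h0" if "h \<in> W \<and> \<bar>\<nu> - \<nu>0\<bar> + N 1 (h - h0) \<le> \<delta> \<and> F \<nu> h = 0" for h
        using only[OF \<nu>(1)] that by blast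
    qed
    show ?thesis using \<delta> part1 part2 inv ne by blast
  next
    case False
    obtain \<rho> where \<rho>: "\<rho> > 0"
      and good: "\<And>s. s \<in> I \<Longrightarrow> \<bar>s - s0\<bar> < \<rho> \<Longrightarrow> 0 < obs s * obs s0 \<and> s / obs s < \<nu>s \<and> (\<nu>0 > 0 \<longrightarrow> 0 < s / obs s)"
      and ball: "\<And>s. \<nu>0 > 0 \<Longrightarrow> \<bar>s - s0\<bar> < \<rho> \<Longrightarrow> s \<in> I"
      using good_region[OF s0 s0_eq False \<nu>0] by blast
    define \<delta> where "\<delta> = min (min \<rho> \<eta>) (\<bar>obs s0\<bar> * \<nu>s) / (2 * C)"
    have \<delta>: "\<delta> > 0" using \<rho> \<eta> C False \<nu>s_pos by (simp add: \<delta>_def)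
    have \<delta>2: "2 * C * \<delta> = min (min \<rho> \<eta>) (\<bar>obs s0\<bar> * \<nu>s)" using C by (simp add: \<delta>_def)
    have C\<delta>: "C * \<delta> > 0" using C \<delta> by simp
    have \<delta>\<rho>: "C * \<delta> < \<rho>" "2 * C * \<delta> \<le> \<rho>" and \<delta>\<eta>: "C * \<delta> < \<eta>" using \<delta>2 C\<delta> by auto
    have "1 * \<delta> \<le> C * \<delta>" using C \<delta> by (intro mult_right_mono) auto
    then have \<delta>\<eta>': "\<delta> < \<eta>" using \<delta>\<eta> by simp
    \<comment> \<open>With this \<open>c\<close> the curve for \<open>\<nu>0 = 0\<close> reaches \<open>\<bar>s\<bar> = 2 * C * \<delta>\<close> at \<open>\<bar>\<tau>\<bar> = \<delta>\<close>.\<close>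
    define c where "c = 2 * C / (\<bar>obs s0\<bar> * \<delta>)"
    have c: "c > 0" using C \<delta> False by (simp add: c_def)
    define \<sigma> where "\<sigma> = (\<lambda>\<tau>. if \<nu>0 > 0 then s0 + 2 * C * \<tau> else c * \<tau>\<^sup>2 * obs s0)"
    have \<sigma>_near: "\<bar>\<sigma> \<tau> - s0\<bar> < \<rho> \<and> \<sigma> \<tau> \<in> I" if \<tau>: "\<tau> \<in> {-\<delta><..<\<delta>}" for \<tau>
    proof (cases "\<nu>0 > 0")
      case True
      have "2 * C * \<bar>\<tau>\<bar> < 2 * C * \<delta>" using \<tau> C by (intro mult_strict_left_mono) auto
      moreover have "\<bar>\<sigma> \<tau> - s0\<bar> = 2 * C * \<bar>\<tau>\<bar>" using True C by (simp add: \<sigma>_def abs_mult)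
      ultimately have "\<bar>\<sigma> \<tau> - s0\<bar> < \<rho>" using \<delta>\<rho>(2) by linarith
      then show ?thesis using ball[OF True] by blast
    next
      case 0: False
      then have s00: "s0 = 0" using s0_0 \<nu>0' by simp
      have "\<bar>\<tau>\<bar>\<^sup>2 < \<delta>\<^sup>2" using \<tau> by (intro power_strict_mono) auto
      then have "c * \<tau>\<^sup>2 * \<bar>obs s0\<bar> < c * \<delta>\<^sup>2 * \<bar>obs s0\<bar>"
        using c False by (intro mult_strict_right_mono mult_strict_left_mono) auto
      also have "\<dots> = 2 * C * \<delta>" using False \<delta> by (simp add: c_def power2_eq_square)
      finally have small: "c * \<tau>\<^sup>2 * \<bar>obs s0\<bar> < 2 * C * \<delta>" .
      have near: "\<bar>\<sigma> \<tau> - s0\<bar> < \<rho>" using small \<delta>\<rho>(2) 0 c s00 by (simp add: \<sigma>_def abs_mult)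
      have "c * \<tau>\<^sup>2 * \<bar>obs s0\<bar> \<le> \<nu>s * \<bar>obs s0\<bar>" using small \<delta>2 by (simp add: mult.commute)
      then have "c * \<tau>\<^sup>2 \<le> \<nu>s" using False by simp
      then have "\<sigma> \<tau> \<in> I" using multiples_in_I[OF s0, of "c * \<tau>\<^sup>2"] 0 c by (simp add: \<sigma>_def)
      with near show ?thesis by blast
    qed
    have \<sigma>_deriv: "(\<sigma> has_real_derivative (if \<nu>0 > 0 then 2 * C else c * (2 * \<tau>) * obs s0)) (at \<tau>)" for \<tau>
      unfolding \<sigma>_def by (cases "\<nu>0 > 0") (auto intro!: derivative_eq_intros)
    have \<sigma>_0: "\<sigma> 0 = s0" using s0_0 \<nu>0' by (auto simp: \<sigma>_def)
    have ne: "obs s \<noteq> 0" if "s \<in> I" "\<bar>s - s0\<bar> < \<rho>" for s using good[OF that] by auto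
    have quot_range: "\<sigma> \<tau> / obs (\<sigma> \<tau>) \<in> {0..\<nu>s}" if \<tau>: "\<tau> \<in> {-\<delta><..<\<delta>}" for \<tau>
    proof (cases "\<nu>0 > 0")
      case True
      then show ?thesis using good \<sigma>_near[OF \<tau>] by (auto intro: less_imp_le)
    next
      case 0: False
      have pos: "0 < obs (\<sigma> \<tau>) * obs s0" using good \<sigma>_near[OF \<tau>] by blast
      have "\<sigma> \<tau> / obs (\<sigma> \<tau>) = c * \<tau>\<^sup>2 * (obs (\<sigma> \<tau>) * obs s0) / (obs (\<sigma> \<tau>))\<^sup>2"
        using 0 ne \<sigma>_near[OF \<tau>] by (simp add: \<sigma>_def power2_eq_square)
      also have "\<dots> \<ge> 0" using c pos by (intro divide_nonneg_nonneg mult_nonneg_nonneg[OF _ less_imp_le[OF pos]]) auto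
      finally show ?thesis using good \<sigma>_near[OF \<tau>] by (auto intro: less_imp_le)
    qed
    have \<sigma>_onto: "\<exists>\<tau>\<in>{-\<delta><..<\<delta>}. \<sigma> \<tau> = s" if s: "s \<in> I" "\<bar>s - s0\<bar> \<le> C * \<delta>" "s = \<nu> * obs s" "0 \<le> \<nu>" for s \<nu>
    proof (cases "\<nu>0 > 0")
      case True
      have "\<bar>(s - s0) / (2 * C)\<bar> \<le> \<delta> / 2" using s(2) C by (simp add: abs_divide divide_le_eq mult.commute)
      then have "(s - s0) / (2 * C) \<in> {-\<delta><..<\<delta>}"
        unfolding greaterThanLessThan_iff abs_le_iff using \<delta> by linarith
      moreover have "\<sigma> ((s - s0) / (2 * C)) = s" using True C by (simp add: \<sigma>_def)
      ultimately show ?thesis by blast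
    next
      case 0: False
      then have s00: "s0 = 0" using s0_0 \<nu>0' by simp
      have pos: "0 < obs s * obs s0" using good[OF s(1)] s(2) \<delta>\<rho> by auto
      have "s / obs s0 = \<nu> * (obs s * obs s0) / (obs s0)\<^sup>2" using s(3) False by (simp add: power2_eq_square field_simps)
      also have "\<dots> \<ge> 0" by (rule divide_nonneg_nonneg[OF mult_nonneg_nonneg[OF s(4) less_imp_le[OF pos]]]) simp
      finally have nn: "0 \<le> s / obs s0" .
      define \<tau> where "\<tau> = sqrt (s / obs s0 / c)"
      have nn': "0 \<le> s / obs s0 / c" by (rule divide_nonneg_pos[OF nn c])
      have \<tau>2: "\<tau>\<^sup>2 = s / obs s0 / c" unfolding \<tau>_def by (rule real_sqrt_pow2[OF nn'])
      have "s / obs s0 = \<bar>s\<bar> / \<bar>obs s0\<bar>" using nn by (metis abs_divide abs_of_nonneg)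
      then have "s / obs s0 / c = \<bar>s\<bar> * \<delta> / (2 * C)" using False \<delta> C by (simp add: c_def)
      also have "\<dots> \<le> (C * \<delta>) * \<delta> / (2 * C)" using s(2) s00 \<delta> C by (intro divide_right_mono mult_right_mono) auto
      also have "\<dots> < \<delta>\<^sup>2" using C \<delta> by (simp add: power2_eq_square)
      finally have "\<tau> < \<delta>" unfolding \<tau>_def using \<delta> by (intro real_less_lsqrt) auto
      moreover have "0 \<le> \<tau>" unfolding \<tau>_def by (rule real_sqrt_ge_zero[OF nn'])
      moreover have "\<sigma> \<tau> = s" using 0 \<tau>2 c False by (simp add: \<sigma>_def)
      ultimately show ?thesis using \<delta> by (intro bexI[of _ \<tau>]) auto
    qed
    have part1: "\<exists>G hh.
        (\<forall>\<tau>\<in>{-\<delta><..<\<delta>}. G \<tau> \<in> {0..\<nu>s} \<and> hh \<tau> \<in> W \<and>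
           G differentiable (at \<tau>) \<and> differentiable_curve (B 1) (N 1) hh \<tau>) \<and>
        G 0 = \<nu>0 \<and> hh 0 = h0 \<and>
        {(\<nu>, h). \<nu> \<in> {0..\<nu>s} \<and> h \<in> W \<and> \<bar>\<nu> - \<nu>0\<bar> + N 1 (h - h0) \<le> \<delta> \<and> F \<nu> h = 0}
          \<subseteq> (\<lambda>\<tau>. (G \<tau>, hh \<tau>)) ` {-\<delta><..<\<delta>}"
    proof (intro exI[of _ "\<lambda>\<tau>. \<sigma> \<tau> / obs (\<sigma> \<tau>)"] exI[of _ "\<lambda>\<tau>. stat (\<sigma> \<tau>)"] conjI ballI)
      fix \<tau> assume \<tau>: "\<tau> \<in> {-\<delta><..<\<delta>}"
      show "\<sigma> \<tau> / obs (\<sigma> \<tau>) \<in> {0..\<nu>s}" by (rule quot_range[OF \<tau>])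
      show "stat (\<sigma> \<tau>) \<in> W" unfolding W_def by (rule stat_WW[OF Ks]) (use \<sigma>_near[OF \<tau>] in blast)
      show "(\<lambda>\<tau>. \<sigma> \<tau> / obs (\<sigma> \<tau>)) differentiable (at \<tau>)"
        by (rule quotient_curve_differentiable[OF \<tau> _ \<sigma>_deriv]) (use \<sigma>_near \<tau> ne in blast)+
      show "differentiable_curve (B 1) (N 1) (\<lambda>\<tau>. stat (\<sigma> \<tau>)) \<tau>"
        by (rule differentiable_curve_compose[OF \<tau> _ \<sigma>_deriv]) (use \<sigma>_near in blast)
    next
      show "\<sigma> 0 / obs (\<sigma> 0) = \<nu>0" unfolding \<sigma>_0 using s0_eq False by (simp add: divide_eq_eq)
      show "stat (\<sigma> 0) = h0" by (simp add: \<sigma>_0 h0_eq)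
      show "{(\<nu>, h). \<nu> \<in> {0..\<nu>s} \<and> h \<in> W \<and> \<bar>\<nu> - \<nu>0\<bar> + N 1 (h - h0) \<le> \<delta> \<and> F \<nu> h = 0}
          \<subseteq> (\<lambda>\<tau>. (\<sigma> \<tau> / obs (\<sigma> \<tau>), stat (\<sigma> \<tau>))) ` {-\<delta><..<\<delta>}"
      proof clarify
        fix \<nu> h assume *: "\<nu> \<in> {0..\<nu>s}" "h \<in> W" "\<bar>\<nu> - \<nu>0\<bar> + N 1 (h - h0) \<le> \<delta>" "F \<nu> h = 0"
        define s where "s = \<nu> * h \<alpha>"
        have s: "s \<in> I" "h = stat s" "s = \<nu> * obs s" "\<bar>s - s0\<bar> \<le> C * \<delta>"
          using sol[OF *(1,2,4)] close[OF *(1,2,4,3)] by (auto simp: s_def)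
        obtain \<tau> where \<tau>: "\<tau> \<in> {-\<delta><..<\<delta>}" "\<sigma> \<tau> = s"
          using \<sigma>_onto[OF s(1,4,3)] *(1) by auto
        have "obs s \<noteq> 0" using ne s(1,4) \<delta>\<rho>(1) by auto
        then have "\<nu> = s / obs s" using s(3) by (simp add: eq_divide_eq)
        then show "(\<nu>, h) \<in> (\<lambda>\<tau>. (\<sigma> \<tau> / obs (\<sigma> \<tau>), stat (\<sigma> \<tau>))) ` {-\<delta><..<\<delta>}"
          using \<tau> s(2) by (intro image_eqI[of _ _ \<tau>]) auto
      qed
    qed
    have part2: "\<exists>\<epsilon>>0. \<forall>\<nu>\<in>{0..\<nu>s}. \<bar>\<nu> - \<nu>0\<bar> < \<epsilon> \<longrightarrow>
           (\<exists>!h. h \<in> W \<and> \<bar>\<nu> - \<nu>0\<bar> + N 1 (h - h0) \<le> \<delta> \<and> F \<nu> h = 0)" if reg: "\<nu>0 * obs' s0 \<noteq> 1"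
    proof -
      have "conv 1 stat (stat s0) (at s0 within I)"
        by (rule conv_le[OF _ _ stat_continuous[OF s0]]) (auto intro!: eventually_within_I stat_B s0)
      from tendstoD[OF this, of "\<delta> / 2"] \<delta>
      have "\<forall>\<^sub>F s in at s0 within I. dist (N 1 (stat s - stat s0)) 0 < \<delta> / 2" by simp
      then obtain \<kappa> where \<kappa>: "\<kappa> > 0" "\<forall>s\<in>I. s \<noteq> s0 \<and> dist s s0 < \<kappa> \<longrightarrow> dist (N 1 (stat s - stat s0)) 0 < \<delta> / 2"
        unfolding eventually_at by blast
      have "\<exists>\<epsilon>>0. \<forall>\<nu>\<in>{0..\<nu>s}. \<bar>\<nu> - \<nu>0\<bar> < \<epsilon> \<longrightarrow> (\<exists>s\<in>I. \<bar>s - s0\<bar> < \<kappa> \<and> s = \<nu> * obs s)"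
      proof (cases "\<nu>0 > 0")
        case True
        then show ?thesis using nearby_solution[OF s0 s0_eq reg \<rho> ball \<kappa>(1)] by blast
      next
        case 0: False
        then have "\<nu>0 = 0" "s0 = 0" using s0_0 \<nu>0' by auto
        then show ?thesis using nearby_solution_at_0[OF _ _ \<kappa>(1)] s0 False by simp
      qed
      then obtain \<epsilon> where \<epsilon>: "\<epsilon> > 0" "\<And>\<nu>. \<nu> \<in> {0..\<nu>s} \<Longrightarrow> \<bar>\<nu> - \<nu>0\<bar> < \<epsilon> \<Longrightarrow> \<exists>s\<in>I. \<bar>s - s0\<bar> < \<kappa> \<and> s = \<nu> * obs s"
        by blast
      have "\<exists>!h. h \<in> W \<and> \<bar>\<nu> - \<nu>0\<bar> + N 1 (h - h0) \<le> \<delta> \<and> F \<nu> h = 0"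
        if \<nu>: "\<nu> \<in> {0..\<nu>s}" "\<bar>\<nu> - \<nu>0\<bar> < min \<epsilon> (\<delta> / 2)" for \<nu>
      proof -
        obtain s where s: "s \<in> I" "\<bar>s - s0\<bar> < \<kappa>" "s = \<nu> * obs s" using \<epsilon>(2)[OF \<nu>(1)] \<nu>(2) by auto
        have "N 1 (stat s - h0) < \<delta> / 2"
        proof (cases "s = s0")
          case True
          then show ?thesis using \<delta> N_0[of 1] by (simp add: h0_eq)
        next
          case False
          then show ?thesis using \<kappa>(2) s by (auto simp: h0_eq dist_real_def)
        qed
        then have "stat s \<in> W \<and> \<bar>\<nu> - \<nu>0\<bar> + N 1 (stat s - h0) \<le> \<delta> \<and> F \<nu> (stat s) = 0"
          using stat_sol[OF s(1) \<nu>(1) s(3)] \<nu>(2) by auto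
        then show ?thesis using uniq[OF \<delta>\<eta> \<delta>\<eta>' reg \<nu>(1)] by blast
      qed
      then show ?thesis using \<epsilon>(1) \<delta> by (intro exI[of _ "min \<epsilon> (\<delta> / 2)"]) auto
    qed
    have part3: "\<exists>\<nu>\<in>{0<..<\<nu>s}. \<exists>h1\<in>W. \<exists>h2\<in>W. h1 \<noteq> h2 \<and> F \<nu> h1 = 0 \<and> F \<nu> h2 = 0"
      if pos: "\<nu>0 > 0" and crit: "\<nu>0 * obs' s0 = 1"
    proof -
      define A where "A = R s0 (dscale (1/2) (acc s0 (stat s0)) + vel s0 (resp s0)) \<alpha>"
      have "\<Theta> \<nu>0 h0 = resp s0"
        unfolding \<Theta>_def s0_def by (rule Theta_eq[OF Ks \<nu>0'(1) h0(1)[unfolded W_def]])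
      then have "DhhF r T \<alpha> \<beta> B N Ks \<nu>0 h0 (resp s0) (resp s0) \<alpha> \<noteq> 0"
        using nondegenerate crit inv by auto
      then have "A \<noteq> 0"
        unfolding DhhF_eq[OF Ks \<nu>0'(1) h0(1)[unfolded W_def]] s0_def[symmetric] A_def by auto
      from two_solutions[OF s0 s0_eq False pos \<nu>0'(3) crit obs_second_order[OF s0, folded A_def] this]
      obtain \<nu> s1 s2 where \<nu>: "\<nu> \<in> {0<..<\<nu>s}" and s: "s1 \<in> I" "s2 \<in> I" "s1 \<noteq> s2" "s1 = \<nu> * obs s1" "s2 = \<nu> * obs s2"
        by blast
      have \<nu>': "\<nu> \<in> {0..\<nu>s}" using \<nu> by auto
      have "stat s1 \<noteq> stat s2" using s(3,4,5) unfolding obs_def by metis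
      then show ?thesis using stat_sol[OF s(1) \<nu>' s(4)] stat_sol[OF s(2) \<nu>' s(5)] \<nu> by blast
    qed
    show ?thesis
      by (rule exI[of _ \<delta>], intro conjI \<delta> part1 impI) (use part2 part3 inv in auto)
  qed
qed

end

theorem theorem2p11:
  fixes r :: nat
    and T :: "real ^ 'd::finite \<Rightarrow> real ^ 'd"
    and \<alpha> :: "real ^ 'd \<Rightarrow> real"
    and \<beta> :: "real ^ 'd \<Rightarrow> real ^ 'd"
    and TT :: "(real ^ 'd \<Rightarrow> real ^ 'd) set"
    and \<nu>s :: real
    and B :: "nat \<Rightarrow> 'd distr set"
    and N :: "nat \<Rightarrow> 'd distr \<Rightarrow> real"
    and K Cs cbar chat \<theta> :: real
  assumes setting: "mean_field_setting r T \<alpha> \<beta> TT \<nu>s B N K Cs cbar chat \<theta>"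
  shows "\<exists>K0>0. \<forall>Ks\<ge>K0.
    (let W = WW r B N Ks; V = VV B;
         F = FF r T \<alpha> \<beta> B N Ks; \<Theta> = Theta r T \<alpha> \<beta> B N Ks;
         D\<^sub>h = DhF r T \<alpha> \<beta> B N Ks; D\<^sub>\<nu> = DnuF r T \<alpha> \<beta> B N Ks;
         D\<^sub>h\<^sub>h = DhhF r T \<alpha> \<beta> B N Ks
     in \<forall>\<nu>\<^sub>0 h\<^sub>0. \<nu>\<^sub>0 \<in> {0..<\<nu>s} \<and> h\<^sub>0 \<in> W \<and> F \<nu>\<^sub>0 h\<^sub>0 = 0 \<and>
        (invertible_op V (N 1) (D\<^sub>h \<nu>\<^sub>0 h\<^sub>0) \<or>
         (direct_sum_eq (D\<^sub>h \<nu>\<^sub>0 h\<^sub>0 ` V) (range (\<lambda>c. dscale c (D\<^sub>\<nu> \<nu>\<^sub>0 h\<^sub>0))) V \<and>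
          D\<^sub>h\<^sub>h \<nu>\<^sub>0 h\<^sub>0 (\<Theta> \<nu>\<^sub>0 h\<^sub>0) (\<Theta> \<nu>\<^sub>0 h\<^sub>0) \<alpha> \<noteq> 0 \<and>
          h\<^sub>0 \<alpha> \<noteq> 0))
        \<longrightarrow>
        (\<exists>\<delta>>0.
          (\<exists>G hh.
             (\<forall>\<tau>\<in>{-\<delta><..<\<delta>}. G \<tau> \<in> {0..\<nu>s} \<and> hh \<tau> \<in> W \<and>
                G differentiable (at \<tau>) \<and> differentiable_curve (B 1) (N 1) hh \<tau>) \<and>
             G 0 = \<nu>\<^sub>0 \<and> hh 0 = h\<^sub>0 \<and>
             {(\<nu>, h). \<nu> \<in> {0..\<nu>s} \<and> h \<in> W \<and> \<bar>\<nu> - \<nu>\<^sub>0\<bar> + N 1 (h - h\<^sub>0) \<le> \<delta> \<and> F \<nu> h = 0}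
               \<subseteq> (\<lambda>\<tau>. (G \<tau>, hh \<tau>)) ` {-\<delta><..<\<delta>}) \<and>
          (invertible_op V (N 1) (D\<^sub>h \<nu>\<^sub>0 h\<^sub>0) \<longrightarrow>
             (\<exists>\<epsilon>>0. \<forall>\<nu>\<in>{0..\<nu>s}. \<bar>\<nu> - \<nu>\<^sub>0\<bar> < \<epsilon> \<longrightarrow>
                (\<exists>!h. h \<in> W \<and> \<bar>\<nu> - \<nu>\<^sub>0\<bar> + N 1 (h - h\<^sub>0) \<le> \<delta> \<and> F \<nu> h = 0))) \<and>
          (\<nu>\<^sub>0 > 0 \<and> \<not> invertible_op V (N 1) (D\<^sub>h \<nu>\<^sub>0 h\<^sub>0) \<longrightarrow>
             (\<exists>\<nu>\<in>{0<..<\<nu>s}. \<exists>h\<^sub>1\<in>W. \<exists>h\<^sub>2\<in>W. h\<^sub>1 \<noteq> h\<^sub>2 \<and> F \<nu> h\<^sub>1 = 0 \<and> F \<nu> h\<^sub>2 = 0))))"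
proof -
  interpret mean_field_setting r T \<alpha> \<beta> TT \<nu>s B N K Cs cbar chat \<theta> by (rule setting)
  \<comment> \<open>Any bound for all invariant distributions will do; it does not depend on the given solution.\<close>
  obtain K0 where K0: "K0 > 0" "\<forall>u\<in>I. N 1 (stat u) \<le> K0" using stat_bound by blast
  show ?thesis
    unfolding Let_def
    by (rule exI[of _ K0], rule conjI[OF K0(1)], intro allI impI, rule solution_branch)
       (use K0(2) in \<open>auto intro: order_trans\<close>)
qed

end
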